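(* Let $\mathcal G_1$ be a finite simple graph all of whose vertices have degree at least $2$, let $\mathcal G_\infty$ be the associated continuous graph with edges of length $1$, and for a positive integer $N$ let $\mathcal G_N$ be the $N$-fold refinement of $\mathcal G_1$, with vertex space $\mathbb H_N$ and operator $\Delta_N$. The discrete Fourier transform $\mathcal F_N:\mathbb H_N\to \mathbb C^{I_0}\oplus\bigoplus_{m,k}\mathbb C^{I_k}$ satisfies $$\mathcal F_N(\Delta_N f)=\{\mu_{m,k}\,\mathcal F_N(f)_{m,k}\},$$ and is an isometry if the $m$-th copy $\mathbb C^{I_k}_m$ of $\mathbb C^{I_k}$ has the $B(\omega_{m,k})$ inner product. If $N$ is a power of $2$, then $\mathcal F_N(f)$ can be computed in time $O(N\log_2 N)$.
   Context: Continuous graph. $\mathcal G_1$ has $N_{\mathcal E}$ edges. Each edge $e$ is identified with $[0,1]$, endpoints being identified with the end vertices of $e$; the result is the continuous graph $\mathcal G_\infty$. $L^2(\mathcal G_\infty)=\bigoplus_e L^2[0,1]$ carries the inner product $\langle f,g\rangle_\infty=\frac1{N_{\mathcal E}}\sum_e\int_0^1 f_e\overline{g_e}\,dx$. The operator $\Delta_\infty f=-f''$ has as domain all $f\in L^2(\mathcal G_\infty)$ with $f_e'$ absolutely continuous on each edge, $f''\in L^2(\mathcal G_\infty)$, $f$ continuous at each vertex, and $\sum_{e\sim v}\partial_\nu f_e(v)=0$ at each vertex $v$ (sum over incident edges), where $\partial_\nu f_e(v)=f_e'(0)$ if $v$ is the endpoint $0$ of $e$ and $-f_e'(1)$ if $v$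 is the endpoint $1$. It is self adjoint and nonnegative with compact resolvent; $E(\lambda)$ is its $\lambda$ eigenspace. Refinement. $\mathcal G_N$ is the discrete graph obtained by subdividing each edge $e\cong[0,1]$ of $\mathcal G_1$ into $N$ edges with the points $x_n=n/N$, $0\le n\le N$; its vertices are those of $\mathcal G_1$ and the points $x_1,\dots,x_{N-1}$ on each edge, $x_n$ being adjacent to $x_{n\pm1}$ along the edge. $\mathbb H_N$ is the space of functions from the vertices of $\mathcal G_N$ to $\mathbb C$, with inner product $\langle f,g\rangle_N=\frac1{2NN_{\mathcal E}}\sum_v \deg(v)f(v)\overline{g(v)}$. $\Delta_N=N^2(I-T^{-1}A)$ on $\mathbb H_N$, where $Af(v)=\sum_{u\text{ adjacent to }v}f(u)$ and $Tf(v)=\deg(v)f(v)$ in $\mathcal G_N$. $R_N$ denotes restriction of functions on $\mathcal G_\infty$ to the vertices of $\mathcal G_N$. Bases. Let $0<\omega_{0,1}<\omega_{0,2}<\dots\le 2\pi$ be the square roots of the $K$ distinct eigenvalues of $\Delta_\infty$ in $(0,(2\pi)^2]$. For each $k$ pick an orthonormal basis $\Psi_j(\omega_{0,k})$, $j=1,\dots,I_k=\dim E(\omega_{0,k}^2)$, of $E(\omega_{0,k}^2)$. On each edge $\Psi_j(\omega_{0,k})=A_e e^{i\omega_{0,k}x}+B_e e^{-i\omega_{0,k}x}$ (coefficients depending on $j,k$). For $m\ge1$ let $\omega_{m,k}=\omega_{0,k}+2m\pi$ and let $\Psi_j(\omega_{m,k})$ be the function equal on each edge to $A_e e^{i\omega_{m,k}x}+B_e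 e^{-i\omega_{m,k}x}$, with the same $A_e,B_e$; these form a basis of $E(\omega_{m,k}^2)$. Let $\Phi(\omega_{m,k})$ be the family $\Phi_j(\omega_{m,k})=R_N\Psi_j(\omega_{m,k})$, $j=1,\dots,I_k$, regarded as a basis for the $\mu_{m,k}$ eigenspace of $\Delta_N$, where $\mu_{m,k}=N^2(1-\cos(\omega_{m,k}/N))$. Let $I_0=\dim E(0)$. Discrete Fourier transform. $\mathcal F_N(f)=\{\langle f,\Phi_j(\omega_{m,k})\rangle_N\}$, $\omega_{m,k}\le N\pi$ (for even $N$ this means $m=0,\dots,N/2-1$); $\mathcal F_N(f)_{m,k}\in\mathbb C^{I_k}$ is the vector of these numbers for fixed $m,k$. The summand $\mathbb C^{I_0}$ holds the inner products of $f$ with the restrictions of an orthonormal basis of $E(0)$; it corresponds to the eigenvalue $0$ of $\Delta_N$ and carries the usual inner product. $B(\omega_{m,k})$ inner product. $B=B(\omega_{m,k})=(b_{ij})$ is a matrix taking the basis $\Phi(\omega_{m,k})$ to an orthonormal basis $\eta_i=\sum_j b_{ij}\Phi_j(\omega_{m,k})$ for the same eigenspace in $\mathbb H_N$. The $B(\omega_{m,k})$ inner product of $X,Y\in\mathbb C^{I_k}$ is $(\overline B X)\bullet(\overline B Y)$, where $\overline B$ is the entrywise complex conjugate and $X\bullet Y=\sum_j x_j\overline{y_j}$. In the time bound the graph $\mathcal G_1$ and the bases $\Psi(\omega_{0,k})$ are fixed, so the number of edges and of indices $k$ is constant.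
   Formalization: At ω_{m,k}=Nπ (which occurs for every even N) the restricted family Φ only spans the eigenspace, so there B may have fewer rows than columns and the B inner product may be only semidefinite; for ω_{m,k}<Nπ, B is square as stated. *)

theory Defs
  imports "HOL-Analysis.Analysis"
begin

section \<open>The graph and its edge coordinates\<close>

text \<open>
  An edge is a two-element vertex set. Identifying an edge \<open>e\<close> with \<open>[0,1]\<close> amounts to choosing
  which end is \<open>0\<close> (\<open>end0 G e\<close>) and which is \<open>1\<close> (\<open>end1 G e\<close>); the choice is arbitrary.
\<close>

record 'v mgraph =
  verts :: "'v set"
  edges :: "'v set set"
  end0 :: "'v set \<Rightarrow> 'v"
  end1 :: "'v set \<Rightarrow> 'v"

definition finite_simple_graph :: "'v mgraph \<Rightarrow> bool" where
  "finite_simple_graph G \<longleftrightarrow>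
     finite (verts G) \<and>
     (\<forall>e\<in>edges G. e \<subseteq> verts G \<and> card e = 2 \<and> e = {end0 G e, end1 G e})"

definition incident_edges :: "'v mgraph \<Rightarrow> 'v \<Rightarrow> 'v set set" where
  "incident_edges G v = {e \<in> edges G. v \<in> e}"

definition endpoint :: "'v mgraph \<Rightarrow> 'v set \<Rightarrow> real \<Rightarrow> 'v" where
  "endpoint G e t = (if t = 0 then end0 G e else end1 G e)"

section \<open>Orthonormal bases of spaces of complex functions\<close>

text \<open>
  The third argument is the dimension: \<open>is_onb ip S n \<phi>\<close> says that \<open>\<phi> 1, \<dots>, \<phi> n\<close> is an orthonormal
  basis of \<open>S\<close>, so it can only hold when \<open>S\<close> has dimension \<open>n\<close>.
\<close>

definition is_onb ::
  "(('x \<Rightarrow> complex) \<Rightarrow> ('x \<Rightarrow> complex) \<Rightarrow> complex) \<Rightarrow> ('x \<Rightarrow> complex) set \<Rightarrow> nat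
    \<Rightarrow> (nat \<Rightarrow> 'x \<Rightarrow> complex) \<Rightarrow> bool" where
  "is_onb ip S n \<phi> \<longleftrightarrow>
     (\<forall>i\<in>{1..n}. \<phi> i \<in> S) \<and>
     (\<forall>i\<in>{1..n}. \<forall>j\<in>{1..n}. ip (\<phi> i) (\<phi> j) = (if i = j then 1 else 0)) \<and>
     (\<forall>f\<in>S. \<exists>c. f = (\<lambda>x. \<Sum>j=1..n. c j * \<phi> j x))"

section \<open>The continuous graph\<close>

text \<open>
  A function on the continuous graph is a function of an edge and a coordinate. The members of the
  domain of the Laplacian have a unique continuous representative; it is normalised to vanish
  outside \<open>edges G \<times> [0,1]\<close>, so that linear combinations can be compared by equality.
\<close>

type_synonym 'v gfun = "'v set \<times> real \<Rightarrow> complex"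

definition L2_unit :: "(real \<Rightarrow> complex) \<Rightarrow> bool" where
  "L2_unit h \<longleftrightarrow> h \<in> borel_measurable (lebesgue_on {0..1}) \<and>
     integrable (lebesgue_on {0..1}) (\<lambda>x. (cmod (h x))\<^sup>2)"

definition inner_inf :: "'v mgraph \<Rightarrow> 'v gfun \<Rightarrow> 'v gfun \<Rightarrow> complex" where
  "inner_inf G f g =
     (\<Sum>e\<in>edges G. integral\<^sup>L (lebesgue_on {0..1}) (\<lambda>x. f (e, x) * cnj (g (e, x))))
       / of_nat (card (edges G))"

definition absolutely_continuous_on_interval :: "(real \<Rightarrow> complex) \<Rightarrow> real \<Rightarrow> real \<Rightarrow> bool" where
  "absolutely_continuous_on_interval h a b \<longleftrightarrow>
     (\<forall>\<epsilon>>0. \<exists>\<delta>>0. \<forall>D :: (real \<times> real) set.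
        finite D \<and> (\<forall>(s, t)\<in>D. a \<le> s \<and> s \<le> t \<and> t \<le> b) \<and>
        (\<forall>p\<in>D. \<forall>q\<in>D. p \<noteq> q \<longrightarrow> {fst p<..<snd p} \<inter> {fst q<..<snd q} = {}) \<and>
        (\<Sum>(s, t)\<in>D. t - s) < \<delta>
        \<longrightarrow> (\<Sum>(s, t)\<in>D. cmod (h t - h s)) < \<epsilon>)"

text \<open>
  Derivatives are one-sided at the ends of \<open>[0,1]\<close>. The function \<open>edge_deriv (edge_deriv f)\<close> is
  meaningful only where \<open>f'\<close> is differentiable; below this is almost everywhere, because \<open>f'\<close> is
  absolutely continuous.
\<close>

definition edge_deriv :: "'v gfun \<Rightarrow> 'v gfun" where
  "edge_deriv f = (\<lambda>(e, x). vector_derivative (\<lambda>y. f (e, y)) (at x within {0..1}))"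

definition normal_deriv :: "'v mgraph \<Rightarrow> 'v gfun \<Rightarrow> 'v set \<Rightarrow> 'v \<Rightarrow> complex" where
  "normal_deriv G f e v = (if v = end0 G e then edge_deriv f (e, 0) else - edge_deriv f (e, 1))"

definition dom_Delta_inf :: "'v mgraph \<Rightarrow> 'v gfun set" where
  "dom_Delta_inf G = {f.
     (\<forall>e x. \<not> (e \<in> edges G \<and> x \<in> {0..1}) \<longrightarrow> f (e, x) = 0) \<and>
     (\<forall>e\<in>edges G.
        L2_unit (\<lambda>x. f (e, x)) \<and>
        (\<forall>x\<in>{0..1}. (\<lambda>y. f (e, y)) differentiable (at x within {0..1})) \<and>
        absolutely_continuous_on_interval (\<lambda>x. edge_deriv f (e, x)) 0 1 \<and>
        L2_unit (\<lambda>x. edge_deriv (edge_deriv f) (e, x))) \<and>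
     (\<forall>e\<in>edges G. \<forall>e'\<in>edges G. \<forall>t\<in>{0, 1}. \<forall>t'\<in>{0, 1}.
        endpoint G e t = endpoint G e' t' \<longrightarrow> f (e, t) = f (e', t')) \<and>
     (\<forall>v\<in>verts G. (\<Sum>e\<in>incident_edges G v. normal_deriv G f e v) = 0)}"

definition Delta_inf :: "'v gfun \<Rightarrow> 'v gfun" where
  "Delta_inf f = (\<lambda>p. - edge_deriv (edge_deriv f) p)"

definition eigenspace_inf :: "'v mgraph \<Rightarrow> real \<Rightarrow> 'v gfun set" where
  "eigenspace_inf G \<nu> = {f \<in> dom_Delta_inf G.
     \<forall>e\<in>edges G. AE x in lebesgue_on {0..1}. Delta_inf f (e, x) = of_real \<nu> * f (e, x)}"

definition eigenvalue_inf :: "'v mgraph \<Rightarrow> real \<Rightarrow> bool" where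
  "eigenvalue_inf G \<nu> \<longleftrightarrow> (\<exists>f\<in>eigenspace_inf G \<nu>. f \<noteq> (\<lambda>_. 0))"

definition edge_wave ::
  "'v mgraph \<Rightarrow> ('v set \<Rightarrow> complex) \<Rightarrow> ('v set \<Rightarrow> complex) \<Rightarrow> real \<Rightarrow> 'v gfun" where
  "edge_wave G A B \<omega> = (\<lambda>(e, x).
     if e \<in> edges G \<and> x \<in> {0..1}
     then A e * exp (\<i> * of_real (\<omega> * x)) + B e * exp (- \<i> * of_real (\<omega> * x)) else 0)"

section \<open>The refinements\<close>

datatype 'v rvertex = Old 'v | New "'v set" nat

definition subdiv_point :: "'v mgraph \<Rightarrow> nat \<Rightarrow> 'v set \<Rightarrow> nat \<Rightarrow> 'v rvertex" where
  "subdiv_point G N e n =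
     (if n = 0 then Old (end0 G e) else if n = N then Old (end1 G e) else New e n)"

definition rverts :: "'v mgraph \<Rightarrow> nat \<Rightarrow> 'v rvertex set" where
  "rverts G N = Old ` verts G \<union> {New e n |e n. e \<in> edges G \<and> 0 < n \<and> n < N}"

definition radj :: "'v mgraph \<Rightarrow> nat \<Rightarrow> 'v rvertex \<Rightarrow> 'v rvertex set" where
  "radj G N v = {u. \<exists>e\<in>edges G. \<exists>n<N. {u, v} = {subdiv_point G N e n, subdiv_point G N e (Suc n)}}"

definition rdeg :: "'v mgraph \<Rightarrow> nat \<Rightarrow> 'v rvertex \<Rightarrow> nat" where
  "rdeg G N v = card (radj G N v)"

definition HN :: "'v mgraph \<Rightarrow> nat \<Rightarrow> ('v rvertex \<Rightarrow> complex) set" where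
  "HN G N = {f. \<forall>v. v \<notin> rverts G N \<longrightarrow> f v = 0}"

definition inner_N ::
  "'v mgraph \<Rightarrow> nat \<Rightarrow> ('v rvertex \<Rightarrow> complex) \<Rightarrow> ('v rvertex \<Rightarrow> complex) \<Rightarrow> complex" where
  "inner_N G N f g =
     (\<Sum>v\<in>rverts G N. of_nat (rdeg G N v) * f v * cnj (g v)) / of_nat (2 * N * card (edges G))"

definition Delta_N ::
  "'v mgraph \<Rightarrow> nat \<Rightarrow> ('v rvertex \<Rightarrow> complex) \<Rightarrow> ('v rvertex \<Rightarrow> complex)" where
  "Delta_N G N f = (\<lambda>v.
     if v \<in> rverts G N
     then (of_nat N)\<^sup>2 * (f v - (\<Sum>u\<in>radj G N v. f u) / of_nat (rdeg G N v)) else 0)"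

definition eigenspace_N :: "'v mgraph \<Rightarrow> nat \<Rightarrow> real \<Rightarrow> ('v rvertex \<Rightarrow> complex) set" where
  "eigenspace_N G N \<mu> = {f \<in> HN G N. Delta_N G N f = (\<lambda>v. of_real \<mu> * f v)}"

text \<open>
  A vertex of the refinement may lie on several edges; for functions continuous at the vertices,
  the only ones to which \<open>restrict_N\<close> is applied, the choice of edge does not matter.
\<close>

definition restrict_N :: "'v mgraph \<Rightarrow> nat \<Rightarrow> 'v gfun \<Rightarrow> ('v rvertex \<Rightarrow> complex)" where
  "restrict_N G N f = (\<lambda>v.
     if v \<in> rverts G N
     then (let (e, n) = (SOME (e, n). e \<in> edges G \<and> n \<le> N \<and> subdiv_point G N e n = v)
           in f (e, real n / real N))
     else 0)"

section \<open>The discrete Fourier transform\<close>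

text \<open>
  \<open>\<omega>0 1, \<dots>, \<omega>0 K\<close> are the base frequencies. The coefficients of \<open>\<Psi>\<^sub>j(\<omega>\<^sub>0\<^sub>,\<^sub>k)\<close> are
  \<open>A k j\<close> and \<open>B k j\<close>, and \<open>\<psi>0\<close> is a basis of the kernel of the Laplacian.
\<close>

definition freq :: "(nat \<Rightarrow> real) \<Rightarrow> nat \<Rightarrow> nat \<Rightarrow> real" where
  "freq \<omega>0 m k = \<omega>0 k + 2 * real m * pi"

definition mu :: "nat \<Rightarrow> (nat \<Rightarrow> real) \<Rightarrow> nat \<Rightarrow> nat \<Rightarrow> real" where
  "mu N \<omega>0 m k = (real N)\<^sup>2 * (1 - cos (freq \<omega>0 m k / real N))"

definition dft_index :: "nat \<Rightarrow> nat \<Rightarrow> (nat \<Rightarrow> real) \<Rightarrow> (nat \<times> nat) set" where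
  "dft_index N K \<omega>0 = {(m, k). k \<in> {1..K} \<and> freq \<omega>0 m k \<le> real N * pi}"

definition Phi ::
  "'v mgraph \<Rightarrow> nat \<Rightarrow> (nat \<Rightarrow> real) \<Rightarrow> (nat \<Rightarrow> nat \<Rightarrow> 'v set \<Rightarrow> complex)
    \<Rightarrow> (nat \<Rightarrow> nat \<Rightarrow> 'v set \<Rightarrow> complex) \<Rightarrow> nat \<Rightarrow> nat \<Rightarrow> nat \<Rightarrow> ('v rvertex \<Rightarrow> complex)" where
  "Phi G N \<omega>0 A B m k j = restrict_N G N (edge_wave G (A k j) (B k j) (freq \<omega>0 m k))"

definition dft ::
  "'v mgraph \<Rightarrow> nat \<Rightarrow> (nat \<Rightarrow> real) \<Rightarrow> (nat \<Rightarrow> nat \<Rightarrow> 'v set \<Rightarrow> complex)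
    \<Rightarrow> (nat \<Rightarrow> nat \<Rightarrow> 'v set \<Rightarrow> complex) \<Rightarrow> ('v rvertex \<Rightarrow> complex) \<Rightarrow> nat \<Rightarrow> nat \<Rightarrow> nat \<Rightarrow> complex"
  where
  "dft G N \<omega>0 A B f m k j = inner_N G N f (Phi G N \<omega>0 A B m k j)"

definition dft_zero ::
  "'v mgraph \<Rightarrow> nat \<Rightarrow> (nat \<Rightarrow> 'v gfun) \<Rightarrow> ('v rvertex \<Rightarrow> complex) \<Rightarrow> nat \<Rightarrow> complex" where
  "dft_zero G N \<psi>0 f j = inner_N G N f (restrict_N G N (\<psi>0 j))"

text \<open>
  The rows of \<open>b\<close> are indexed by \<open>1..d\<close>, its columns by \<open>1..I k\<close>. For \<open>\<omega>\<^sub>m\<^sub>,\<^sub>k < N\<pi>\<close> the family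
  \<open>\<Phi>(\<omega>\<^sub>m\<^sub>,\<^sub>k)\<close> is linearly independent and \<open>b\<close> is square. At \<open>\<omega>\<^sub>m\<^sub>,\<^sub>k = N\<pi>\<close> (which occurs
  for every even \<open>N\<close>) the functions \<open>sin (N\<pi>x)\<close> vanish at all points \<open>n/N\<close>, so \<open>\<Phi>(\<omega>\<^sub>m\<^sub>,\<^sub>k)\<close> still
  spans the eigenspace but can be linearly dependent; \<open>b\<close> then has fewer rows than columns.
\<close>

definition is_B_matrix ::
  "'v mgraph \<Rightarrow> nat \<Rightarrow> (nat \<Rightarrow> real) \<Rightarrow> (nat \<Rightarrow> nat \<Rightarrow> 'v set \<Rightarrow> complex)
    \<Rightarrow> (nat \<Rightarrow> nat \<Rightarrow> 'v set \<Rightarrow> complex) \<Rightarrow> (nat \<Rightarrow> nat) \<Rightarrow> nat \<Rightarrow> nat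
    \<Rightarrow> nat \<Rightarrow> (nat \<Rightarrow> nat \<Rightarrow> complex) \<Rightarrow> bool" where
  "is_B_matrix G N \<omega>0 A B I m k d b \<longleftrightarrow>
     (freq \<omega>0 m k < real N * pi \<longrightarrow> d = I k) \<and>
     is_onb (inner_N G N) (eigenspace_N G N (mu N \<omega>0 m k)) d
       (\<lambda>i v. \<Sum>j=1..I k. b i j * Phi G N \<omega>0 A B m k j v)"

definition B_inner ::
  "nat \<Rightarrow> nat \<Rightarrow> (nat \<Rightarrow> nat \<Rightarrow> complex) \<Rightarrow> (nat \<Rightarrow> complex) \<Rightarrow> (nat \<Rightarrow> complex) \<Rightarrow> complex" where
  "B_inner d n b X Y =
     (\<Sum>i=1..d. (\<Sum>j=1..n. cnj (b i j) * X j) * cnj (\<Sum>j=1..n. cnj (b i j) * Y j))"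

section \<open>The computational model\<close>

text \<open>
  Running time is measured on a random access machine with unit-cost exact complex arithmetic
  and exponential. The machine has index registers holding natural numbers, numbered by \<open>nat\<close>,
  and arrays of complex numbers, named by the elements of \<open>'a\<close>. The operand \<open>(a, r)\<close> denotes the
  cell of array \<open>a\<close> whose position is the content of register \<open>r\<close>. A program is a finite object
  containing finitely many constants and may not inspect complex values, so its control flow
  depends on the index registers only.
\<close>

datatype 'a instr =
    Nat_Const nat nat
  | Nat_Add nat nat nat
  | Nat_Sub nat nat nat
  | Nat_Half nat nat
  | Cx_Const "'a \<times> nat" complex
  | Cx_Of_Nat "'a \<times> nat" nat
  | Cx_Copy "'a \<times> nat" "'a \<times> nat"
  | Cx_Add "'a \<times> nat" "'a \<times> nat" "'a \<times> nat"
  | Cx_Sub "'a \<times> nat" "'a \<times> nat" "'a \<times> nat"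
  | Cx_Mult "'a \<times> nat" "'a \<times> nat" "'a \<times> nat"
  | Cx_Div "'a \<times> nat" "'a \<times> nat" "'a \<times> nat"
  | Cx_Exp "'a \<times> nat" "'a \<times> nat"

datatype 'a prog =
    Instr "'a instr"
  | Seq "'a prog" "'a prog"
  | While_Less nat nat "'a prog"

type_synonym 'a state = "(nat \<Rightarrow> nat) \<times> ('a \<Rightarrow> nat \<Rightarrow> complex)"

definition cell :: "'a state \<Rightarrow> 'a \<times> nat \<Rightarrow> complex" where
  "cell s p = snd s (fst p) (fst s (snd p))"

definition set_reg :: "'a state \<Rightarrow> nat \<Rightarrow> nat \<Rightarrow> 'a state" where
  "set_reg s r n = ((fst s)(r := n), snd s)"

definition set_cell :: "'a state \<Rightarrow> 'a \<times> nat \<Rightarrow> complex \<Rightarrow> 'a state" where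
  "set_cell s p z = (fst s, (snd s)(fst p := (snd s (fst p))(fst s (snd p) := z)))"

fun run_instr :: "'a instr \<Rightarrow> 'a state \<Rightarrow> 'a state" where
  "run_instr (Nat_Const r n) s = set_reg s r n"
| "run_instr (Nat_Add r p q) s = set_reg s r (fst s p + fst s q)"
| "run_instr (Nat_Sub r p q) s = set_reg s r (fst s p - fst s q)"
| "run_instr (Nat_Half r p) s = set_reg s r (fst s p div 2)"
| "run_instr (Cx_Const x c) s = set_cell s x c"
| "run_instr (Cx_Of_Nat x r) s = set_cell s x (of_nat (fst s r))"
| "run_instr (Cx_Copy x y) s = set_cell s x (cell s y)"
| "run_instr (Cx_Add x y z) s = set_cell s x (cell s y + cell s z)"
| "run_instr (Cx_Sub x y z) s = set_cell s x (cell s y - cell s z)"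
| "run_instr (Cx_Mult x y z) s = set_cell s x (cell s y * cell s z)"
| "run_instr (Cx_Div x y z) s = set_cell s x (cell s y / cell s z)"
| "run_instr (Cx_Exp x y) s = set_cell s x (exp (cell s y))"

text \<open>
  \<open>runs P s t s'\<close>: started in \<open>s\<close>, the program \<open>P\<close> halts in \<open>s'\<close> after exactly \<open>t\<close> steps, every
  instruction and every evaluation of a loop condition counting as one step.
\<close>

inductive runs :: "'a prog \<Rightarrow> 'a state \<Rightarrow> nat \<Rightarrow> 'a state \<Rightarrow> bool" where
  instr: "runs (Instr i) s 1 (run_instr i s)"
| seq: "runs P s t s' \<Longrightarrow> runs Q s' t' s'' \<Longrightarrow> runs (Seq P Q) s (t + t') s''"
| while_done: "\<not> fst s p < fst s q \<Longrightarrow> runs (While_Less p q P) s 1 s"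
| while_step: "fst s p < fst s q \<Longrightarrow> runs P s t s' \<Longrightarrow> runs (While_Less p q P) s' t' s''
    \<Longrightarrow> runs (While_Less p q P) s (1 + t + t') s''"

text \<open>
  Input and output of the transform. Since \<open>G\<close> and the numbers \<open>K\<close>, \<open>I k\<close> are fixed, a program can
  name the vertices and edges of \<open>G\<close> and the pairs \<open>(k, j)\<close>. Initially register \<open>0\<close> holds \<open>N\<close>,
  \<open>f\<close> is stored in the input arrays, and everything else is zero.
\<close>

datatype 'v array =
    In_Vertex 'v
  | In_Edge "'v set"
  | Out_Zero nat
  | Out nat nat
  | Work nat

fun input_memory :: "('v rvertex \<Rightarrow> complex) \<Rightarrow> 'v array \<Rightarrow> nat \<Rightarrow> complex" where
  "input_memory f (In_Vertex v) n = (if n = 0 then f (Old v) else 0)"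
| "input_memory f (In_Edge e) n = f (New e n)"
| "input_memory f (Out_Zero j) n = 0"
| "input_memory f (Out k j) n = 0"
| "input_memory f (Work i) n = 0"

definition input_state :: "nat \<Rightarrow> ('v rvertex \<Rightarrow> complex) \<Rightarrow> 'v array state" where
  "input_state N f = ((\<lambda>r. if r = 0 then N else 0), input_memory f)"

definition holds_dft ::
  "'v mgraph \<Rightarrow> nat \<Rightarrow> nat \<Rightarrow> (nat \<Rightarrow> real) \<Rightarrow> nat \<Rightarrow> (nat \<Rightarrow> nat) \<Rightarrow> (nat \<Rightarrow> 'v gfun)
    \<Rightarrow> (nat \<Rightarrow> nat \<Rightarrow> 'v set \<Rightarrow> complex) \<Rightarrow> (nat \<Rightarrow> nat \<Rightarrow> 'v set \<Rightarrow> complex)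
    \<Rightarrow> ('v rvertex \<Rightarrow> complex) \<Rightarrow> 'v array state \<Rightarrow> bool" where
  "holds_dft G N K \<omega>0 I0 I \<psi>0 A B f s \<longleftrightarrow>
     (\<forall>j\<in>{1..I0}. snd s (Out_Zero j) 0 = dft_zero G N \<psi>0 f j) \<and>
     (\<forall>(m, k)\<in>dft_index N K \<omega>0. \<forall>j\<in>{1..I k}. snd s (Out k j) m = dft G N \<omega>0 A B f m k j)"

end

theory Submission
  imports Defs "HOL-Computational_Algebra.Fundamental_Theorem_Algebra"
begin

text \<open>
  A wave \<open>A e\<^sup>i\<^sup>\<omega>\<^sup>x + B e\<^sup>-\<^sup>i\<^sup>\<omega>\<^sup>x\<close> sampled at the points \<open>n/N\<close> of an edge satisfies
  \<open>f(n-1) + f(n+1) = 2 cos(\<omega>/N) f(n)\<close>, and at a vertex the sum of the neighbouring samples is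
  \<open>deg(v) cos(\<omega>/N) f(v)\<close> plus a multiple of \<open>sin(\<omega>/N)\<close> times the sum of the normal derivatives. Hence
  sampling maps \<open>E(\<omega>\<^sup>2)\<close> to the eigenspace of \<open>\<Delta>\<^sub>N\<close> for \<open>N\<^sup>2(1 - cos(\<omega>/N))\<close>, and for \<open>0 < \<omega> < N\<pi>\<close> every
  eigenfunction of \<open>\<Delta>\<^sub>N\<close> extends uniquely to a wave. For \<open>\<omega> = N\<pi>\<close>, and for the eigenvalue 0, an
  extension exists because the energies \<open>\<Sum> |f(u) + f(v)|\<^sup>2\<close> and \<open>\<Sum> |f(u) - f(v)|\<^sup>2\<close> over all adjacent
  \<open>u\<close>, \<open>v\<close> vanish. The vertex conditions depend on \<open>\<omega>\<close> only through \<open>e\<^sup>i\<^sup>\<omega>\<close>, which explains the shifts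
  by \<open>2m\<pi>\<close>. As \<open>\<Delta>\<^sub>N\<close> is self-adjoint, its eigenspaces exhaust \<open>H\<^sub>N\<close> and the isometry is Parseval's identity.

  On an edge, the inner products with a wave for all \<open>m\<close> are given by two discrete Fourier
  transforms of length \<open>N\<close>, one of them reflected by \<open>n \<mapsto> N - n\<close>. By linearity the inputs of all edges
  and vertices are added up first, so each pair \<open>(k, j)\<close> costs a single fast Fourier transform.
\<close>

text \<open>No dimensions are counted. Nonnegativity of the two energies confines every eigenvalue
  of \<open>Delta_N\<close> to [0, 2 N^2], hence to the form N^2 (1 - cos \<theta>) with 0 \<le>
  \<theta> \<le> pi. Removing multiples of 2 pi from N \<theta> lands in (0, 2 pi], where
  \<open>freq_all\<close> lists every frequency; injectivity of cos on [0, pi] keeps the eigenvalues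
  with \<omega> \<le> N pi apart. The eigenvalue 0 is the delicate one: the explicit form of the
  basis functions is given for positive frequencies only, and the equation f'' = 0 holds only almost
  everywhere. Once its eigenfunctions are known to be constant on the edges, trapezoidal sums equal
  integrals, so sampling keeps that basis orthonormal and this summand carries the usual inner
  product. One FFT serves all m because a shift by 2 m pi multiplies the two halves of a wave at n/N
  by exp (2 pi i m n/N) and its conjugate and leaves the values at the vertices unchanged.\<close>

section \<open>Linear algebra\<close>

text \<open>Gaussian elimination: equation \<open>i\<close> is solved for an unknown
  \<open>k\<close> with nonzero coefficient, which leaves one equation and one unknown fewer. The
  lemma supplies the dependence of Krylov vectors and the combination of cut pieces in
  \<open>kernel_edge_deriv_constant\<close>.\<close>

lemma homogeneous_system_nontrivial:
  fixes a :: "'i \<Rightarrow> 'j \<Rightarrow> 'a::field"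
  assumes "finite E" "finite J" "card E < card J"
  shows "\<exists>c. (\<exists>j\<in>J. c j \<noteq> 0) \<and> (\<forall>i\<in>E. (\<Sum>j\<in>J. a i j * c j) = 0)"
  using assms
proof (induction E arbitrary: J a rule: finite_induct)
  case empty
  then have "J \<noteq> {}" by auto
  then show ?case by (intro exI[of _ "\<lambda>_. 1"]) auto
next
  case (insert i E)
  show ?case
  proof (cases "\<forall>j\<in>J. a i j = 0")
    case True
    obtain c where "\<exists>j\<in>J. c j \<noteq> 0" "\<forall>i\<in>E. (\<Sum>j\<in>J. a i j * c j) = 0"
      using insert.IH[of J a] insert by (metis card_insert_disjoint Suc_lessD)
    then show ?thesis using True by (intro exI[of _ c]) auto
  next
    case False
    then obtain k where k: "k \<in> J" "a i k \<noteq> 0" by auto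
    define J' where "J' = J - {k}"
    have J': "finite J'" "card E < card J'" and J: "J = insert k J'" "k \<notin> J'"
      using insert k by (auto simp: J'_def)
    obtain c where c: "\<exists>j\<in>J'. c j \<noteq> 0"
        "\<forall>l\<in>E. (\<Sum>j\<in>J'. (a l j - a l k * a i j / a i k) * c j) = 0"
      using insert.IH[OF J', of "\<lambda>l j. a l j - a l k * a i j / a i k"] by auto
    define s where "s = (\<Sum>j\<in>J'. a i j * c j)"
    define c' where "c' = c(k := - s / a i k)"
    have sum: "(\<Sum>j\<in>J. a l j * c' j) = (\<Sum>j\<in>J'. a l j * c j) - a l k * s / a i k" for l
    proof -
      have "(\<Sum>j\<in>J'. a l j * c' j) = (\<Sum>j\<in>J'. a l j * c j)"
        using J(2) by (intro sum.cong) (auto simp: c'_def)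
      then show ?thesis using J J'(1) by (simp add: c'_def)
    qed
    have "(\<Sum>j\<in>J. a l j * c' j) = 0" if "l \<in> insert i E" for l
    proof (cases "l = i")
      case True
      then show ?thesis using k unfolding sum by (simp add: s_def)
    next
      case False
      then have "(\<Sum>j\<in>J'. a l j * c j) - (\<Sum>j\<in>J'. a l k * a i j / a i k * c j) = 0"
        using c(2) that by (simp add: left_diff_distrib sum_subtractf)
      moreover have "(\<Sum>j\<in>J'. a l k * a i j / a i k * c j) = a l k * s / a i k"
        unfolding s_def sum_distrib_left sum_divide_distrib by (intro sum.cong) auto
      ultimately show ?thesis unfolding sum by simp
    qed
    moreover have "\<exists>j\<in>J. c' j \<noteq> 0" using c(1) J by (auto simp: c'_def)
    ultimately show ?thesis by blast
  qed
qed

lemma sum_Suc_if: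
  fixes c f :: "nat \<Rightarrow> 'a::comm_semiring_1"
  shows "(\<Sum>j=1..Suc n. (if j = Suc n then a else c j) * f j) = (\<Sum>j=1..n. c j * f j) + a * f (Suc n)"
proof -
  have "(\<Sum>j=1..n. (if j = Suc n then a else c j) * f j) = (\<Sum>j=1..n. c j * f j)"
    by (rule sum.cong) auto
  then show ?thesis by (simp only: sum.cl_ivl_Suc) simp
qed

section \<open>Functions on a finite set with a weighted inner product\<close>

locale weighted_functions =
  fixes V :: "'x set" and w :: "'x \<Rightarrow> real"
  assumes finite_V: "finite V" and w_pos: "v \<in> V \<Longrightarrow> 0 < w v"
begin

definition ip :: "('x \<Rightarrow> complex) \<Rightarrow> ('x \<Rightarrow> complex) \<Rightarrow> complex" where
  "ip f g = (\<Sum>v\<in>V. of_real (w v) * f v * cnj (g v))"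

definition space :: "('x \<Rightarrow> complex) set" where
  "space = {f. \<forall>v. v \<notin> V \<longrightarrow> f v = 0}"

lemma ip_commute: "ip g f = cnj (ip f g)"
  by (auto simp: ip_def intro!: sum.cong)

lemma ip_sum_left: "ip (\<lambda>v. \<Sum>j\<in>J. c j * \<phi> j v) g = (\<Sum>j\<in>J. c j * ip (\<phi> j) g)"
proof -
  have "ip (\<lambda>v. \<Sum>j\<in>J. c j * \<phi> j v) g
      = (\<Sum>v\<in>V. \<Sum>j\<in>J. c j * (of_real (w v) * \<phi> j v * cnj (g v)))"
    unfolding ip_def by (intro sum.cong) (auto simp: sum_distrib_left sum_distrib_right mult_ac)
  also have "\<dots> = (\<Sum>j\<in>J. c j * ip (\<phi> j) g)"
    unfolding ip_def by (subst sum.swap) (simp add: sum_distrib_left)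
  finally show ?thesis .
qed

lemma ip_sum_right: "ip f (\<lambda>v. \<Sum>j\<in>J. c j * \<phi> j v) = (\<Sum>j\<in>J. cnj (c j) * ip f (\<phi> j))"
  by (subst (1 2) ip_commute) (simp add: ip_sum_left)

lemma ip_scale_left: "ip (\<lambda>v. c * f v) g = c * ip f g"
  and ip_scale_right: "ip f (\<lambda>v. c * g v) = cnj c * ip f g"
  by (auto simp: ip_def sum_distrib_left mult_ac)

lemma ip_divide_left: "ip (\<lambda>v. f v / c) g = ip f g / c"
  and ip_divide_right: "ip f (\<lambda>v. g v / c) = ip f g / cnj c"
  by (auto simp: ip_def sum_divide_distrib)

lemma ip_diff_left: "ip (\<lambda>v. f v - h v) g = ip f g - ip h g"
  and ip_diff_right: "ip g (\<lambda>v. f v - h v) = ip g f - ip g h"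
  by (auto simp: ip_def sum_subtractf algebra_simps)

lemma ip_self: "ip f f = of_real (\<Sum>v\<in>V. w v * (cmod (f v))\<^sup>2)"
  unfolding ip_def of_real_sum
  by (intro sum.cong) (simp_all add: complex_norm_square[symmetric] mult.assoc)

lemma ip_self_zero:
  assumes "f \<in> space" "ip f f = 0"
  shows "f = (\<lambda>_. 0)"
proof -
  have "(\<Sum>v\<in>V. w v * (cmod (f v))\<^sup>2) = 0"
    using assms(2) unfolding ip_self of_real_eq_0_iff .
  then have "\<forall>v\<in>V. w v * (cmod (f v))\<^sup>2 = 0"
    by (subst (asm) sum_nonneg_eq_0_iff) (auto simp: finite_V w_pos less_imp_le)
  then show ?thesis using assms(1) w_pos by (fastforce simp: space_def)
qed

lemma space_sum: "(\<And>j. j \<in> J \<Longrightarrow> \<phi> j \<in> space) \<Longrightarrow> (\<lambda>v. \<Sum>j\<in>J. c j * \<phi> j v) \<in> space"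
  by (auto simp: space_def)

text \<open>Krylov argument. The iterates of a nonzero \<open>f\<close> stay orthogonal to all
  eigenvectors. Among the nonzero polynomials p with p(T) f = 0 take one of least degree and split
  off a root z: the cofactor q gives an eigenvector g = q(T) f, which is orthogonal to the iterates
  and so to itself.\<close>

lemma selfadjoint_complete:
  assumes T_space: "\<And>f. f \<in> space \<Longrightarrow> T f \<in> space"
    and T_sum: "\<And>(n::nat) c \<phi>. T (\<lambda>v. \<Sum>j\<le>n. c j * \<phi> j v) = (\<lambda>v. \<Sum>j\<le>n. c j * T (\<phi> j) v)"
    and T_adj: "\<And>f g. f \<in> space \<Longrightarrow> g \<in> space \<Longrightarrow> ip (T f) g = ip f (T g)"
    and f: "f \<in> space"
    and orth: "\<And>\<mu> g. g \<in> space \<Longrightarrow> T g = (\<lambda>v. of_real \<mu> * g v) \<Longrightarrow> ip f g = 0"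
  shows "f = (\<lambda>_. 0)"
proof (rule ccontr)
  assume nz: "f \<noteq> (\<lambda>_. 0)"
  define it where "it n = (T ^^ n) f" for n
  have it_0: "it 0 = f" and it_Suc: "it (Suc n) = T (it n)" for n
    by (auto simp: it_def)
  have it_W: "it n \<in> space \<and> (\<forall>\<mu> g. g \<in> space \<longrightarrow> T g = (\<lambda>v. of_real \<mu> * g v) \<longrightarrow> ip (it n) g = 0)" for n
  proof (induction n)
    case (Suc n)
    then show ?case
      by (auto simp: it_Suc T_space T_adj ip_scale_right)
  qed (auto simp: it_0 f orth)
  \<comment> \<open>\<open>app p\<close> stands for p(T) f.\<close>
  define app where "app p = (\<lambda>v. \<Sum>i\<le>degree p. coeff p i * it i v)" for p
  have app_alt: "app p = (\<lambda>v. \<Sum>i\<le>n. coeff p i * it i v)" if "degree p \<le> n" for p n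
    unfolding app_def
    by (intro ext sum.mono_neutral_left) (use that in \<open>auto simp: coeff_eq_0\<close>)
  have app_step: "app ([:- z, 1:] * q) = (\<lambda>v. T (app q) v - z * app q v)" for z q
  proof
    fix v
    let ?n = "degree q"
    have "degree ([:- z, 1:] * q) \<le> Suc ?n"
      using degree_mult_le[of "[:- z, 1:]" q] by simp
    then have "app ([:- z, 1:] * q) v = (\<Sum>i\<le>Suc ?n. coeff ([:- z, 1:] * q) i * it i v)"
      by (simp add: app_alt)
    also have "\<dots> = (\<Sum>i\<le>Suc ?n. coeff (pCons 0 q) i * it i v - z * (coeff q i * it i v))"
      by (intro sum.cong) (auto simp: algebra_simps)
    also have "\<dots> = (\<Sum>i\<le>Suc ?n. coeff (pCons 0 q) i * it i v) - z * (\<Sum>i\<le>Suc ?n. coeff q i * it i v)"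
      by (simp only: sum_subtractf sum_distrib_left)
    also have "(\<Sum>i\<le>Suc ?n. coeff q i * it i v) = app q v"
      by (subst app_alt[of _ "Suc ?n"]) auto
    also have "(\<Sum>i\<le>Suc ?n. coeff (pCons 0 q) i * it i v) = T (app q) v"
      unfolding app_def T_sum by (subst sum.atMost_Suc_shift) (simp add: it_Suc)
    finally show "app ([:- z, 1:] * q) v = T (app q) v - z * app q v" .
  qed
  \<comment> \<open>\<open>card V\<close> + 1 iterates live in a space of dimension
    \<open>card V\<close>, so they are dependent.\<close>
  have "\<exists>p. p \<noteq> 0 \<and> app p = (\<lambda>_. 0)"
  proof -
    obtain c where c: "\<exists>j\<in>{..card V}. c j \<noteq> 0" "\<forall>v\<in>V. (\<Sum>j\<le>card V. it j v * c j) = 0"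
      using homogeneous_system_nontrivial[OF finite_V, of "{..card V}" "\<lambda>v j. it j v"] by auto
    define p where "p = (\<Sum>j\<le>card V. monom (c j) j)"
    have coeff_p: "coeff p i = (if i \<le> card V then c i else 0)" for i
      by (auto simp: p_def coeff_sum)
    then have "degree p \<le> card V" by (intro degree_le) auto
    then have "app p = (\<lambda>v. \<Sum>i\<le>card V. coeff p i * it i v)" by (rule app_alt)
    also have "\<dots> = (\<lambda>_. 0)"
    proof
      fix v
      show "(\<Sum>i\<le>card V. coeff p i * it i v) = 0"
        using c(2) it_W by (cases "v \<in> V") (auto simp: coeff_p mult.commute space_def)
    qed
    finally show ?thesis using c(1) coeff_p by (metis atMost_iff coeff_0)
  qed
  then obtain p where p: "p \<noteq> 0" "app p = (\<lambda>_. 0)"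
    and min: "\<And>q. q \<noteq> 0 \<Longrightarrow> app q = (\<lambda>_. 0) \<Longrightarrow> degree p \<le> degree q"
    using ex_has_least_nat[of "\<lambda>p. p \<noteq> 0 \<and> app p = (\<lambda>_. 0)" _ degree] by blast
  have "degree p \<noteq> 0"
  proof
    assume "degree p = 0"
    then obtain c where "p = [:c:]" by (metis degree_eq_zeroE)
    with p nz show False by (auto simp: app_def it_0 fun_eq_iff)
  qed
  then have "\<not> constant (poly p)" by (simp add: constant_degree)
  then obtain z where "poly p z = 0" using fundamental_theorem_of_algebra by blast
  then obtain q where q: "p = [:- z, 1:] * q" by (auto simp: poly_eq_0_iff_dvd)
  with p have "q \<noteq> 0" by auto
  then have "degree p = Suc (degree q)" unfolding q by (subst degree_mult_eq) auto
  define g where "g = app q"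
  have "g \<noteq> (\<lambda>_. 0)" using min[OF \<open>q \<noteq> 0\<close>] \<open>degree p = _\<close> by (auto simp: g_def)
  have g: "g \<in> space" unfolding g_def app_def by (intro space_sum) (use it_W in auto)
  have Tg: "T g = (\<lambda>v. z * g v)"
  proof
    fix v
    have "T (app q) v - z * app q v = 0" using app_step[of z q] p(2) unfolding q by metis
    then show "T g v = z * g v" by (simp add: g_def)
  qed
  \<comment> \<open>Self-adjointness forces z to be real; only then does \<open>orth\<close>, which
    speaks of real eigenvalues, apply to g.\<close>
  have "ip g g \<noteq> 0" using ip_self_zero g \<open>g \<noteq> _\<close> by blast
  moreover have "z * ip g g = cnj z * ip g g"
    using T_adj[OF g g] by (simp add: Tg ip_scale_left ip_scale_right)
  ultimately have "z = cnj z" by simp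
  then have "z = of_real (Re z)" by (metis Reals_cnj_iff of_real_Re)
  then have "T g = (\<lambda>v. of_real (Re z) * g v)" using Tg by simp
  then have "ip (it i) g = 0" for i using it_W g by blast
  then have "ip g g = 0" by (subst g_def, unfold app_def) (simp add: ip_sum_left)
  with \<open>ip g g \<noteq> 0\<close> show False by simp
qed

text \<open>The difference between \<open>f\<close> and its projection is orthogonal to every
  \<eta>, so completeness makes it zero.\<close>

lemma parseval:
  assumes L: "finite L" and \<eta>: "\<And>l. l \<in> L \<Longrightarrow> \<eta> l \<in> space"
    and ons: "\<And>l l'. l \<in> L \<Longrightarrow> l' \<in> L \<Longrightarrow> ip (\<eta> l) (\<eta> l') = (if l = l' then 1 else 0)"
    and complete: "\<And>h. h \<in> space \<Longrightarrow> (\<And>l. l \<in> L \<Longrightarrow> ip h (\<eta> l) = 0) \<Longrightarrow> h = (\<lambda>_. 0)"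
    and f: "f \<in> space"
  shows "ip f g = (\<Sum>l\<in>L. ip f (\<eta> l) * cnj (ip g (\<eta> l)))"
proof -
  define s where "s = (\<lambda>v. \<Sum>l\<in>L. ip f (\<eta> l) * \<eta> l v)"
  have "(\<lambda>v. f v - s v) = (\<lambda>_. 0)"
  proof (rule complete)
    have "s \<in> space" unfolding s_def by (rule space_sum) (rule \<eta>)
    then show "(\<lambda>v. f v - s v) \<in> space" using f by (auto simp: space_def)
    fix l assume l: "l \<in> L"
    have "ip s (\<eta> l) = (\<Sum>l'\<in>L. if l' = l then ip f (\<eta> l') else 0)"
      unfolding s_def ip_sum_left by (intro sum.cong) (auto simp: ons l)
    then show "ip (\<lambda>v. f v - s v) (\<eta> l) = 0" using L l by (simp add: ip_diff_left)
  qed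
  then have "f = s" by (auto simp: fun_eq_iff)
  then have "ip f g = ip s g" by simp
  also have "\<dots> = (\<Sum>l\<in>L. ip f (\<eta> l) * ip (\<eta> l) g)" unfolding s_def ip_sum_left ..
  also have "\<dots> = (\<Sum>l\<in>L. ip f (\<eta> l) * cnj (ip g (\<eta> l)))"
    by (intro sum.cong refl) (subst (2) ip_commute, simp)
  finally show ?thesis .
qed

text \<open>The coefficients \<open>b\<close> are recorded along with the orthonormal vectors
  because \<open>is_B_matrix\<close> speaks of them. Vectors that depend on earlier ones are
  skipped, so \<open>d\<close> is the rank of the family.\<close>

lemma gram_schmidt:
  fixes \<phi> :: "nat \<Rightarrow> 'x \<Rightarrow> complex"
  assumes "\<forall>j\<in>{1..n}. \<phi> j \<in> space"
  shows "\<exists>d b. (\<forall>i\<in>{1..d}. \<forall>i'\<in>{1..d}.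
       ip (\<lambda>v. \<Sum>j=1..n. b i j * \<phi> j v) (\<lambda>v. \<Sum>j=1..n. b i' j * \<phi> j v) = (if i = i' then 1 else 0)) \<and>
     (\<forall>j\<in>{1..n}. \<exists>a. \<phi> j = (\<lambda>v. \<Sum>i=1..d::nat. a i * (\<Sum>j=1..n. b i j * \<phi> j v))) \<and>
     ((\<forall>c. (\<lambda>v. \<Sum>j=1..n. c j * \<phi> j v) = (\<lambda>_. 0) \<longrightarrow> (\<forall>j\<in>{1..n}. c j = 0)) \<longrightarrow> d = n)"
  using assms
proof (induction n)
  case 0
  show ?case by (intro exI[of _ 0]) auto
next
  case (Suc n)
  then have "\<forall>j\<in>{1..n}. \<phi> j \<in> space" by simp
  from Suc.IH[OF this] obtain d b where
      ons: "\<forall>i\<in>{1..d}. \<forall>i'\<in>{1..d}.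
       ip (\<lambda>v. \<Sum>j=1..n. b i j * \<phi> j v) (\<lambda>v. \<Sum>j=1..n. b i' j * \<phi> j v) = (if i = i' then 1 else 0)"
    and span: "\<forall>j\<in>{1..n}. \<exists>a. \<phi> j = (\<lambda>v. \<Sum>i=1..d. a i * (\<Sum>j=1..n. b i j * \<phi> j v))"
    and indep: "(\<forall>c. (\<lambda>v. \<Sum>j=1..n. c j * \<phi> j v) = (\<lambda>_. 0) \<longrightarrow> (\<forall>j\<in>{1..n}. c j = 0)) \<longrightarrow> d = n"
    by (elim exE conjE) (rule that)
  define \<eta> where "\<eta> i = (\<lambda>v. \<Sum>j=1..n. b i j * \<phi> j v)" for i
  define b0 where "b0 i j = (if j = Suc n then 0 else b i j)" for i j
  have b0: "(\<lambda>v. \<Sum>j=1..Suc n. b0 i j * \<phi> j v) = \<eta> i" for i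
    unfolding \<eta>_def b0_def sum_Suc_if by simp
  have \<eta>_space: "\<eta> i \<in> space" for i unfolding \<eta>_def by (intro space_sum) (use Suc.prems in auto)
  have ons': "ip (\<eta> i) (\<eta> i') = (if i = i' then 1 else 0)" if "i \<in> {1..d}" "i' \<in> {1..d}" for i i'
    unfolding \<eta>_def using ons that by blast
  define a where "a i = ip (\<phi> (Suc n)) (\<eta> i)" for i
  define r where "r = (\<lambda>v. \<phi> (Suc n) v - (\<Sum>i=1..d. a i * \<eta> i v))"
  \<comment> \<open>The rows of \<open>b\<close> must express the new vector through \<phi>, so the
    residual is rewritten in these terms, with coefficient 1 at \<open>Suc n\<close>.\<close>
  have r_comb: "r = (\<lambda>v. \<Sum>j=1..Suc n. (if j = Suc n then 1 else - (\<Sum>i=1..d. a i * b i j)) * \<phi> j v)"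
  proof
    fix v
    have "(\<Sum>i=1..d. a i * \<eta> i v) = (\<Sum>j=1..n. (\<Sum>i=1..d. a i * b i j) * \<phi> j v)"
      unfolding \<eta>_def sum_distrib_left sum_distrib_right
      by (subst sum.swap) (simp add: mult.assoc)
    moreover have "(\<Sum>j=1..Suc n. (if j = Suc n then 1 else - (\<Sum>i=1..d. a i * b i j)) * \<phi> j v)
        = \<phi> (Suc n) v + (\<Sum>j=1..n. - (\<Sum>i=1..d. a i * b i j) * \<phi> j v)"
      unfolding sum_Suc_if by simp
    ultimately show "r v = (\<Sum>j=1..Suc n. (if j = Suc n then 1 else - (\<Sum>i=1..d. a i * b i j)) * \<phi> j v)"
      by (simp add: r_def sum_negf)
  qed
  have r_space: "r \<in> space"
    unfolding r_comb by (intro space_sum) (use Suc.prems in auto)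
  have r_orth: "ip r (\<eta> i) = 0" if "i \<in> {1..d}" for i
  proof -
    have "(\<Sum>l=1..d. a l * ip (\<eta> l) (\<eta> i)) = (\<Sum>l=1..d. (if l = i then a l else 0))"
      by (intro sum.cong) (simp_all add: ons'[OF _ that])
    also have "\<dots> = a i" using that by simp
    finally show ?thesis by (simp add: r_def ip_diff_left ip_sum_left a_def)
  qed
  have restrict_indep: "\<forall>c. (\<lambda>v. \<Sum>j=1..n. c j * \<phi> j v) = (\<lambda>_. 0) \<longrightarrow> (\<forall>j\<in>{1..n}. c j = 0)"
    if H: "\<forall>c. (\<lambda>v. \<Sum>j=1..Suc n. c j * \<phi> j v) = (\<lambda>_. 0) \<longrightarrow> (\<forall>j\<in>{1..Suc n}. c j = 0)"
  proof (intro allI impI ballI)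
    fix c j assume c: "(\<lambda>v. \<Sum>j=1..n. c j * \<phi> j v) = (\<lambda>_. 0)" and j: "j \<in> {1..n}"
    have "(\<lambda>v. \<Sum>j=1..Suc n. (if j = Suc n then 0 else c j) * \<phi> j v) = (\<lambda>v. \<Sum>j=1..n. c j * \<phi> j v)"
      unfolding sum_Suc_if by simp
    from trans[OF this c] have "\<forall>j\<in>{1..Suc n}. (if j = Suc n then 0 else c j) = 0"
      by (rule H[THEN spec[of _ "\<lambda>j. if j = Suc n then 0 else c j"], THEN mp])
    from bspec[OF this, of j] j show "c j = 0" by (auto split: if_splits)
  qed
  show ?case
  proof (cases "r = (\<lambda>_. 0)")
    case True
    then have "\<phi> (Suc n) = (\<lambda>v. \<Sum>i=1..d. a i * \<eta> i v)" by (auto simp: r_def fun_eq_iff)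
    \<comment> \<open>A vanishing residual is a linear relation whose last coefficient is 1, so the
      claim about independent families holds vacuously.\<close>
    moreover have "\<not> (\<forall>c. (\<lambda>v. \<Sum>j=1..Suc n. c j * \<phi> j v) = (\<lambda>_. 0) \<longrightarrow> (\<forall>j\<in>{1..Suc n}. c j = 0))"
    proof
      assume H: "\<forall>c. (\<lambda>v. \<Sum>j=1..Suc n. c j * \<phi> j v) = (\<lambda>_. 0) \<longrightarrow> (\<forall>j\<in>{1..Suc n}. c j = 0)"
      have "\<forall>j\<in>{1..Suc n}. (if j = Suc n then 1 else - (\<Sum>i=1..d. a i * b i j)) = 0"
        by (rule H[THEN spec[of _ "\<lambda>j. if j = Suc n then 1 else - (\<Sum>i=1..d. a i * b i j)"],
              THEN mp, OF trans[OF r_comb[symmetric] True]])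
      from bspec[OF this, of "Suc n"] show False by simp
    qed
    moreover have "\<exists>a. \<phi> j = (\<lambda>v. \<Sum>i=1..d. a i * \<eta> i v)" if "j \<in> {1..Suc n}" for j
    proof (cases "j = Suc n")
      case False
      then have "j \<in> {1..n}" using that by auto
      then show ?thesis using span unfolding \<eta>_def by blast
    qed (use calculation(1) in blast)
    ultimately show ?thesis
      by (intro exI[of _ d] exI[of _ b0]) (unfold b0 fun_cong[OF b0], use ons' in blast)
  next
    case False
    define \<rho> where "\<rho> = sqrt (\<Sum>v\<in>V. w v * (cmod (r v))\<^sup>2)"
    have nn: "(\<Sum>v\<in>V. w v * (cmod (r v))\<^sup>2) \<ge> 0"
      by (intro sum_nonneg) (auto simp: w_pos less_imp_le)
    have "ip r r = of_real (\<rho>\<^sup>2)" unfolding ip_self \<rho>_def using nn by simp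
    moreover have "ip r r \<noteq> 0" using False r_space ip_self_zero by blast
    ultimately have \<rho>: "ip r r = of_real \<rho> * of_real \<rho>" "\<rho> \<noteq> 0"
      by (auto simp: power2_eq_square)
    define b1 where "b1 i j = (if i = Suc d then (if j = Suc n then 1 else - (\<Sum>i=1..d. a i * b i j)) / of_real \<rho>
      else b0 i j)" for i j
    define \<eta>1 where "\<eta>1 i = (if i = Suc d then (\<lambda>v. r v / of_real \<rho>) else \<eta> i)" for i
    have b1: "(\<lambda>v. \<Sum>j=1..Suc n. b1 i j * \<phi> j v) = \<eta>1 i" for i
    proof (cases "i = Suc d")
      case True
      have "(\<Sum>j=1..Suc n. b1 i j * \<phi> j v)
          = (\<Sum>j=1..Suc n. (if j = Suc n then 1 else - (\<Sum>i=1..d. a i * b i j)) * \<phi> j v) / of_real \<rho>" for v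
        unfolding sum_divide_distrib by (rule sum.cong) (simp_all add: b1_def True)
      then show ?thesis by (simp only: \<eta>1_def if_True True fun_cong[OF r_comb, symmetric] refl)
    next
      case False
      then show ?thesis using b0[of i] by (simp add: b1_def \<eta>1_def)
    qed
    have "ip (\<eta>1 i) (\<eta>1 i') = (if i = i' then 1 else 0)" if "i \<in> {1..Suc d}" "i' \<in> {1..Suc d}" for i i'
    proof -
      have "ip (\<eta> i) r = 0" if "i \<in> {1..d}" for i
        using r_orth[OF that] by (subst ip_commute) simp
      then show ?thesis
        using that ons' r_orth \<rho> by (auto simp: \<eta>1_def ip_divide_left ip_divide_right le_Suc_eq)
    qed
    moreover have "\<exists>a. \<phi> j = (\<lambda>v. \<Sum>i=1..Suc d. a i * \<eta>1 i v)" if j: "j \<in> {1..Suc n}" for j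
    proof (cases "j = Suc n")
      case True
      have "\<phi> j = (\<lambda>v. \<Sum>i=1..Suc d. (if i = Suc d then of_real \<rho> else a i) * \<eta>1 i v)"
      proof
        fix v
        have "(\<Sum>i=1..d. a i * \<eta>1 i v) = (\<Sum>i=1..d. a i * \<eta> i v)"
          by (rule sum.cong) (auto simp: \<eta>1_def)
        then show "\<phi> j v = (\<Sum>i=1..Suc d. (if i = Suc d then of_real \<rho> else a i) * \<eta>1 i v)"
          unfolding sum_Suc_if using True \<rho>(2) by (simp add: \<eta>1_def r_def)
      qed
      then show ?thesis by (rule exI[of _ "\<lambda>i. if i = Suc d then of_real \<rho> else a i"])
    next
      case False
      with j obtain a' where a': "\<phi> j = (\<lambda>v. \<Sum>i=1..d. a' i * \<eta> i v)"
        using span[THEN bspec, of j] unfolding \<eta>_def by auto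
      have "\<phi> j = (\<lambda>v. \<Sum>i=1..Suc d. (if i = Suc d then 0 else a' i) * \<eta>1 i v)"
        unfolding sum_Suc_if a' by (simp add: \<eta>1_def)
      then show ?thesis by (rule exI[of _ "\<lambda>i. if i = Suc d then 0 else a' i"])
    qed
    ultimately show ?thesis
      using indep restrict_indep
      by (intro exI[of _ "Suc d"] exI[of _ b1]) (unfold b1 fun_cong[OF b1], blast)
  qed
qed

end

section \<open>Refined graphs\<close>

locale refined_graph =
  fixes G :: "'v mgraph" and N :: nat
  assumes graph: "finite_simple_graph G"
    and degree: "\<And>v. v \<in> verts G \<Longrightarrow> card (incident_edges G v) \<ge> 2"
    and N_pos: "0 < N"
begin

abbreviation "sp \<equiv> subdiv_point G N"

lemma finite_verts: "finite (verts G)"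
  using graph by (auto simp: finite_simple_graph_def)

lemma finite_edges: "finite (edges G)"
proof (rule finite_subset)
  show "edges G \<subseteq> Pow (verts G)" using graph by (auto simp: finite_simple_graph_def)
qed (simp add: finite_verts)

lemma edge_ends:
  assumes "e \<in> edges G"
  shows "end0 G e \<in> verts G" "end1 G e \<in> verts G" "end0 G e \<noteq> end1 G e" "{end0 G e, end1 G e} = e"
proof -
  have *: "e \<subseteq> verts G \<and> card e = 2 \<and> e = {end0 G e, end1 G e}"
    using assms graph unfolding finite_simple_graph_def by blast
  then have e: "e \<subseteq> verts G" "card e = 2" by auto
  from * show e3: "{end0 G e, end1 G e} = e" by metis
  have "end0 G e \<in> e" "end1 G e \<in> e"
    by (subst e3[symmetric], simp)+
  then show "end0 G e \<in> verts G" "end1 G e \<in> verts G" using e(1) by auto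
  show "end0 G e \<noteq> end1 G e"
  proof
    assume "end0 G e = end1 G e"
    with e3 have "card e = card {end1 G e}" by simp
    with e(2) show False by simp
  qed
qed

lemma finite_incident: "finite (incident_edges G v)"
  using finite_edges by (simp add: incident_edges_def)

lemma incident_iff: "e \<in> incident_edges G v \<longleftrightarrow> e \<in> edges G \<and> (v = end0 G e \<or> v = end1 G e)"
  using edge_ends(4)[of e] unfolding incident_edges_def by blast

lemma incident_nonempty: "v \<in> verts G \<Longrightarrow> incident_edges G v \<noteq> {}"
  using degree[of v] by auto

lemma sp_simps: "sp e 0 = Old (end0 G e)" "sp e N = Old (end1 G e)"
    "0 < n \<Longrightarrow> n < N \<Longrightarrow> sp e n = New e n"
  using N_pos by (auto simp: subdiv_point_def)

lemma sp_eq_Old: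
  "n \<le> N \<Longrightarrow> sp e n = Old v \<longleftrightarrow> n = 0 \<and> v = end0 G e \<or> n = N \<and> v = end1 G e"
  using N_pos by (auto simp: subdiv_point_def)

lemma sp_eq_New:
  "n \<le> N \<Longrightarrow> sp e n = New e' n' \<longleftrightarrow> e = e' \<and> n = n' \<and> 0 < n \<and> n < N"
  using N_pos by (auto simp: subdiv_point_def)

lemma sp_in_rverts: "e \<in> edges G \<Longrightarrow> n \<le> N \<Longrightarrow> sp e n \<in> rverts G N"
  using edge_ends(1,2)[of e] by (auto simp: subdiv_point_def rverts_def)

text \<open>The degree condition excludes isolated vertices, so every old vertex is an end of some
  edge.\<close>

lemma rverts_cases:
  assumes "v \<in> rverts G N"
  obtains e n where "e \<in> edges G" "n \<le> N" "v = sp e n"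
proof -
  consider u where "u \<in> verts G" "v = Old u" | e n where "e \<in> edges G" "0 < n" "n < N" "v = New e n"
    using assms by (auto simp: rverts_def)
  then show ?thesis
  proof cases
    case 1
    then obtain e where "e \<in> edges G" "u = end0 G e \<or> u = end1 G e"
      using incident_nonempty incident_iff by blast
    then show ?thesis using that[of e 0] that[of e N] 1 by (auto simp: sp_simps)
  next
    case 2
    then show ?thesis using that[of e n] by (simp add: sp_simps)
  qed
qed

text \<open>Meant for an end \<open>v\<close> of \<open>e\<close>: the second branch takes
  \<open>v\<close> to be \<open>end1 G e\<close>. With N = 1 both branches give the opposite end of
  the edge.\<close>

definition nbr :: "'v set \<Rightarrow> 'v \<Rightarrow> 'v rvertex" where
  "nbr e v = (if v = end0 G e then sp e 1 else sp e (N - 1))"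

lemma radj_Old: "radj G N (Old v) = (\<lambda>e. nbr e v) ` incident_edges G v" (is "?L = ?R")
proof
  show "?L \<subseteq> ?R"
  proof
    fix u assume "u \<in> ?L"
    then obtain e n where e: "e \<in> edges G" and n: "n < N"
      and "{u, Old v} = {sp e n, sp e (Suc n)}"
      by (auto simp: radj_def)
    then consider "u = sp e n" "sp e (Suc n) = Old v" | "u = sp e (Suc n)" "sp e n = Old v"
      by (auto simp: doubleton_eq_iff)
    then have "e \<in> incident_edges G v \<and> u = nbr e v"
      by cases (use e n edge_ends(3)[OF e] in \<open>auto simp: sp_eq_Old incident_iff nbr_def\<close>)
    then show "u \<in> ?R" by blast
  qed
  show "?R \<subseteq> ?L"
  proof
    fix u assume "u \<in> ?R"
    then obtain e where e: "e \<in> edges G" "v = end0 G e \<or> v = end1 G e" "u = nbr e v"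
      by (auto simp: incident_iff)
    show "u \<in> ?L"
    proof (cases "v = end0 G e")
      case True
      then have "{u, Old v} = {sp e 0, sp e (Suc 0)}"
        using e by (auto simp: nbr_def sp_simps)
      then show ?thesis using e N_pos unfolding radj_def by blast
    next
      case False
      then have "{u, Old v} = {sp e (N - 1), sp e (Suc (N - 1))}"
        using e N_pos by (auto simp: nbr_def sp_simps)
      moreover have "N - 1 < N" using N_pos by simp
      ultimately show ?thesis using e unfolding radj_def by blast
    qed
  qed
qed

text \<open>For N = 1 this is simplicity of the graph: an edge is determined by its two ends. For N
  > 1 the neighbour is a \<open>New\<close> vertex, which carries its edge.\<close>

lemma nbr_inj: "inj_on (\<lambda>e. nbr e v) (incident_edges G v)"
proof (rule inj_onI)
  fix e e' assume e: "e \<in> incident_edges G v" "e' \<in> incident_edges G v" and eq: "nbr e v = nbr e' v"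
  have E: "e \<in> edges G" "e' \<in> edges G" using e by (auto simp: incident_iff)
  show "e = e'"
  proof (cases "N = 1")
    case True
    then have nbr: "nbr d v = Old (if v = end0 G d then end1 G d else end0 G d)" for d
      unfolding nbr_def by (auto simp: subdiv_point_def)
    have ends: "{v, if v = end0 G d then end1 G d else end0 G d} = d" if "d \<in> incident_edges G v" for d
      using that edge_ends(3,4)[of d] by (auto simp: incident_iff)
    have "e = {v, if v = end0 G e then end1 G e else end0 G e}"
      using ends[OF e(1)] by (rule sym)
    also have "\<dots> = {v, if v = end0 G e' then end1 G e' else end0 G e'}"
      using eq unfolding nbr by auto
    also have "\<dots> = e'" by (rule ends[OF e(2)])
    finally show ?thesis .
  next
    case False
    have nbr: "nbr d v = (if v = end0 G d then New d 1 else New d (N - 1))" for d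
      unfolding nbr_def using N_pos False by (auto simp: subdiv_point_def)
    have "e = e'" if "(if P then New e a else New e b) = (if Q then New e' a else New e' b)" for P Q a b
      using that by (cases P; cases Q) auto
    from this[OF eq[unfolded nbr]] show ?thesis .
  qed
qed

lemma sum_radj_Old: "(\<Sum>u\<in>radj G N (Old v). F u) = (\<Sum>e\<in>incident_edges G v. F (nbr e v))"
  unfolding radj_Old by (subst sum.reindex[OF nbr_inj]) (simp add: o_def)

lemma radj_New:
  assumes e: "e \<in> edges G" "0 < n" "n < N"
  shows "radj G N (New e n) = {sp e (n - 1), sp e (Suc n)}" (is "?L = ?R")
proof
  show "?L \<subseteq> ?R"
  proof
    fix u assume "u \<in> ?L"
    then obtain e' n' where e': "e' \<in> edges G" "n' < N"
      and "{u, New e n} = {sp e' n', sp e' (Suc n')}"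
      by (auto simp: radj_def)
    then consider "u = sp e' n'" "sp e' (Suc n') = New e n" | "u = sp e' (Suc n')" "sp e' n' = New e n"
      by (auto simp: doubleton_eq_iff)
    then show "u \<in> ?R" by cases (use e' in \<open>auto simp: sp_eq_New\<close>)
  qed
  have "{sp e (n - 1), New e n} = {sp e (n - 1), sp e (Suc (n - 1))}"
    "{sp e (Suc n), New e n} = {sp e n, sp e (Suc n)}"
    using e by (auto simp: sp_simps)
  moreover have "n - 1 < N" using e by simp
  ultimately show "?R \<subseteq> ?L" using e unfolding radj_def by blast
qed

text \<open>The two neighbours are distinct also for N = 2, where they are the ends of
  \<open>e\<close>.\<close>

lemma sum_radj_New:
  assumes e: "e \<in> edges G" "0 < n" "n < N"
  shows "(\<Sum>u\<in>radj G N (New e n). F u) = F (sp e (n - 1)) + F (sp e (Suc n))"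
proof -
  have "sp e (n - 1) \<noteq> sp e (Suc n)"
    using e edge_ends(3)[OF e(1)] by (auto simp: subdiv_point_def)
  then show ?thesis unfolding radj_New[OF e] by simp
qed

lemma finite_rverts: "finite (rverts G N)"
proof -
  have "{New e n |e n. e \<in> edges G \<and> 0 < n \<and> n < N} = (\<lambda>(e, n). New e n) ` (edges G \<times> {0<..<N})"
    by auto
  then show ?thesis by (simp add: rverts_def finite_verts finite_edges)
qed

lemma rdeg_Old: "rdeg G N (Old v) = card (incident_edges G v)"
  unfolding rdeg_def radj_Old by (rule card_image[OF nbr_inj])

lemma rdeg_New: "e \<in> edges G \<Longrightarrow> 0 < n \<Longrightarrow> n < N \<Longrightarrow> rdeg G N (New e n) = 2"
  using sum_radj_New[of e n "\<lambda>_. 1 :: nat"] by (simp add: rdeg_def)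

lemma rdeg_pos: "v \<in> rverts G N \<Longrightarrow> 0 < rdeg G N v"
  using degree by (fastforce simp: rverts_def rdeg_Old rdeg_New)

lemma sum_rverts:
  "(\<Sum>v\<in>rverts G N. F v) = (\<Sum>v\<in>verts G. F (Old v)) + (\<Sum>e\<in>edges G. \<Sum>n\<in>{0<..<N}. F (New e n))"
proof -
  have *: "{New e n |e n. e \<in> edges G \<and> 0 < n \<and> n < N} = (\<lambda>(e, n). New e n) ` (edges G \<times> {0<..<N})"
    by auto
  have "(\<Sum>v\<in>rverts G N. F v)
      = sum F (Old ` verts G) + sum F ((\<lambda>(e, n). New e n) ` (edges G \<times> {0<..<N}))"
    unfolding rverts_def * by (intro sum.union_disjoint) (auto simp: finite_verts finite_edges)
  also have "sum F (Old ` verts G) = (\<Sum>v\<in>verts G. F (Old v))"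
    by (subst sum.reindex) (auto simp: inj_on_def)
  also have "sum F ((\<lambda>(e, n). New e n) ` (edges G \<times> {0<..<N}))
      = (\<Sum>e\<in>edges G. \<Sum>n\<in>{0<..<N}. F (New e n))"
    by (subst sum.reindex) (auto simp: inj_on_def sum.cartesian_product intro!: sum.cong)
  finally show ?thesis .
qed

lemma sum_incident:
  "(\<Sum>v\<in>verts G. \<Sum>e\<in>incident_edges G v. H e v) = (\<Sum>e\<in>edges G. H e (end0 G e) + H e (end1 G e))"
proof -
  have "(\<Sum>v\<in>verts G. \<Sum>e\<in>incident_edges G v. H e v)
      = (\<Sum>e\<in>edges G. \<Sum>v\<in>{v \<in> verts G. v \<in> e}. H e v)"
    unfolding incident_edges_def by (rule sum.swap_restrict) (auto simp: finite_verts finite_edges)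
  also have "\<dots> = (\<Sum>e\<in>edges G. H e (end0 G e) + H e (end1 G e))"
  proof (rule sum.cong[OF refl])
    fix e assume e: "e \<in> edges G"
    have "{v \<in> verts G. v \<in> e} = {end0 G e, end1 G e}"
      using edge_ends(1,2,4)[OF e] by blast
    then show "(\<Sum>v\<in>{v \<in> verts G. v \<in> e}. H e v) = H e (end0 G e) + H e (end1 G e)"
      using edge_ends(3)[OF e] by simp
  qed
  finally show ?thesis .
qed

text \<open>Double counting: ordered pairs of adjacent vertices correspond to the N segments of each
  edge, taken in both directions. Self-adjointness, the energies and the trapezoidal form of the
  inner product all come from it.\<close>

lemma sum_radj_pairs:
  "(\<Sum>v\<in>rverts G N. \<Sum>u\<in>radj G N v. H u v)
    = (\<Sum>e\<in>edges G. \<Sum>n<N. H (sp e n) (sp e (Suc n)) + H (sp e (Suc n)) (sp e n))"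
proof -
  have "(\<Sum>v\<in>rverts G N. \<Sum>u\<in>radj G N v. H u v)
      = (\<Sum>v\<in>verts G. \<Sum>e\<in>incident_edges G v. H (nbr e v) (Old v))
        + (\<Sum>e\<in>edges G. \<Sum>n\<in>{0<..<N}. H (sp e (n - 1)) (New e n) + H (sp e (Suc n)) (New e n))"
    unfolding sum_rverts by (simp add: sum_radj_Old sum_radj_New)
  also have "\<dots> = (\<Sum>e\<in>edges G. (H (nbr e (end0 G e)) (Old (end0 G e)) + H (nbr e (end1 G e)) (Old (end1 G e)))
      + (\<Sum>n\<in>{0<..<N}. H (sp e (n - 1)) (New e n) + H (sp e (Suc n)) (New e n)))"
    unfolding sum_incident by (simp add: sum.distrib)
  also have "\<dots> = (\<Sum>e\<in>edges G. \<Sum>n<N. H (sp e n) (sp e (Suc n)) + H (sp e (Suc n)) (sp e n))"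
  proof (rule sum.cong[OF refl])
    fix e assume e: "e \<in> edges G"
    have "(\<Sum>n<N. H (sp e n) (sp e (Suc n))) = (\<Sum>n\<in>{1..N}. H (sp e (n - 1)) (sp e n))"
      by (rule sum.reindex_bij_witness[of _ "\<lambda>n. n - 1" Suc]) auto
    \<comment> \<open>The extreme segments of an edge are the ones counted at the old vertices,
      through \<open>nbr\<close>.\<close>
    also have "{1..N} = insert N {0<..<N}" using N_pos by auto
    also have "(\<Sum>n\<in>insert N {0<..<N}. H (sp e (n - 1)) (sp e n))
        = H (sp e (N - 1)) (sp e N) + (\<Sum>n\<in>{0<..<N}. H (sp e (n - 1)) (sp e n))" by simp
    finally have 1: "(\<Sum>n<N. H (sp e n) (sp e (Suc n)))
        = H (sp e (N - 1)) (sp e N) + (\<Sum>n\<in>{0<..<N}. H (sp e (n - 1)) (New e n))"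
      by (simp add: sp_simps)
    have "{..<N} = insert 0 {0<..<N}" using N_pos by auto
    then have 2: "(\<Sum>n<N. H (sp e (Suc n)) (sp e n))
        = H (sp e 1) (sp e 0) + (\<Sum>n\<in>{0<..<N}. H (sp e (Suc n)) (New e n))"
      by (simp add: sp_simps)
    show "(H (nbr e (end0 G e)) (Old (end0 G e)) + H (nbr e (end1 G e)) (Old (end1 G e)))
      + (\<Sum>n\<in>{0<..<N}. H (sp e (n - 1)) (New e n) + H (sp e (Suc n)) (New e n))
      = (\<Sum>n<N. H (sp e n) (sp e (Suc n)) + H (sp e (Suc n)) (sp e n))"
      unfolding sum.distrib 1 2 using edge_ends(3)[OF e] by (simp add: nbr_def sp_simps algebra_simps)
  qed
  finally show ?thesis .
qed

text \<open>A summand that depends on v alone turns the degree weights into a trapezoidal sum on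
  every edge; for functions constant along the edges this reproduces the integrals of
  \<open>inner_inf\<close>.\<close>

lemma sum_rdeg: 
  fixes F :: "'v rvertex \<Rightarrow> 'b::{comm_semiring_1}"
  shows "(\<Sum>v\<in>rverts G N. of_nat (rdeg G N v) * F v) = (\<Sum>e\<in>edges G. \<Sum>n<N. F (sp e n) + F (sp e (Suc n)))"
  using sum_radj_pairs[of "\<lambda>u v. F v"] by (simp add: rdeg_def add.commute)

section \<open>Self-adjointness of the discrete Laplacian\<close>

definition weight :: "'v rvertex \<Rightarrow> real" where
  "weight v = real (rdeg G N v) / real (2 * N * card (edges G))"

sublocale W: weighted_functions "rverts G N" weight
proof
  fix v assume v: "v \<in> rverts G N"
  then have "edges G \<noteq> {}" by (auto elim: rverts_cases)
  then show "0 < weight v"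
    using rdeg_pos[OF v] N_pos finite_edges by (simp add: weight_def card_gt_0_iff)
qed (rule finite_rverts)

lemma inner_N_ip: "inner_N G N = W.ip"
  unfolding W.ip_def by (auto simp: inner_N_def weight_def fun_eq_iff sum_divide_distrib)

lemma HN_space: "HN G N = W.space"
  unfolding W.space_def by (simp add: HN_def)

lemma Delta_N_sum:
  "Delta_N G N (\<lambda>v. \<Sum>j\<in>J. c j * \<phi> j v) = (\<lambda>v. \<Sum>j\<in>J. c j * Delta_N G N (\<phi> j) v)"
proof
  fix v
  have "(\<Sum>u\<in>radj G N v. \<Sum>j\<in>J. c j * \<phi> j u) = (\<Sum>j\<in>J. c j * (\<Sum>u\<in>radj G N v. \<phi> j u))"
    by (subst sum.swap) (simp add: sum_distrib_left)
  moreover have "(\<Sum>j\<in>J. c j * (n * (\<phi> j v - s j / d))) = n * ((\<Sum>j\<in>J. c j * \<phi> j v) - (\<Sum>j\<in>J. c j * s j) / d)"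
    for n d :: complex and s
    unfolding sum_divide_distrib sum_subtractf[symmetric] sum_distrib_left
    by (intro sum.cong) (auto simp: algebra_simps)
  ultimately show "Delta_N G N (\<lambda>v. \<Sum>j\<in>J. c j * \<phi> j v) v = (\<Sum>j\<in>J. c j * Delta_N G N (\<phi> j) v)"
    by (simp add: Delta_N_def)
qed

lemma Delta_N_HN: "Delta_N G N f \<in> HN G N"
  by (simp add: Delta_N_def HN_def)

text \<open>Multiplied by the degree, \<open>Delta_N\<close> is a multiple of degree minus
  adjacency; the adjacency form is symmetric because each adjacent pair occurs in both
  orders.\<close>

lemma Delta_N_adj: "inner_N G N (Delta_N G N f) g = inner_N G N f (Delta_N G N g)"
proof -
  let ?n = "(of_nat N :: complex)\<^sup>2"
  have l: "(\<Sum>v\<in>rverts G N. of_nat (rdeg G N v) * Delta_N G N f v * cnj (g v))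
      = ?n * ((\<Sum>v\<in>rverts G N. of_nat (rdeg G N v) * f v * cnj (g v))
          - (\<Sum>v\<in>rverts G N. \<Sum>u\<in>radj G N v. f u * cnj (g v)))"
    unfolding sum_subtractf[symmetric] sum_distrib_left
  proof (intro sum.cong refl)
    fix v assume v: "v \<in> rverts G N"
    have "of_nat (rdeg G N v) \<noteq> (0 :: complex)" using rdeg_pos[OF v] by simp
    then have "of_nat (rdeg G N v) * Delta_N G N f v
        = ?n * (of_nat (rdeg G N v) * f v - (\<Sum>u\<in>radj G N v. f u))"
      using v by (simp add: Delta_N_def field_simps)
    then have "of_nat (rdeg G N v) * Delta_N G N f v * cnj (g v)
        = ?n * (of_nat (rdeg G N v) * f v - (\<Sum>u\<in>radj G N v. f u)) * cnj (g v)" by simp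
    then show "of_nat (rdeg G N v) * Delta_N G N f v * cnj (g v)
      = ?n * (of_nat (rdeg G N v) * f v * cnj (g v) - (\<Sum>u\<in>radj G N v. f u * cnj (g v)))"
      by (simp add: sum_distrib_right[symmetric] algebra_simps)
  qed
  have r: "(\<Sum>v\<in>rverts G N. of_nat (rdeg G N v) * f v * cnj (Delta_N G N g v))
      = ?n * ((\<Sum>v\<in>rverts G N. of_nat (rdeg G N v) * f v * cnj (g v))
          - (\<Sum>v\<in>rverts G N. \<Sum>u\<in>radj G N v. f v * cnj (g u)))"
    unfolding sum_subtractf[symmetric] sum_distrib_left
  proof (intro sum.cong refl)
    fix v assume v: "v \<in> rverts G N"
    have "of_nat (rdeg G N v) \<noteq> (0 :: complex)" using rdeg_pos[OF v] by simp
    then have "of_nat (rdeg G N v) * cnj (Delta_N G N g v)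
        = ?n * (of_nat (rdeg G N v) * cnj (g v) - (\<Sum>u\<in>radj G N v. cnj (g u)))"
      using v by (simp add: Delta_N_def field_simps)
    then have "f v * (of_nat (rdeg G N v) * cnj (Delta_N G N g v))
        = f v * (?n * (of_nat (rdeg G N v) * cnj (g v) - (\<Sum>u\<in>radj G N v. cnj (g u))))" by simp
    then show "of_nat (rdeg G N v) * f v * cnj (Delta_N G N g v)
      = ?n * (of_nat (rdeg G N v) * f v * cnj (g v) - (\<Sum>u\<in>radj G N v. f v * cnj (g u)))"
      by (simp add: sum_distrib_left[symmetric] algebra_simps)
  qed
  have "(\<Sum>v\<in>rverts G N. \<Sum>u\<in>radj G N v. f u * cnj (g v)) = (\<Sum>v\<in>rverts G N. \<Sum>u\<in>radj G N v. f v * cnj (g u))"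
    unfolding sum_radj_pairs[of "\<lambda>u v. f u * cnj (g v)"] sum_radj_pairs[of "\<lambda>u v. f v * cnj (g u)"]
    by (simp add: add.commute)
  then show ?thesis unfolding inner_N_def l r by simp
qed

section \<open>Energies and the range of the eigenvalues\<close>

lemma eigenspace_N_iff:
  "f \<in> eigenspace_N G N \<mu> \<longleftrightarrow> f \<in> HN G N \<and>
     (\<forall>v\<in>rverts G N. (\<Sum>u\<in>radj G N v. f u) = of_nat (rdeg G N v) * of_real (1 - \<mu> / (real N)\<^sup>2) * f v)"
proof -
  have "Delta_N G N f v = of_real \<mu> * f v \<longleftrightarrow>
      (\<Sum>u\<in>radj G N v. f u) = of_nat (rdeg G N v) * of_real (1 - \<mu> / (real N)\<^sup>2) * f v"
    if v: "v \<in> rverts G N" for v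
  proof -
    define S where "S = (\<Sum>u\<in>radj G N v. f u)"
    define d where "d = (of_nat (rdeg G N v) :: complex)"
    define n where "n = (of_nat N :: complex)\<^sup>2"
    have nz: "d \<noteq> 0" "n \<noteq> 0" using rdeg_pos[OF v] N_pos by (auto simp: d_def n_def)
    have D: "Delta_N G N f v = n * (f v - S / d)"
      using v by (simp add: Delta_N_def S_def d_def n_def)
    have c: "of_real (1 - \<mu> / (real N)\<^sup>2) = 1 - of_real \<mu> / n" by (simp add: n_def)
    have "n * (f v - S / d) = of_real \<mu> * f v \<longleftrightarrow> S = d * (1 - of_real \<mu> / n) * f v"
      using nz by (auto simp: field_simps)
    then show ?thesis unfolding D c S_def[symmetric] d_def[symmetric] .
  qed
  moreover have "Delta_N G N f v = of_real \<mu> * f v" if "f \<in> HN G N" "v \<notin> rverts G N" for v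
    using that by (simp add: Delta_N_def HN_def)
  ultimately show ?thesis unfolding eigenspace_N_def by (auto simp: fun_eq_iff)
qed

text \<open>Expand the squares: by symmetry of adjacency both square terms give the degree-weighted
  norm, and the eigenvalue equation evaluates the mixed term. \<sigma> = 1 and \<sigma> = -1 yield
  the two energies at once.\<close>

lemma eigenspace_energy:
  fixes \<sigma> :: real
  assumes f: "f \<in> eigenspace_N G N \<mu>" and \<sigma>: "\<sigma>\<^sup>2 = 1"
  shows "(\<Sum>v\<in>rverts G N. \<Sum>u\<in>radj G N v. (cmod (f u - of_real \<sigma> * f v))\<^sup>2)
    = 2 * (1 - \<sigma> * (1 - \<mu> / (real N)\<^sup>2)) * (\<Sum>v\<in>rverts G N. real (rdeg G N v) * (cmod (f v))\<^sup>2)"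
proof -
  let ?c = "1 - \<mu> / (real N)\<^sup>2"
  let ?S = "\<Sum>v\<in>rverts G N. real (rdeg G N v) * (cmod (f v))\<^sup>2"
  have sq: "(cmod (a - of_real \<sigma> * b))\<^sup>2 = (cmod a)\<^sup>2 + (cmod b)\<^sup>2 - 2 * \<sigma> * Re (a * cnj b)" for a b
  proof -
    have "(cmod (a - of_real \<sigma> * b))\<^sup>2 = (cmod a)\<^sup>2 + \<sigma>\<^sup>2 * (cmod b)\<^sup>2 - 2 * \<sigma> * Re (a * cnj b)"
      unfolding cmod_power2 by (simp add: power2_eq_square algebra_simps)
    with \<sigma> show ?thesis by simp
  qed
  have S: "(\<Sum>v\<in>rverts G N. \<Sum>u\<in>radj G N v. (cmod (f v))\<^sup>2) = ?S" by (simp add: rdeg_def)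
  have S': "(\<Sum>v\<in>rverts G N. \<Sum>u\<in>radj G N v. (cmod (f u))\<^sup>2)
      = (\<Sum>v\<in>rverts G N. \<Sum>u\<in>radj G N v. (cmod (f v))\<^sup>2)"
    unfolding sum_radj_pairs[of "\<lambda>u v. (cmod (f u))\<^sup>2"] sum_radj_pairs[of "\<lambda>u v. (cmod (f v))\<^sup>2"]
    by (simp add: add.commute)
  have R: "(\<Sum>v\<in>rverts G N. \<Sum>u\<in>radj G N v. Re (f u * cnj (f v))) = ?c * ?S"
    unfolding sum_distrib_left
  proof (rule sum.cong[OF refl])
    fix v assume v: "v \<in> rverts G N"
    have "(\<Sum>u\<in>radj G N v. Re (f u * cnj (f v))) = Re ((\<Sum>u\<in>radj G N v. f u) * cnj (f v))"
      by (simp only: sum_distrib_right Re_sum)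
    also have "(\<Sum>u\<in>radj G N v. f u) * cnj (f v) = of_nat (rdeg G N v) * of_real ?c * (f v * cnj (f v))"
      using f v by (simp add: eigenspace_N_iff)
    also have "\<dots> = of_real (real (rdeg G N v) * ?c * (cmod (f v))\<^sup>2)"
      by (simp add: complex_norm_square[symmetric])
    finally show "(\<Sum>u\<in>radj G N v. Re (f u * cnj (f v))) = ?c * (real (rdeg G N v) * (cmod (f v))\<^sup>2)"
      by simp
  qed
  have "(\<Sum>v\<in>rverts G N. \<Sum>u\<in>radj G N v. (cmod (f u - of_real \<sigma> * f v))\<^sup>2)
      = (\<Sum>v\<in>rverts G N. \<Sum>u\<in>radj G N v. (cmod (f u))\<^sup>2)
        + (\<Sum>v\<in>rverts G N. \<Sum>u\<in>radj G N v. (cmod (f v))\<^sup>2)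
        - 2 * \<sigma> * (\<Sum>v\<in>rverts G N. \<Sum>u\<in>radj G N v. Re (f u * cnj (f v)))"
    unfolding sq by (simp only: sum.distrib sum_subtractf sum_distrib_left)
  also have "\<dots> = ?S + ?S - 2 * \<sigma> * (?c * ?S)" unfolding S' S R ..
  also have "\<dots> = 2 * (1 - \<sigma> * ?c) * ?S" by (simp add: algebra_simps)
  finally show ?thesis .
qed

text \<open>The assumption on \<sigma> makes the energy zero, and a sum of squares vanishes
  termwise. The lemma is applied with \<sigma> = 1 at the bottom \<mu> = 0 and with \<sigma> = -1 at
  the top \<mu> = 2 N^2 of the spectrum, where sin \<theta> = 0 prevents solving for the wave
  coefficients.\<close>

lemma eigenspace_N_extreme:
  assumes f: "f \<in> eigenspace_N G N \<mu>" and \<sigma>: "\<sigma>\<^sup>2 = 1" "\<sigma> * (1 - \<mu> / (real N)\<^sup>2) = 1"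
    and e: "e \<in> edges G" and n: "n < N"
  shows "f (sp e (Suc n)) = of_real \<sigma> * f (sp e n)"
proof -
  define d where "d e n = (cmod (f (sp e n) - of_real \<sigma> * f (sp e (Suc n))))\<^sup>2
       + (cmod (f (sp e (Suc n)) - of_real \<sigma> * f (sp e n)))\<^sup>2" for e n
  have d_nonneg: "0 \<le> d e n" for e n by (simp add: d_def)
  have "(\<Sum>v\<in>rverts G N. \<Sum>u\<in>radj G N v. (cmod (f u - of_real \<sigma> * f v))\<^sup>2) = 0"
    using eigenspace_energy[OF f \<sigma>(1)] \<sigma>(2) by simp
  then have "(\<Sum>e\<in>edges G. \<Sum>n<N. d e n) = 0"
    unfolding sum_radj_pairs[of "\<lambda>u v. (cmod (f u - of_real \<sigma> * f v))\<^sup>2"] d_def .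
  then have "(\<Sum>n<N. d e n) = 0"
    using sum_nonneg_eq_0_iff[OF finite_edges, of "\<lambda>e. \<Sum>n<N. d e n"] e d_nonneg
    by (simp add: sum_nonneg)
  then have "d e n = 0"
    using n by (intro sum_nonneg_0[of "{..<N}" "d e"]) (simp_all add: d_nonneg)
  moreover have "(cmod (f (sp e (Suc n)) - of_real \<sigma> * f (sp e n)))\<^sup>2 \<le> d e n"
    unfolding d_def by (rule le_add_same_cancel2[THEN iffD2]) (rule zero_le_power2)
  ultimately have "cmod (f (sp e (Suc n)) - of_real \<sigma> * f (sp e n)) = 0"
    by (metis power2_less_eq_zero_iff)
  then show ?thesis unfolding norm_eq_zero right_minus_eq .
qed

text \<open>Both energies are nonnegative, while the degree-weighted norm of \<open>f\<close> is
  positive.\<close>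

lemma eigenvalue_N_bounds:
  assumes f: "f \<in> eigenspace_N G N \<mu>" and nz: "f \<noteq> (\<lambda>_. 0)"
  shows "\<bar>1 - \<mu> / (real N)\<^sup>2\<bar> \<le> 1"
proof -
  let ?S = "\<Sum>v\<in>rverts G N. real (rdeg G N v) * (cmod (f v))\<^sup>2"
  have f0: "f v = 0" if "v \<notin> rverts G N" for v using f that by (auto simp: eigenspace_N_def HN_def)
  with nz obtain v where v: "v \<in> rverts G N" "f v \<noteq> 0" by (auto simp: fun_eq_iff)
  have "0 < real (rdeg G N v) * (cmod (f v))\<^sup>2" using v rdeg_pos by simp
  also have "\<dots> \<le> ?S" using v finite_rverts by (intro member_le_sum) auto
  finally have S: "0 < ?S" .
  have "0 \<le> 2 * (1 - \<sigma> * (1 - \<mu> / (real N)\<^sup>2)) * ?S" if "\<sigma>\<^sup>2 = 1" for \<sigma> :: real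
    unfolding eigenspace_energy[OF f that, symmetric] by (intro sum_nonneg) auto
  then have "0 \<le> 1 - \<sigma> * (1 - \<mu> / (real N)\<^sup>2)" if "\<sigma>\<^sup>2 = 1" for \<sigma> :: real
    using that S by (auto simp: zero_le_mult_iff)
  from this[of 1] this[of "-1"] show ?thesis by simp
qed

section \<open>Sampling functions of the continuous graph\<close>

definition vertex_continuous :: "'v gfun \<Rightarrow> bool" where
  "vertex_continuous \<phi> \<longleftrightarrow> (\<forall>e\<in>edges G. \<forall>e'\<in>edges G. \<forall>t\<in>{0, 1}. \<forall>t'\<in>{0, 1}.
        endpoint G e t = endpoint G e' t' \<longrightarrow> \<phi> (e, t) = \<phi> (e', t'))"

text \<open>The choice in \<open>restrict_N\<close> may fall on another edge through the same old
  vertex; continuity makes the values agree.\<close>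

lemma restrict_N_sp:
  assumes \<phi>: "vertex_continuous \<phi>" and e: "e \<in> edges G" and n: "n \<le> N"
  shows "restrict_N G N \<phi> (sp e n) = \<phi> (e, real n / real N)"
proof -
  let ?Q = "\<lambda>(e', n'). e' \<in> edges G \<and> n' \<le> N \<and> sp e' n' = sp e n"
  obtain e' n' where en: "(SOME p. ?Q p) = (e', n')" by fastforce
  have "?Q (SOME p. ?Q p)" by (rule someI[of _ "(e, n)"]) (use e n in auto)
  then have Q: "e' \<in> edges G" "n' \<le> N" "sp e' n' = sp e n" unfolding en by auto
  have "\<phi> (e', real n' / real N) = \<phi> (e, real n / real N)"
  proof (cases "0 < n \<and> n < N")
    case True
    then have "sp e n = New e n" by (simp add: sp_simps)
    with Q show ?thesis by (simp add: sp_eq_New)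
  next
    case False
    then have *: "n = 0 \<or> n = N" using n by auto
    then have "n' = 0 \<or> n' = N" using Q by (auto simp: subdiv_point_def split: if_splits)
    then have "\<phi> (e', if n' = 0 then 0 else 1) = \<phi> (e, if n = 0 then 0 else 1)"
      using * \<phi> Q(1) e Q(3) N_pos
      by (intro \<phi>[unfolded vertex_continuous_def, rule_format]) (auto simp: endpoint_def sp_simps)
    then show ?thesis using * \<open>n' = 0 \<or> n' = N\<close> N_pos by (auto split: if_splits)
  qed
  then show ?thesis using sp_in_rverts[OF e n] by (simp add: restrict_N_def en)
qed

lemma restrict_N_HN: "restrict_N G N \<phi> \<in> HN G N"
  by (simp add: restrict_N_def HN_def)

lemma HN_eqI:
  assumes "f \<in> HN G N" "g \<in> HN G N" "\<And>e n. e \<in> edges G \<Longrightarrow> n \<le> N \<Longrightarrow> f (sp e n) = g (sp e n)"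
  shows "f = g"
proof
  fix v show "f v = g v"
    using assms by (cases "v \<in> rverts G N") (auto simp: HN_def elim: rverts_cases)
qed

end

section \<open>The kernel of the continuous Laplacian\<close>

lemma L2_unit_continuous:
  assumes "continuous_on {0..1} h"
  shows "L2_unit h"
proof -
  have "continuous_on {0..1} (\<lambda>x. (cmod (h x))\<^sup>2)"
    using assms by (intro continuous_intros)
  then show ?thesis
    using assms unfolding L2_unit_def
    by (auto intro: continuous_imp_measurable_on_sets_lebesgue continuous_imp_integrable_real)
qed

text \<open>Serves for second derivatives, which are known only up to a null set. Lebesgue
  measurability survives changes on null sets, as the measure is complete.\<close>

lemma L2_unit_AE_eq_continuous:
  assumes g: "continuous_on {0..1} g" and ae: "AE x in lebesgue_on {0..1}. g x = h x"
  shows "L2_unit h"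
proof -
  have ae': "AE x in lebesgue. x \<in> {0..1} \<longrightarrow> g x = h x"
    using ae by (subst (asm) AE_restrict_space_iff) auto
  have "L2_unit g" by (rule L2_unit_continuous) (rule g)
  have "(\<lambda>x. if x \<in> {0..1} then h x else 0) \<in> borel_measurable lebesgue"
  proof (rule borel_measurable_AE)
    show "(\<lambda>x. if x \<in> {0..1} then g x else 0) \<in> borel_measurable lebesgue"
      using \<open>L2_unit g\<close> by (subst borel_measurable_if) (auto simp: L2_unit_def)
    show "AE x in lebesgue. (if x \<in> {0..1} then g x else 0) = (if x \<in> {0..1} then h x else 0)"
      using ae' by eventually_elim auto
  qed
  then have meas: "h \<in> borel_measurable (lebesgue_on {0..1})"
    by (subst (asm) borel_measurable_if) auto
  have "integrable (lebesgue_on {0..1}) (\<lambda>x. (cmod (h x))\<^sup>2)"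
  proof (rule integrable_cong_AE_imp)
    show "integrable (lebesgue_on {0..1}) (\<lambda>x. (cmod (g x))\<^sup>2)"
      using \<open>L2_unit g\<close> by (simp add: L2_unit_def)
    show "(\<lambda>x. (cmod (h x))\<^sup>2) \<in> borel_measurable (lebesgue_on {0..1})"
      using meas by measurable
    show "AE x in lebesgue_on {0..1}. (cmod (g x))\<^sup>2 = (cmod (h x))\<^sup>2"
      using ae by eventually_elim auto
  qed
  with meas show ?thesis by (simp add: L2_unit_def)
qed

lemma AE_lebesgue_on_finite:
  assumes "finite X" "\<And>x. x \<in> {0..1} \<Longrightarrow> x \<notin> X \<Longrightarrow> P x"
  shows "AE x in lebesgue_on {0..1::real}. P x"
proof -
  have "AE x in lebesgue. x \<notin> X"
    using assms(1) by (intro AE_not_in) (simp add: negligible_iff_null_sets[symmetric] negligible_finite)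
  then have "AE x in lebesgue. x \<in> {0..1} \<longrightarrow> P x"
    by eventually_elim (use assms(2) in auto)
  then show ?thesis by (subst AE_restrict_space_iff) auto
qed

section \<open>Absolute continuity and cutting a function into pieces\<close>

definition disjoint_intervals :: "real \<Rightarrow> real \<Rightarrow> (real \<times> real) set \<Rightarrow> bool" where
  "disjoint_intervals a b D \<longleftrightarrow> finite D \<and> (\<forall>(s, t)\<in>D. a \<le> s \<and> s \<le> t \<and> t \<le> b) \<and>
     (\<forall>p\<in>D. \<forall>q\<in>D. p \<noteq> q \<longrightarrow> {fst p<..<snd p} \<inter> {fst q<..<snd q} = {})"

lemma absolutely_continuous_on_interval_iff:
  "absolutely_continuous_on_interval h a b \<longleftrightarrow> (\<forall>\<epsilon>>0. \<exists>\<delta>>0. \<forall>D.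
     disjoint_intervals a b D \<and> (\<Sum>(s, t)\<in>D. t - s) < \<delta> \<longrightarrow> (\<Sum>(s, t)\<in>D. cmod (h t - h s)) < \<epsilon>)"
  unfolding absolutely_continuous_on_interval_def disjoint_intervals_def by (simp only: conj_assoc)

lemma absolutely_continuousE:
  assumes "absolutely_continuous_on_interval h a b" "0 < \<epsilon>"
  obtains \<delta> where "0 < \<delta>" "\<And>D. disjoint_intervals a b D \<Longrightarrow> (\<Sum>(s, t)\<in>D. t - s) < \<delta> \<Longrightarrow>
      (\<Sum>(s, t)\<in>D. cmod (h t - h s)) < \<epsilon>"
proof -
  from assms obtain \<delta> where "0 < \<delta>" "\<forall>D. disjoint_intervals a b D \<and> (\<Sum>(s, t)\<in>D. t - s) < \<delta> \<longrightarrow>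
      (\<Sum>(s, t)\<in>D. cmod (h t - h s)) < \<epsilon>"
    unfolding absolutely_continuous_on_interval_iff by meson
  then show ?thesis by (intro that) blast+
qed

lemma absolutely_continuous_on_interval_cong:
  assumes "\<And>x. x \<in> {a..b} \<Longrightarrow> g x = h x" "absolutely_continuous_on_interval g a b"
  shows "absolutely_continuous_on_interval h a b"
proof -
  have "(\<Sum>(s, t)\<in>D. cmod (h t - h s)) = (\<Sum>(s, t)\<in>D. cmod (g t - g s))"
    if "\<forall>(s, t)\<in>D. a \<le> s \<and> s \<le> t \<and> t \<le> b" for D
    using that by (intro sum.cong) (auto simp: assms(1) split: prod.splits)
  then show ?thesis
    using assms(2) unfolding absolutely_continuous_on_interval_def by (smt (verit))
qed

lemma absolutely_continuous_lipschitz: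
  assumes L: "\<And>s t. a \<le> s \<Longrightarrow> s \<le> t \<Longrightarrow> t \<le> b \<Longrightarrow> cmod (h t - h s) \<le> L * (t - s)" and "0 \<le> L"
  shows "absolutely_continuous_on_interval h a b"
  unfolding absolutely_continuous_on_interval_iff
proof (intro allI impI)
  fix \<epsilon> :: real assume \<epsilon>: "0 < \<epsilon>"
  show "\<exists>\<delta>>0. \<forall>D. disjoint_intervals a b D \<and> (\<Sum>(s, t)\<in>D. t - s) < \<delta> \<longrightarrow> (\<Sum>(s, t)\<in>D. cmod (h t - h s)) < \<epsilon>"
  proof (intro exI conjI allI impI)
    show "0 < \<epsilon> / (L + 1)" using \<epsilon> \<open>0 \<le> L\<close> by simp
    fix D :: "(real \<times> real) set"
    assume D: "disjoint_intervals a b D \<and> (\<Sum>(s, t)\<in>D. t - s) < \<epsilon> / (L + 1)"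
    have "(\<Sum>(s, t)\<in>D. cmod (h t - h s)) \<le> (\<Sum>p\<in>D. L * (snd p - fst p))"
      using D by (intro sum_mono) (auto intro!: L simp: disjoint_intervals_def split: prod.splits)
    also have "\<dots> = L * (\<Sum>(s, t)\<in>D. t - s)" by (simp add: sum_distrib_left case_prod_beta)
    also have "\<dots> \<le> L * (\<epsilon> / (L + 1))" using D \<open>0 \<le> L\<close> by (intro mult_left_mono) auto
    also have "\<dots> < \<epsilon>" using \<epsilon> \<open>0 \<le> L\<close> by (simp add: field_simps)
    finally show "(\<Sum>(s, t)\<in>D. cmod (h t - h s)) < \<epsilon>" .
  qed
qed

lemma absolutely_continuous_imp_continuous:
  assumes "absolutely_continuous_on_interval h a b"
  shows "continuous_on {a..b} h"
  unfolding continuous_on_iff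
proof (intro ballI allI impI)
  fix x and \<epsilon> :: real assume x: "x \<in> {a..b}" and "0 < \<epsilon>"
  from absolutely_continuousE[OF assms \<open>0 < \<epsilon>\<close>] obtain \<delta> where "0 < \<delta>" and
    \<delta>: "\<And>D. disjoint_intervals a b D \<Longrightarrow> (\<Sum>(s, t)\<in>D. t - s) < \<delta> \<Longrightarrow> (\<Sum>(s, t)\<in>D. cmod (h t - h s)) < \<epsilon>"
    by blast
  show "\<exists>d>0. \<forall>x'\<in>{a..b}. dist x' x < d \<longrightarrow> dist (h x') (h x) < \<epsilon>"
  proof (intro exI conjI ballI impI)
    fix x' assume "x' \<in> {a..b}" "dist x' x < \<delta>"
    then have "(\<Sum>(s, t)\<in>{(min x x', max x x')}. cmod (h t - h s)) < \<epsilon>"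
      using x by (intro \<delta>) (auto simp: dist_real_def disjoint_intervals_def)
    then show "dist (h x') (h x) < \<epsilon>"
      by (cases "x \<le> x'") (auto simp: dist_norm norm_minus_commute min_def max_def)
  qed fact
qed

lemma absolutely_continuous_add_scaled:
  assumes f: "absolutely_continuous_on_interval f a b"
    and g: "absolutely_continuous_on_interval g a b"
  shows "absolutely_continuous_on_interval (\<lambda>x. f x + c * g x) a b"
  unfolding absolutely_continuous_on_interval_iff
proof (intro allI impI)
  fix \<epsilon> :: real assume \<epsilon>: "0 < \<epsilon>"
  have pos: "0 < \<epsilon> / 2" "0 < \<epsilon> / (2 * (cmod c + 1))" using \<epsilon> by (auto simp: add_nonneg_pos)
  obtain \<delta>1 where "0 < \<delta>1" and \<delta>1: "\<And>D. disjoint_intervals a b D \<Longrightarrow> (\<Sum>(s, t)\<in>D. t - s) < \<delta>1 \<Longrightarrow>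
      (\<Sum>(s, t)\<in>D. cmod (f t - f s)) < \<epsilon> / 2"
    using absolutely_continuousE[OF f pos(1)] by blast
  obtain \<delta>2 where "0 < \<delta>2" and \<delta>2: "\<And>D. disjoint_intervals a b D \<Longrightarrow> (\<Sum>(s, t)\<in>D. t - s) < \<delta>2 \<Longrightarrow>
      (\<Sum>(s, t)\<in>D. cmod (g t - g s)) < \<epsilon> / (2 * (cmod c + 1))"
    using absolutely_continuousE[OF g pos(2)] by blast
  have "(\<Sum>(s, t)\<in>D. cmod (f t + c * g t - (f s + c * g s))) < \<epsilon>"
    if D: "disjoint_intervals a b D" "(\<Sum>(s, t)\<in>D. t - s) < min \<delta>1 \<delta>2" for D
  proof -
    have "(\<Sum>(s, t)\<in>D. cmod (f t + c * g t - (f s + c * g s)))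
        \<le> (\<Sum>(s, t)\<in>D. cmod (f t - f s) + cmod c * cmod (g t - g s))"
    proof (rule sum_mono, clarify)
      fix s t
      have "f t + c * g t - (f s + c * g s) = (f t - f s) + c * (g t - g s)" by (simp add: algebra_simps)
      then show "cmod (f t + c * g t - (f s + c * g s)) \<le> cmod (f t - f s) + cmod c * cmod (g t - g s)"
        by (metis norm_mult norm_triangle_ineq)
    qed
    also have "\<dots> = (\<Sum>(s, t)\<in>D. cmod (f t - f s)) + cmod c * (\<Sum>(s, t)\<in>D. cmod (g t - g s))"
      by (simp add: sum.distrib sum_distrib_left case_prod_beta)
    also have "\<dots> < \<epsilon> / 2 + \<epsilon> / 2"
    proof (rule add_less_le_mono)
      show "(\<Sum>(s, t)\<in>D. cmod (f t - f s)) < \<epsilon> / 2" using D by (intro \<delta>1) auto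
      have "(\<Sum>(s, t)\<in>D. cmod (g t - g s)) < \<epsilon> / (2 * (cmod c + 1))" using D by (intro \<delta>2) auto
      then have "cmod c * (\<Sum>(s, t)\<in>D. cmod (g t - g s)) \<le> cmod c * (\<epsilon> / (2 * (cmod c + 1)))"
        by (intro mult_left_mono) auto
      also have "\<dots> = (\<epsilon> * cmod c) / (2 * (cmod c + 1))" by simp
      also have "\<dots> \<le> (\<epsilon> * (cmod c + 1)) / (2 * (cmod c + 1))"
        using \<epsilon> by (intro divide_right_mono mult_left_mono) auto
      also have "\<dots> = \<epsilon> / 2" using norm_ge_zero[of c]
        by (intro nonzero_mult_divide_mult_cancel_right) linarith
      finally show "cmod c * (\<Sum>(s, t)\<in>D. cmod (g t - g s)) \<le> \<epsilon> / 2" .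
    qed
    finally show ?thesis by simp
  qed
  then show "\<exists>\<delta>>0. \<forall>D. disjoint_intervals a b D \<and> (\<Sum>(s, t)\<in>D. t - s) < \<delta> \<longrightarrow> (\<Sum>(s, t)\<in>D. cmod (f t + c * g t - (f s + c * g s))) < \<epsilon>"
    using \<open>0 < \<delta>1\<close> \<open>0 < \<delta>2\<close> by (intro exI[of _ "min \<delta>1 \<delta>2"]) auto
qed

lemma absolutely_continuous_sum:
  assumes "finite J" "\<And>j. j \<in> J \<Longrightarrow> absolutely_continuous_on_interval (g j) a b"
  shows "absolutely_continuous_on_interval (\<lambda>x. \<Sum>j\<in>J. c j * g j x) a b"
  using assms
proof (induction J rule: finite_induct)
  case empty
  show ?case by (rule absolutely_continuous_lipschitz[of _ _ _ 0]) auto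
next
  case (insert j J)
  then have "absolutely_continuous_on_interval (\<lambda>x. (\<Sum>j\<in>J. c j * g j x) + c j * g j x) a b"
    by (intro absolutely_continuous_add_scaled) auto
  with insert show ?case by (simp add: add.commute)
qed

text \<open>The part of the variation of \<open>h\<close> that happens on [s, t]: for s \<le> t it
  is 0 to the left of s and the full increment \<open>h t - h s\<close> to the right of t.\<close>

definition clamp_diff :: "(real \<Rightarrow> complex) \<Rightarrow> real \<Rightarrow> real \<Rightarrow> real \<Rightarrow> complex" where
  "clamp_diff h s t x = h (max s (min x t)) - h s"

text \<open>Clamping sends disjoint intervals to disjoint intervals of no greater total length, so
  the \<delta> of \<open>h\<close> serves.\<close>

lemma absolutely_continuous_clamp_diff:
  assumes h: "absolutely_continuous_on_interval h a b" and st: "a \<le> s" "s \<le> t" "t \<le> b"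
  shows "absolutely_continuous_on_interval (clamp_diff h s t) a b"
  unfolding absolutely_continuous_on_interval_iff
proof (intro allI impI)
  fix \<epsilon> :: real assume "0 < \<epsilon>"
  obtain \<delta> where "0 < \<delta>" and \<delta>: "\<And>D. disjoint_intervals a b D \<Longrightarrow> (\<Sum>(s, t)\<in>D. t - s) < \<delta> \<Longrightarrow>
      (\<Sum>(s, t)\<in>D. cmod (h t - h s)) < \<epsilon>"
    using absolutely_continuousE[OF h \<open>0 < \<epsilon>\<close>] by blast
  define cl where "cl x = max s (min x t)" for x
  have "(\<Sum>(u, v)\<in>D. cmod (clamp_diff h s t v - clamp_diff h s t u)) < \<epsilon>"
    if D: "disjoint_intervals a b D" "(\<Sum>(s, t)\<in>D. t - s) < \<delta>" for D
  proof -
    \<comment> \<open>Intervals that collapse under clamping contribute nothing and are dropped;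
      otherwise \<tau> could send several of them to the same pair.\<close>
    define D' where "D' = {p \<in> D. cl (fst p) < cl (snd p)}"
    define \<tau> where "\<tau> p = (cl (fst p), cl (snd p))" for p
    have fin: "finite D" "finite D'" using D by (auto simp: D'_def disjoint_intervals_def)
    have Dp: "a \<le> fst p \<and> fst p \<le> snd p \<and> snd p \<le> b" if "p \<in> D" for p
      using D that by (auto simp: disjoint_intervals_def)
    have sub: "{fst (\<tau> p)<..<snd (\<tau> p)} \<subseteq> {fst p<..<snd p}" for p
      using st by (auto simp: \<tau>_def cl_def max_def min_def split: if_splits)
    have disj: "{fst (\<tau> p)<..<snd (\<tau> p)} \<inter> {fst (\<tau> q)<..<snd (\<tau> q)} = {}"
      if "p \<in> D'" "q \<in> D'" "p \<noteq> q" for p q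
      using sub[of p] sub[of q] that D unfolding D'_def disjoint_intervals_def by blast
    have inj: "inj_on \<tau> D'"
    proof (rule inj_onI, rule ccontr)
      fix p q assume pq: "p \<in> D'" "q \<in> D'" "\<tau> p = \<tau> q" "p \<noteq> q"
      then have "{fst (\<tau> p)<..<snd (\<tau> p)} = {}" using disj[of p q] by simp
      with pq(1) show False by (auto simp: D'_def \<tau>_def)
    qed
    have "(\<Sum>(u, v)\<in>D. cmod (clamp_diff h s t v - clamp_diff h s t u))
        = (\<Sum>p\<in>D. cmod (h (cl (snd p)) - h (cl (fst p))))"
      by (simp add: clamp_diff_def cl_def case_prod_beta)
    also have "\<dots> = (\<Sum>p\<in>D'. cmod (h (cl (snd p)) - h (cl (fst p))))"
    proof (rule sum.mono_neutral_right)
      show "\<forall>p\<in>D - D'. cmod (h (cl (snd p)) - h (cl (fst p))) = 0"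
      proof
        fix p assume p: "p \<in> D - D'"
        have "cl (fst p) \<le> cl (snd p)" using Dp[of p] p by (auto simp: cl_def max_def min_def)
        with p have "cl (fst p) = cl (snd p)" by (auto simp: D'_def)
        then show "cmod (h (cl (snd p)) - h (cl (fst p))) = 0" by simp
      qed
    qed (use fin in \<open>auto simp: D'_def\<close>)
    also have "\<dots> = (\<Sum>(u, v)\<in>\<tau> ` D'. cmod (h v - h u))"
      by (subst sum.reindex[OF inj]) (simp add: \<tau>_def)
    also have "\<dots> < \<epsilon>"
    proof (rule \<delta>)
      have "a \<le> fst (\<tau> p) \<and> fst (\<tau> p) \<le> snd (\<tau> p) \<and> snd (\<tau> p) \<le> b" if "p \<in> D'" for p
        using that st by (auto simp: D'_def \<tau>_def cl_def)
      moreover have "\<forall>p\<in>\<tau> ` D'. \<forall>q\<in>\<tau> ` D'. p \<noteq> q \<longrightarrow> {fst p<..<snd p} \<inter> {fst q<..<snd q} = {}"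
        using disj by blast
      ultimately show "disjoint_intervals a b (\<tau> ` D')" using fin by (auto simp: case_prod_beta disjoint_intervals_def)
      have "(\<Sum>(u, v)\<in>\<tau> ` D'. v - u) = (\<Sum>p\<in>D'. snd (\<tau> p) - fst (\<tau> p))"
        by (subst sum.reindex[OF inj]) (simp add: case_prod_beta)
      also have "\<dots> \<le> (\<Sum>p\<in>D'. snd p - fst p)"
      proof (rule sum_mono)
        fix p assume "p \<in> D'"
        then have "fst p \<le> snd p" using Dp by (auto simp: D'_def)
        then show "snd (\<tau> p) - fst (\<tau> p) \<le> snd p - fst p"
          using st by (auto simp: \<tau>_def cl_def max_def min_def)
      qed
      also have "\<dots> \<le> (\<Sum>p\<in>D. snd p - fst p)"
        using fin Dp by (intro sum_mono2) (auto simp: D'_def)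
      also have "\<dots> < \<delta>" using D(2) by (simp add: case_prod_beta)
      finally show "(\<Sum>(u, v)\<in>\<tau> ` D'. v - u) < \<delta>" .
    qed
    finally show ?thesis .
  qed
  then show "\<exists>\<delta>>0. \<forall>D. disjoint_intervals a b D \<and> (\<Sum>(s, t)\<in>D. t - s) < \<delta> \<longrightarrow> (\<Sum>(u, v)\<in>D. cmod (clamp_diff h s t v - clamp_diff h s t u)) < \<epsilon>"
    using \<open>0 < \<delta>\<close> by (intro exI[of _ \<delta>]) auto
qed

text \<open>Relates \<open>g\<close> to \<open>h\<close> near \<open>x\<close> without asking either
  to be differentiable; c = 0 covers the stretches where a clamped piece is constant.\<close>

definition locally_affine_in :: "(real \<Rightarrow> complex) \<Rightarrow> (real \<Rightarrow> complex) \<Rightarrow> real \<Rightarrow> bool" where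
  "locally_affine_in h g x \<longleftrightarrow> (\<exists>c d r. 0 < r \<and> (\<forall>y\<in>{0..1}. \<bar>y - x\<bar> < r \<longrightarrow> g y = c * h y + d))"

lemma locally_affine_in_sum:
  assumes "finite J" "\<And>j. j \<in> J \<Longrightarrow> locally_affine_in h (g j) x"
  shows "locally_affine_in h (\<lambda>x. \<Sum>j\<in>J. a j * g j x) x"
  using assms
proof (induction J rule: finite_induct)
  case empty
  show ?case unfolding locally_affine_in_def by (intro exI[of _ 0] exI[of _ 1]) auto
next
  case (insert j J)
  obtain c d r where "0 < r" "\<forall>y\<in>{0..1}. \<bar>y - x\<bar> < r \<longrightarrow> (\<Sum>j\<in>J. a j * g j y) = c * h y + d"
    using insert unfolding locally_affine_in_def by blast
  moreover obtain c' d' r' where "0 < r'" "\<forall>y\<in>{0..1}. \<bar>y - x\<bar> < r' \<longrightarrow> g j y = c' * h y + d'"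
    using insert.prems[of j] unfolding locally_affine_in_def by blast
  ultimately have "0 < min r r' \<and> (\<forall>y\<in>{0..1}. \<bar>y - x\<bar> < min r r' \<longrightarrow>
      (\<Sum>j\<in>insert j J. a j * g j y) = (a j * c' + c) * h y + (a j * d' + d))"
    using insert.hyps by (auto simp: algebra_simps)
  then show ?case unfolding locally_affine_in_def by blast
qed

lemma locally_affine_in_clamp_diff:
  assumes "x \<noteq> s" "x \<noteq> t" "s < t"
  shows "locally_affine_in h (clamp_diff h s t) x"
proof -
  consider "x < s" | "s < x" "x < t" | "t < x" using assms by linarith
  then show ?thesis
  proof cases
    case 1
    then show ?thesis using assms unfolding locally_affine_in_def clamp_diff_def
      by (intro exI[of _ 0] exI[of _ "s - x"]) auto
  next
    case 2
    have "clamp_diff h s t y = 1 * h y + - h s" if "\<bar>y - x\<bar> < min (x - s) (t - x)" for y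
    proof -
      have "max s (min y t) = y" using that by auto
      then show ?thesis by (simp add: clamp_diff_def)
    qed
    then show ?thesis using 2 unfolding locally_affine_in_def
      by (intro exI[of _ 1] exI[of _ "- h s"] exI[of _ "min (x - s) (t - x)"]) auto
  next
    case 3
    have "clamp_diff h s t y = 0 * h y + (h t - h s)" if "\<bar>y - x\<bar> < x - t" for y
    proof -
      have "max s (min y t) = t" using that assms by auto
      then show ?thesis by (simp add: clamp_diff_def)
    qed
    then show ?thesis using 3 unfolding locally_affine_in_def
      by (intro exI[of _ 0] exI[of _ "h t - h s"] exI[of _ "x - t"]) auto
  qed
qed

text \<open>
  At a point where \<open>h\<close> is not differentiable, \<open>vector_derivative\<close> is an unspecified constant,
  the same for all functions; this is why the lemma holds at such points, too.
\<close>

lemma vector_derivative_locally_affine: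
  assumes x: "x \<in> {0..1}" and g: "locally_affine_in h g x"
    and h: "vector_derivative h (at x within {0..1}) = 0"
  shows "vector_derivative g (at x within {0..1}) = 0"
proof -
  obtain c d r where r: "0 < r" and eq: "\<And>y. y \<in> {0..1} \<Longrightarrow> \<bar>y - x\<bar> < r \<Longrightarrow> g y = c * h y + d"
    using g unfolding locally_affine_in_def by blast
  have g_deriv: "(g has_vector_derivative c * D) (at x within {0..1})"
    if "(h has_vector_derivative D) (at x within {0..1})" for D
  proof (rule has_vector_derivative_transform_within[OF _ r x])
    show "((\<lambda>y. c * h y + d) has_vector_derivative c * D) (at x within {0..1})"
      using that by (auto intro!: derivative_eq_intros)
  qed (auto simp: eq dist_real_def)
  show ?thesis
  proof (cases "\<exists>D. (h has_vector_derivative D) (at x within {0..1})")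
    case True
    then have "(h has_vector_derivative 0) (at x within {0..1})"
      using h vector_derivative_within_closed_interval[OF _ x] by (metis zero_less_one)
    from g_deriv[OF this] show ?thesis
      using x by (intro vector_derivative_within_closed_interval) auto
  next
    case False
    show ?thesis
    proof (cases "\<exists>D. (g has_vector_derivative D) (at x within {0..1})")
      case True
      then obtain D where D: "(g has_vector_derivative D) (at x within {0..1})" ..
      have "c = 0"
      proof (rule ccontr)
        assume "c \<noteq> 0"
        have "(h has_vector_derivative D / c) (at x within {0..1})"
        proof (rule has_vector_derivative_transform_within[OF _ r x])
          show "((\<lambda>y. (g y - d) / c) has_vector_derivative D / c) (at x within {0..1})"
            using D \<open>c \<noteq> 0\<close> by (auto intro!: derivative_eq_intros)
        qed (use \<open>c \<noteq> 0\<close> in \<open>auto simp: eq dist_real_def\<close>)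
        with False show False by blast
      qed
      have "(g has_vector_derivative 0) (at x within {0..1})"
      proof (rule has_vector_derivative_transform_within[OF _ r x])
        show "((\<lambda>y. d) has_vector_derivative 0) (at x within {0..1})" by simp
      qed (auto simp: eq dist_real_def \<open>c = 0\<close>)
      then show ?thesis using x by (intro vector_derivative_within_closed_interval) auto
    next
      case False
      then have "vector_derivative g (at x within {0..1}) = vector_derivative h (at x within {0..1})"
        using \<open>\<not> (\<exists>D. (h has_vector_derivative D) (at x within {0..1}))\<close>
        by (simp add: vector_derivative_def)
      with h show ?thesis by simp
    qed
  qed
qed

text \<open>By the intermediate value theorem some c has |h c - h a| equal to half of |h b - h a|.
  Then h differs between a and c and between c and b, and the second gap is split further.\<close>

lemma oscillation_points:
  fixes h :: "real \<Rightarrow> complex"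
  assumes "continuous_on {0..1} h" "0 \<le> a" "a < b" "b \<le> 1" "h a \<noteq> h b"
  shows "\<exists>s. s 0 = a \<and> s (n::nat) \<le> b \<and> (\<forall>i<n. s i < s (Suc i) \<and> h (s i) \<noteq> h (s (Suc i)))"
  using assms
proof (induction n arbitrary: a)
  case 0
  then show ?case by (intro exI[of _ "\<lambda>_. a"]) auto
next
  case (Suc n)
  define u where "u x = cmod (h x - h a)" for x
  have cont: "continuous_on {a..b} u"
    unfolding u_def using Suc.prems
    by (intro continuous_intros continuous_on_subset[OF Suc.prems(1)]) auto
  have ub: "0 < u b" "u a = 0" using Suc.prems by (auto simp: u_def)
  then obtain c where c: "a \<le> c" "c \<le> b" "u c = u b / 2"
    using IVT'[of u a "u b / 2" b] cont Suc.prems by auto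
  with ub have "a \<noteq> c" "c \<noteq> b" by auto
  with c have ac: "a < c" "c < b" by auto
  have "h c \<noteq> h b" "h a \<noteq> h c" using c(3) ub by (auto simp: u_def)
  then obtain s where s: "s 0 = c" "s n \<le> b" "\<forall>i<n. s i < s (Suc i) \<and> h (s i) \<noteq> h (s (Suc i))"
    using Suc.IH[of c] Suc.prems ac by auto
  show ?case
    by (intro exI[of _ "case_nat a s"])
      (use s ac \<open>h a \<noteq> h c\<close> in \<open>auto split: nat.split simp: less_Suc_eq_0_disj\<close>)
qed

lemma edge_deriv_eq:
  assumes "x \<in> {0..1}" "\<And>y. y \<in> {0..1} \<Longrightarrow> \<phi> (e, y) = g y"
    and "(g has_vector_derivative d) (at x within {0..1})"
  shows "edge_deriv \<phi> (e, x) = d"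
  unfolding edge_deriv_def prod.case
  by (rule vector_derivative_within_closed_interval)
    (use assms in \<open>auto intro: has_vector_derivative_transform\<close>)

lemma inner_inf_sum_left:
  assumes "finite J" "\<And>j e. j \<in> J \<Longrightarrow> e \<in> edges G \<Longrightarrow> continuous_on {0..1} (\<lambda>x. \<phi> j (e, x))"
    "\<And>e. e \<in> edges G \<Longrightarrow> continuous_on {0..1} (\<lambda>x. g (e, x))"
  shows "inner_inf G (\<lambda>p. \<Sum>j\<in>J. c j * \<phi> j p) g = (\<Sum>j\<in>J. c j * inner_inf G (\<phi> j) g)"
proof -
  let ?M = "lebesgue_on {0..1::real}"
  have "(\<Sum>e\<in>edges G. LINT x|?M. (\<Sum>j\<in>J. c j * \<phi> j (e, x)) * cnj (g (e, x)))
      = (\<Sum>e\<in>edges G. \<Sum>j\<in>J. c j * (LINT x|?M. \<phi> j (e, x) * cnj (g (e, x))))"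
  proof (rule sum.cong[OF refl])
    fix e assume e: "e \<in> edges G"
    have int: "integrable ?M (\<lambda>x. c j * (\<phi> j (e, x) * cnj (g (e, x))))" if "j \<in> J" for j
      using assms(2)[OF that e] assms(3)[OF e]
      by (intro continuous_imp_integrable_real continuous_intros)
    have "(LINT x|?M. (\<Sum>j\<in>J. c j * \<phi> j (e, x)) * cnj (g (e, x)))
        = (LINT x|?M. (\<Sum>j\<in>J. c j * (\<phi> j (e, x) * cnj (g (e, x)))))"
      by (simp add: sum_distrib_right mult.assoc)
    also have "\<dots> = (\<Sum>j\<in>J. LINT x|?M. c j * (\<phi> j (e, x) * cnj (g (e, x))))"
      by (rule Bochner_Integration.integral_sum) (rule int)
    finally show "(LINT x|?M. (\<Sum>j\<in>J. c j * \<phi> j (e, x)) * cnj (g (e, x)))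
      = (\<Sum>j\<in>J. c j * (LINT x|?M. \<phi> j (e, x) * cnj (g (e, x))))" by simp
  qed
  also have "\<dots> = (\<Sum>j\<in>J. c j * (\<Sum>e\<in>edges G. LINT x|?M. \<phi> j (e, x) * cnj (g (e, x))))"
    by (subst sum.swap) (simp add: sum_distrib_left)
  finally show ?thesis by (simp add: inner_inf_def sum_divide_distrib[where A = J])
qed

lemma dom_Delta_inf_continuous:
  assumes "f \<in> dom_Delta_inf G" "e \<in> edges G"
  shows "continuous_on {0..1} (\<lambda>x. f (e, x))"
  using assms unfolding dom_Delta_inf_def
  by (auto simp: continuous_on_eq_continuous_within intro: differentiable_imp_continuous_within)

lemma absolutely_continuous_bounded_derivative:
  assumes h: "\<And>x. x \<in> {a..b} \<Longrightarrow> (h has_vector_derivative h' x) (at x within {a..b})"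
    and L: "\<And>x. x \<in> {a..b} \<Longrightarrow> cmod (h' x) \<le> L" and "0 \<le> L"
  shows "absolutely_continuous_on_interval h a b"
proof (rule absolutely_continuous_lipschitz)
  fix s t assume st: "a \<le> s" "s \<le> t" "t \<le> b"
  have "cmod (h t - h s) \<le> L * norm (t - s)"
  proof (rule differentiable_bound)
    show "convex {a..b}" by (rule convex_real_interval)
    show "(h has_derivative (\<lambda>d. d *\<^sub>R h' x)) (at x within {a..b})" if "x \<in> {a..b}" for x
      using h[OF that] by (simp add: has_vector_derivative_def)
    show "onorm (\<lambda>d. d *\<^sub>R h' x) \<le> L" if "x \<in> {a..b}" for x
    proof (rule onorm_le)
      fix d :: real
      show "norm (d *\<^sub>R h' x) \<le> L * norm d"
        using mult_right_mono[OF L[OF that], of "\<bar>d\<bar>"] by (simp add: mult.commute)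
    qed
  qed (use st in auto)
  then show "cmod (h t - h s) \<le> L * (t - s)" using st by simp
qed fact

lemma vector_derivative_cong_within:
  assumes "x \<in> S" "\<And>y. y \<in> S \<Longrightarrow> f y = g y"
  shows "vector_derivative f (at x within S) = vector_derivative g (at x within S)"
proof -
  have "(f has_vector_derivative d) (at x within S) \<longleftrightarrow> (g has_vector_derivative d) (at x within S)" for d
    using has_vector_derivative_transform[of x S f g d] has_vector_derivative_transform[of x S g f d]
      assms by auto
  then show ?thesis by (simp add: vector_derivative_def)
qed

lemma edge_deriv_has_vector_derivative:
  assumes "f \<in> dom_Delta_inf G" "e \<in> edges G" "x \<in> {0..1}"
  shows "((\<lambda>y. f (e, y)) has_vector_derivative edge_deriv f (e, x)) (at x within {0..1})"
proof -
  have "(\<lambda>y. f (e, y)) differentiable (at x within {0..1})"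
    using assms unfolding dom_Delta_inf_def by blast
  then show ?thesis unfolding vector_derivative_works edge_deriv_def by simp
qed

section \<open>The kernel: functions constant on the edges\<close>

context refined_graph
begin

text \<open>\<open>h\<close> plays the role of the first derivative, and its equation is demanded
  almost everywhere, so that both smooth waves and the glued pieces of the kernel argument
  qualify.\<close>

lemma eigenspace_inf_intro:
  assumes out: "\<And>e x. \<not> (e \<in> edges G \<and> x \<in> {0..1}) \<Longrightarrow> \<phi> (e, x) = 0"
    and deriv: "\<And>e. e \<in> edges G \<Longrightarrow> \<exists>h. absolutely_continuous_on_interval h 0 1 \<and>
      (\<forall>x\<in>{0..1}. ((\<lambda>y. \<phi> (e, y)) has_vector_derivative h x) (at x within {0..1})) \<and>
      (AE x in lebesgue_on {0..1}. vector_derivative h (at x within {0..1}) = - of_real \<nu> * \<phi> (e, x))"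
    and cont: "vertex_continuous \<phi>"
    and flux: "\<And>v. v \<in> verts G \<Longrightarrow> (\<Sum>e\<in>incident_edges G v. normal_deriv G \<phi> e v) = 0"
  shows "\<phi> \<in> eigenspace_inf G \<nu>"
proof -
  have edge: "L2_unit (\<lambda>x. \<phi> (e, x)) \<and>
      (\<forall>x\<in>{0..1}. (\<lambda>y. \<phi> (e, y)) differentiable (at x within {0..1})) \<and>
      absolutely_continuous_on_interval (\<lambda>x. edge_deriv \<phi> (e, x)) 0 1 \<and>
      L2_unit (\<lambda>x. edge_deriv (edge_deriv \<phi>) (e, x)) \<and>
      (AE x in lebesgue_on {0..1}. Delta_inf \<phi> (e, x) = of_real \<nu> * \<phi> (e, x))"
    if e: "e \<in> edges G" for e
  proof -
    obtain h where h: "absolutely_continuous_on_interval h 0 1"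
      "\<And>x. x \<in> {0..1} \<Longrightarrow> ((\<lambda>y. \<phi> (e, y)) has_vector_derivative h x) (at x within {0..1})"
      "AE x in lebesgue_on {0..1}. vector_derivative h (at x within {0..1}) = - of_real \<nu> * \<phi> (e, x)"
      using deriv[OF e] by blast
    have ed: "edge_deriv \<phi> (e, x) = h x" if "x \<in> {0..1}" for x
      using that h(2)[OF that] by (intro edge_deriv_eq[of x \<phi> e "\<lambda>y. \<phi> (e, y)"]) auto
    have ed2: "edge_deriv (edge_deriv \<phi>) (e, x) = vector_derivative h (at x within {0..1})"
      if "x \<in> {0..1}" for x
      unfolding edge_deriv_def[of "edge_deriv \<phi>"] prod.case
      using that ed by (intro vector_derivative_cong_within) auto
    have ae: "AE x in lebesgue_on {0..1}. edge_deriv (edge_deriv \<phi>) (e, x) = - of_real \<nu> * \<phi> (e, x)"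
      using h(3) by (rule AE_mp) (intro AE_I2, auto simp: ed2)
    have diff: "(\<lambda>y. \<phi> (e, y)) differentiable (at x within {0..1})" if "x \<in> {0..1}" for x
      using h(2)[OF that] by (auto simp: differentiable_def has_vector_derivative_def)
    then have c: "continuous_on {0..1} (\<lambda>y. \<phi> (e, y))"
      by (auto simp: continuous_on_eq_continuous_within intro: differentiable_imp_continuous_within)
    show ?thesis
    proof (intro conjI ballI)
      show "L2_unit (\<lambda>x. \<phi> (e, x))" by (rule L2_unit_continuous) (rule c)
      show "absolutely_continuous_on_interval (\<lambda>x. edge_deriv \<phi> (e, x)) 0 1"
        by (rule absolutely_continuous_on_interval_cong[OF _ h(1)]) (simp add: ed)
      show "L2_unit (\<lambda>x. edge_deriv (edge_deriv \<phi>) (e, x))"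
      proof (rule L2_unit_AE_eq_continuous)
        show "continuous_on {0..1} (\<lambda>x. - of_real \<nu> * \<phi> (e, x))"
          using c by (intro continuous_intros)
        show "AE x in lebesgue_on {0..1}. - of_real \<nu> * \<phi> (e, x) = edge_deriv (edge_deriv \<phi>) (e, x)"
          using ae by eventually_elim simp
      qed
      show "AE x in lebesgue_on {0..1}. Delta_inf \<phi> (e, x) = of_real \<nu> * \<phi> (e, x)"
        using ae by eventually_elim (simp add: Delta_inf_def)
    qed (rule diff)
  qed
  then have "\<phi> \<in> dom_Delta_inf G"
    using out cont flux unfolding dom_Delta_inf_def vertex_continuous_def by blast
  then show ?thesis using edge by (simp add: eigenspace_inf_def)
qed

lemma eigenspace_inf_dom: "f \<in> eigenspace_inf G \<nu> \<Longrightarrow> f \<in> dom_Delta_inf G"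
  by (simp add: eigenspace_inf_def)

lemma dom_vertex_continuous: "f \<in> dom_Delta_inf G \<Longrightarrow> vertex_continuous f"
  unfolding dom_Delta_inf_def vertex_continuous_def by blast

lemma dom_flux:
  "f \<in> dom_Delta_inf G \<Longrightarrow> v \<in> verts G \<Longrightarrow> (\<Sum>e\<in>incident_edges G v. normal_deriv G f e v) = 0"
  unfolding dom_Delta_inf_def by blast

lemma dom_outside: "f \<in> dom_Delta_inf G \<Longrightarrow> \<not> (e \<in> edges G \<and> x \<in> {0..1}) \<Longrightarrow> f (e, x) = 0"
  unfolding dom_Delta_inf_def by blast

lemma onb_orthogonal_zero:
  assumes onb: "is_onb (inner_inf G) (eigenspace_inf G \<nu>) n \<psi>" and f: "f \<in> eigenspace_inf G \<nu>"
    and orth: "\<And>i. i \<in> {1..n} \<Longrightarrow> inner_inf G f (\<psi> i) = 0"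
  shows "f = (\<lambda>_. 0)"
proof -
  obtain \<gamma> where \<gamma>: "f = (\<lambda>p. \<Sum>j=1..n. \<gamma> j * \<psi> j p)"
    using onb f unfolding is_onb_def by blast
  have \<psi>: "\<psi> j \<in> eigenspace_inf G \<nu>" if "j \<in> {1..n}" for j
    using onb that unfolding is_onb_def by blast
  have "\<gamma> i = 0" if i: "i \<in> {1..n}" for i
  proof -
    have "0 = inner_inf G f (\<psi> i)" using orth[OF i] by simp
    also have "\<dots> = (\<Sum>j=1..n. \<gamma> j * inner_inf G (\<psi> j) (\<psi> i))"
      unfolding \<gamma> using \<psi> i
      by (intro inner_inf_sum_left) (auto intro!: dom_Delta_inf_continuous[of _ G] eigenspace_inf_dom)
    also have "\<dots> = (\<Sum>j=1..n. if j = i then \<gamma> j else 0)"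
      using onb i unfolding is_onb_def by (intro sum.cong) auto
    also have "\<dots> = \<gamma> i" using i by simp
    finally show ?thesis by simp
  qed
  then show ?thesis unfolding \<gamma> by simp
qed

text \<open>
  Nothing is known about \<open>vector_derivative\<close> where \<open>f'\<close> is not differentiable. Instead of showing that
  this happens only on a null set, the proof cuts a nonconstant \<open>f'\<close> into pieces, which would
  generate an infinite dimensional space of elements of the kernel supported on one edge.
\<close>

lemma kernel_edge_deriv_constant:
  assumes onb: "is_onb (inner_inf G) (eigenspace_inf G 0) n \<psi>"
    and f: "f \<in> eigenspace_inf G 0" and e: "e \<in> edges G" and ab: "a \<in> {0..1}" "b \<in> {0..1}"
  shows "edge_deriv f (e, a) = edge_deriv f (e, b)"
  using ab
proof (induction a b rule: linorder_wlog)
  case (le a b)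
  define h where "h x = edge_deriv f (e, x)" for x
  have ac: "absolutely_continuous_on_interval h 0 1"
    using eigenspace_inf_dom[OF f] e unfolding dom_Delta_inf_def h_def by blast
  have ae: "AE x in lebesgue_on {0..1}. vector_derivative h (at x within {0..1}) = 0"
  proof -
    have "AE x in lebesgue_on {0..1}. Delta_inf f (e, x) = of_real 0 * f (e, x)"
      using f e unfolding eigenspace_inf_def by blast
    then show ?thesis
      unfolding Delta_inf_def edge_deriv_def[of "edge_deriv f"] prod.case h_def by simp
  qed
  show ?case
  proof (rule ccontr)
    assume "edge_deriv f (e, a) \<noteq> edge_deriv f (e, b)"
    then have ne: "h a \<noteq> h b" "a < b" using le by (auto simp: h_def less_le)
    \<comment> \<open>There are n + 2 linear conditions below; one unknown more than equations
      forces a nontrivial combination of the pieces.\<close>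
    define M where "M = n + 3"
    obtain s where s: "s 0 = a" "s M \<le> b"
        "\<And>i. i < M \<Longrightarrow> s i < s (Suc i) \<and> h (s i) \<noteq> h (s (Suc i))"
      using oscillation_points[OF absolutely_continuous_imp_continuous[OF ac], of a b M] le ne by auto
    have s_mono: "s i \<le> s j" if "i \<le> j" "j \<le> M" for i j
      using that
    proof (induction j rule: dec_induct)
      case (step j)
      then show ?case using s(3)[of j] by force
    qed simp
    have s01: "0 \<le> s i" "s i \<le> 1" if "i \<le> M" for i
      using s_mono[of 0 i] s_mono[of i M] s that le by auto
    define k where "k i = clamp_diff h (s i) (s (Suc i))" for i
    have k_ac: "absolutely_continuous_on_interval (k i) 0 1" if "i < M" for i
      unfolding k_def using that s01[of i] s01[of "Suc i"] s(3)[of i]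
      by (intro absolutely_continuous_clamp_diff ac) auto
    have k_cont: "continuous_on {0..1} (k i)" if "i < M" for i
      by (rule absolutely_continuous_imp_continuous[OF k_ac[OF that]])
    have k_s: "k i (s m) = (if m \<le> i then 0 else h (s (Suc i)) - h (s i))" if "i < M" "m \<le> M" for i m
    proof (cases "m \<le> i")
      case True
      then show ?thesis using s_mono[of m i] s(3)[of i] that by (simp add: k_def clamp_diff_def)
    next
      case False
      then show ?thesis using s_mono[of "Suc i" m] s(3)[of i] that by (simp add: k_def clamp_diff_def)
    qed
    have k0: "k i 0 = 0" if "i < M" for i
      using s01[of i] s(3)[of i] that by (simp add: k_def clamp_diff_def)
    define F where "F i = (\<lambda>(e', x). if e' = e \<and> x \<in> {0..1} then integral {0..x} (k i) else 0)" for i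
    have F_deriv: "((\<lambda>y. F i (e, y)) has_vector_derivative k i x) (at x within {0..1})"
      if "i < M" "x \<in> {0..1}" for i x
      by (rule has_vector_derivative_transform[OF that(2) _
            integral_has_vector_derivative[OF k_cont[OF that(1)] that(2)]]) (simp add: F_def)
    have F_cont: "continuous_on {0..1} (\<lambda>x. F i (e', x))" if "i < M" for i e'
    proof (cases "e' = e")
      case True
      then show ?thesis
        unfolding continuous_on_eq_continuous_within
        by (auto intro!: has_vector_derivative_continuous F_deriv[OF that])
    next
      case False
      then show ?thesis by (simp add: F_def)
    qed
    \<comment> \<open>Row 0 makes the derivative vanish at 1, row \<open>Suc n\<close> the value at
      1, and the rows 1, ..., n give orthogonality to \<psi>. At 0 value and derivative vanish by
      construction, so the vertex conditions hold with 0 on all other edges.\<close>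
    define eqs where "eqs i j = (if i = 0 then k j 1 else if i = Suc n then integral {0..1} (k j)
      else inner_inf G (F j) (\<psi> i))" for i j
    obtain c where c: "\<exists>j\<in>{..<M}. c j \<noteq> 0" "\<And>i. i \<in> {..Suc n} \<Longrightarrow> (\<Sum>j<M. eqs i j * c j) = 0"
      using homogeneous_system_nontrivial[of "{..Suc n}" "{..<M}" eqs] by (auto simp: M_def)
    define g where "g x = (\<Sum>j<M. c j * k j x)" for x
    define \<phi> where "\<phi> = (\<lambda>p. \<Sum>j<M. c j * F j p)"
    have g1: "g 1 = 0" using c(2)[of 0] by (simp add: g_def eqs_def mult.commute)
    have g0: "g 0 = 0" by (simp add: g_def k0)
    have \<phi>_deriv: "((\<lambda>y. \<phi> (e, y)) has_vector_derivative g x) (at x within {0..1})" if "x \<in> {0..1}" for x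
      unfolding \<phi>_def g_def using that
      by (intro has_vector_derivative_sum has_vector_derivative_mult_right F_deriv) auto
    have ed: "edge_deriv \<phi> (e, x) = g x" if "x \<in> {0..1}" for x
      using edge_deriv_eq[OF that _ \<phi>_deriv[OF that]] by blast
    have \<phi>_other: "\<phi> (e', x) = 0" if "e' \<noteq> e" for e' x using that by (simp add: \<phi>_def F_def)
    have ed_other: "edge_deriv \<phi> (e', x) = 0" if "e' \<noteq> e" "x \<in> {0..1}" for e' x
      using \<phi>_other[OF that(1)] that(2) by (intro edge_deriv_eq[of x \<phi> e' "\<lambda>_. 0"]) auto
    have "integral {0..0} (k j) = 0" for j by (metis cbox_interval integral_refl)
    then have \<phi>0: "\<phi> (e', 0) = 0" for e' by (cases "e' = e") (simp_all add: \<phi>_def F_def)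
    have "\<phi> (e, 1) = 0" using c(2)[of "Suc n"] by (simp add: \<phi>_def F_def eqs_def mult.commute)
    then have \<phi>1: "\<phi> (e', 1) = 0" for e' using \<phi>_other by (cases "e' = e") auto
    have "\<phi> \<in> eigenspace_inf G 0"
    proof (rule eigenspace_inf_intro)
      show "\<phi> (e', x) = 0" if "\<not> (e' \<in> edges G \<and> x \<in> {0..1})" for e' x
      proof -
        have "F j (e', x) = 0" for j using that e by (auto simp: F_def)
        then show ?thesis by (simp add: \<phi>_def)
      qed
      show "vertex_continuous \<phi>" by (auto simp: vertex_continuous_def \<phi>0 \<phi>1)
      show "(\<Sum>e'\<in>incident_edges G v. normal_deriv G \<phi> e' v) = 0" for v
      proof (rule sum.neutral, rule ballI)
        fix e' show "normal_deriv G \<phi> e' v = 0"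
          using ed ed_other g0 g1 by (cases "e' = e") (auto simp: normal_deriv_def)
      qed
      fix e' assume "e' \<in> edges G"
      show "\<exists>h. absolutely_continuous_on_interval h 0 1 \<and>
        (\<forall>x\<in>{0..1}. ((\<lambda>y. \<phi> (e', y)) has_vector_derivative h x) (at x within {0..1})) \<and>
        (AE x in lebesgue_on {0..1}. vector_derivative h (at x within {0..1}) = - of_real 0 * \<phi> (e', x))"
      proof (cases "e' = e")
        case False
        have "vector_derivative (\<lambda>_. 0 :: complex) (at x within {0..1}) = 0" if "x \<in> {0..1}" for x :: real
          using that by (intro vector_derivative_within_closed_interval) auto
        then have "AE x in lebesgue_on {0..1}. vector_derivative (\<lambda>_. 0 :: complex) (at x within {0..1}) = 0"
          by (intro AE_I2) simp
        moreover have "absolutely_continuous_on_interval (\<lambda>_. 0) 0 1"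
          by (rule absolutely_continuous_lipschitz[of _ _ _ 0]) auto
        ultimately show ?thesis using False by (intro exI[of _ "\<lambda>_. 0"]) (auto simp: \<phi>_other)
      next
        case True
        \<comment> \<open>Away from the finitely many cut points the combination is locally affine
          in \<open>h\<close>, whose \<open>vector_derivative\<close> is 0 almost
          everywhere.\<close>
        have "AE x in lebesgue_on {0..1}. x \<notin> s ` {..M}"
          by (rule AE_lebesgue_on_finite[of "s ` {..M}"]) auto
        moreover have "AE x in lebesgue_on {0..1}. x \<in> {0..1::real}"
          by (intro AE_I2) simp
        ultimately have "AE x in lebesgue_on {0..1}. vector_derivative g (at x within {0..1}) = 0"
          using ae
        proof eventually_elim
          case (elim x)
          have "locally_affine_in h (k i) x" if "i < M" for i
          proof -
            have "s i \<in> s ` {..M}" "s (Suc i) \<in> s ` {..M}" using that by auto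
            then have "x \<noteq> s i" "x \<noteq> s (Suc i)" using elim(1) by metis+
            then show ?thesis unfolding k_def using s(3)[OF that] by (intro locally_affine_in_clamp_diff) auto
          qed
          then have "locally_affine_in h g x"
            unfolding g_def[abs_def] by (intro locally_affine_in_sum) auto
          from vector_derivative_locally_affine[OF elim(2) this elim(3)] show ?case .
        qed
        moreover have "absolutely_continuous_on_interval g 0 1"
          unfolding g_def by (intro absolutely_continuous_sum k_ac) auto
        ultimately show ?thesis using \<phi>_deriv True by (intro exI[of _ g]) auto
      qed
    qed
    moreover have "inner_inf G \<phi> (\<psi> i) = 0" if i: "i \<in> {1..n}" for i
    proof -
      have "\<psi> i \<in> eigenspace_inf G 0" using onb i unfolding is_onb_def by blast
      then have "inner_inf G \<phi> (\<psi> i) = (\<Sum>j<M. c j * inner_inf G (F j) (\<psi> i))"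
        unfolding \<phi>_def
        by (intro inner_inf_sum_left F_cont dom_Delta_inf_continuous[of _ G] eigenspace_inf_dom) auto
      also have "\<dots> = 0" using c(2)[of i] i by (simp add: eqs_def mult.commute)
      finally show ?thesis .
    qed
    ultimately have "\<phi> = (\<lambda>_. 0)" by (rule onb_orthogonal_zero[OF onb])
    then have "g x = 0" if "x \<in> {0..1}" for x
      using ed[OF that] edge_deriv_eq[OF that, of \<phi> e "\<lambda>_. 0" 0] by auto
    then have g_s: "g (s m) = 0" if "m \<le> M" for m using s01[OF that] by auto
    have "c j = 0" if j: "j < M" for j
    proof -
      \<comment> \<open>Between \<open>s j\<close> and \<open>s (Suc j)\<close> only the piece
        \<open>k j\<close> changes, so the increment of \<open>g\<close> isolates
        \<open>c j\<close>.\<close>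
      have "0 = g (s (Suc j)) - g (s j)" using g_s j by simp
      also have "\<dots> = (\<Sum>i<M. c i * (k i (s (Suc j)) - k i (s j)))"
        by (simp add: g_def sum_subtractf right_diff_distrib)
      also have "\<dots> = (\<Sum>i<M. if i = j then c i * (h (s (Suc j)) - h (s j)) else 0)"
        using j by (intro sum.cong) (auto simp: k_s)
      also have "\<dots> = c j * (h (s (Suc j)) - h (s j))" using j by simp
      finally have "c j * (h (s (Suc j)) - h (s j)) = 0" by simp
      moreover have "h (s (Suc j)) - h (s j) \<noteq> 0" using s(3)[OF j] by (metis right_minus_eq)
      ultimately show ?thesis by simp
    qed
    with c(1) show False by auto
  qed
next
  case (sym a b)
  then show ?case by metis
qed

text \<open>On each edge \<open>f\<close> is affine with some slope \<open>b e\<close>. Pairing the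
  flux condition at every vertex with the value of \<open>f\<close> there and summing over the
  vertices is a Green formula: it gives minus the sum of all |b e|^2, which therefore is 0.\<close>

lemma kernel_edgewise_constant:
  assumes onb: "is_onb (inner_inf G) (eigenspace_inf G 0) n \<psi>"
    and f: "f \<in> eigenspace_inf G 0" and e: "e \<in> edges G" and x: "x \<in> {0..1}"
  shows "f (e, x) = f (e, 0)"
proof -
  note dom = eigenspace_inf_dom[OF f]
  define b where "b e = edge_deriv f (e, 0)" for e
  have b: "edge_deriv f (e, x) = b e" if "e \<in> edges G" "x \<in> {0..1}" for e x
    unfolding b_def using kernel_edge_deriv_constant[OF onb f that(1) that(2)] by simp
  have lin: "f (e, x) = f (e, 0) + of_real x * b e" if e: "e \<in> edges G" and x: "x \<in> {0..1}" for e x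
  proof -
    have "((\<lambda>y. f (e, y) - of_real y * b e) has_vector_derivative 0) (at y within {0..1})"
      if y: "y \<in> {0..1}" for y
      using edge_deriv_has_vector_derivative[OF dom e y] unfolding b[OF e y]
      by (auto intro!: derivative_eq_intros)
    then obtain c where "\<And>y. y \<in> {0..1} \<Longrightarrow> f (e, y) - of_real y * b e = c"
      using has_vector_derivative_zero_constant[of "{0..1}" "\<lambda>y. f (e, y) - of_real y * b e"] by auto
    from this[of 0] this[of x] x show ?thesis by (simp add: algebra_simps)
  qed
  \<comment> \<open>The value at \<open>v\<close> read off along \<open>e\<close>; by continuity it
    does not depend on the edge, so it can be pulled out of the flux sum.\<close>
  define val where "val e v = (if v = end0 G e then f (e, 0) else f (e, 1))" for e v
  have val_eq: "val e v = val e' v" if "e \<in> incident_edges G v" "e' \<in> incident_edges G v" for e e' v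
  proof -
    have "val e v = f (e, if v = end0 G e then 0 else 1)" for e by (simp add: val_def)
    moreover have "f (e, if v = end0 G e then 0 else 1) = f (e', if v = end0 G e' then 0 else 1)"
      using that by (intro dom_vertex_continuous[OF dom, unfolded vertex_continuous_def, rule_format])
        (auto simp: endpoint_def incident_iff)
    ultimately show ?thesis by metis
  qed
  have "(\<Sum>e\<in>incident_edges G v. normal_deriv G f e v * cnj (val e v)) = 0" if v: "v \<in> verts G" for v
  proof -
    obtain e0 where e0: "e0 \<in> incident_edges G v" using incident_nonempty[OF v] by blast
    have "(\<Sum>e\<in>incident_edges G v. normal_deriv G f e v * cnj (val e v))
        = (\<Sum>e\<in>incident_edges G v. normal_deriv G f e v * cnj (val e0 v))"
      using val_eq[OF _ e0] by (intro sum.cong) auto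
    also have "\<dots> = 0" by (simp add: sum_distrib_right[symmetric] dom_flux[OF dom v])
    finally show ?thesis .
  qed
  then have "0 = (\<Sum>v\<in>verts G. \<Sum>e\<in>incident_edges G v. normal_deriv G f e v * cnj (val e v))" by simp
  also have "\<dots> = (\<Sum>e\<in>edges G. normal_deriv G f e (end0 G e) * cnj (val e (end0 G e))
      + normal_deriv G f e (end1 G e) * cnj (val e (end1 G e)))"
    by (rule sum_incident)
  also have "\<dots> = (\<Sum>e\<in>edges G. - of_real ((cmod (b e))\<^sup>2))"
  proof (rule sum.cong[OF refl])
    fix e assume e: "e \<in> edges G"
    have "normal_deriv G f e (end0 G e) * cnj (val e (end0 G e))
      + normal_deriv G f e (end1 G e) * cnj (val e (end1 G e)) = b e * cnj (f (e, 0)) - b e * cnj (f (e, 1))"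
      using edge_ends(3)[OF e] b[OF e] by (simp add: normal_deriv_def val_def)
    also have "f (e, 1) = f (e, 0) + b e" using lin[OF e, of 1] by simp
    also have "b e * cnj (f (e, 0)) - b e * cnj (f (e, 0) + b e) = - (b e * cnj (b e))"
      by (simp add: algebra_simps)
    finally show "normal_deriv G f e (end0 G e) * cnj (val e (end0 G e))
      + normal_deriv G f e (end1 G e) * cnj (val e (end1 G e)) = - of_real ((cmod (b e))\<^sup>2)"
      by (simp add: complex_norm_square[symmetric])
  qed
  also have "\<dots> = of_real (- (\<Sum>e\<in>edges G. (cmod (b e))\<^sup>2))" by (simp add: sum_negf)
  finally have "- (\<Sum>e\<in>edges G. (cmod (b e))\<^sup>2) = 0" by (metis of_real_eq_0_iff)
  then have "(cmod (b e))\<^sup>2 = 0"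
    using sum_nonneg_eq_0_iff[OF finite_edges, of "\<lambda>e. (cmod (b e))\<^sup>2"] e by simp
  with lin[OF e x] show ?thesis by simp
qed

end

section \<open>Waves\<close>

definition wave :: "complex \<Rightarrow> complex \<Rightarrow> real \<Rightarrow> real \<Rightarrow> complex" where
  "wave a b \<omega> x = a * cis (\<omega> * x) + b * cis (- (\<omega> * x))"

lemma wave_deriv:
  "(wave a b \<omega> has_vector_derivative wave (\<i> * of_real \<omega> * a) (- \<i> * of_real \<omega> * b) \<omega> x) (at x within S)"
proof -
  have "((\<lambda>z. a * exp (\<i> * of_real \<omega> * z) + b * exp (- (\<i> * of_real \<omega> * z))) has_field_derivative
     a * (exp (\<i> * of_real \<omega> * of_real x) * (\<i> * of_real \<omega>))
     + b * (exp (- (\<i> * of_real \<omega> * of_real x)) * (- (\<i> * of_real \<omega>)))) (at (of_real x))"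
    by (auto intro!: derivative_eq_intros)
  from has_vector_derivative_real_field[OF this, of S]
  show ?thesis by (simp add: wave_def[abs_def] cis_conv_exp mult_ac)
qed

lemma wave_bound: "cmod (wave a b \<omega> x) \<le> cmod a + cmod b"
  unfolding wave_def by (rule order_trans[OF norm_triangle_ineq]) (simp add: norm_mult)

text \<open>The term with sin is what becomes the flux at a vertex; inside an edge the shifts by
  \<delta> and -\<delta> cancel it.\<close>

lemma wave_shift:
  "wave a b \<omega> (x + \<delta>) = of_real (cos (\<omega> * \<delta>)) * wave a b \<omega> x
    + \<i> * of_real (sin (\<omega> * \<delta>)) * (a * cis (\<omega> * x) - b * cis (- (\<omega> * x)))"
proof -
  have c: "cis (\<omega> * (x + \<delta>)) = cis (\<omega> * x) * (of_real (cos (\<omega> * \<delta>)) + \<i> * of_real (sin (\<omega> * \<delta>)))"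
    "cis (- (\<omega> * (x + \<delta>))) = cis (- (\<omega> * x)) * (of_real (cos (\<omega> * \<delta>)) - \<i> * of_real (sin (\<omega> * \<delta>)))"
    by (simp_all add: complex_eq_iff distrib_left cos_add sin_add
      cos_diff sin_diff)
  show ?thesis unfolding wave_def c by (simp add: algebra_simps)
qed

lemma wave_three_term:
  "wave a b \<omega> (x - \<delta>) + wave a b \<omega> (x + \<delta>) = 2 * of_real (cos (\<omega> * \<delta>)) * wave a b \<omega> x"
  using wave_shift[of a b \<omega> x \<delta>] wave_shift[of a b \<omega> x "- \<delta>"] by simp

lemma wave_sum: "wave (\<Sum>j\<in>J. c j * a j) (\<Sum>j\<in>J. c j * b j) \<omega> x = (\<Sum>j\<in>J. c j * wave (a j) (b j) \<omega> x)"
  by (simp add: wave_def sum_distrib_right sum.distrib distrib_left mult.assoc)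

lemma edge_wave_eq:
  "edge_wave G A B \<omega> (e, x) = (if e \<in> edges G \<and> x \<in> {0..1} then wave (A e) (B e) \<omega> x else 0)"
  by (simp add: edge_wave_def wave_def cis_conv_exp)

lemma edge_wave_sum:
  fixes G :: "'v mgraph"
  shows "edge_wave G (\<lambda>e. \<Sum>j\<in>J. c j * A' j e) (\<lambda>e. \<Sum>j\<in>J. c j * B' j e) \<omega>
    = (\<lambda>p. \<Sum>j\<in>J. c j * edge_wave G (A' j) (B' j) \<omega> p)"
proof
  fix p :: "'v set \<times> real"
  obtain e x where p: "p = (e, x)" by fastforce
  show "edge_wave G (\<lambda>e. \<Sum>j\<in>J. c j * A' j e) (\<lambda>e. \<Sum>j\<in>J. c j * B' j e) \<omega> p
    = (\<Sum>j\<in>J. c j * edge_wave G (A' j) (B' j) \<omega> p)"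
  proof (cases "e \<in> edges G \<and> x \<in> {0..1}")
    case True
    then show ?thesis unfolding p by (simp add: edge_wave_eq wave_sum)
  next
    case False
    then show ?thesis unfolding p by (simp only: edge_wave_eq if_not_P[OF False] if_False mult_zero_right sum.neutral_const)
  qed
qed

section \<open>Vertex conditions on the coefficients of a wave\<close>

context refined_graph
begin

lemma edge_deriv_edge_wave:
  assumes "e \<in> edges G" "x \<in> {0..1}"
  shows "edge_deriv (edge_wave G A B \<omega>) (e, x) = wave (\<i> * of_real \<omega> * A e) (- \<i> * of_real \<omega> * B e) \<omega> x"
  using assms by (intro edge_deriv_eq[OF _ _ wave_deriv]) (auto simp: edge_wave_eq)

text \<open>
  With \<open>z = cis \<omega>\<close>, the values at \<open>v\<close> of the waves with coefficients \<open>A\<close> and \<open>B\<close>, and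
  their normal derivatives divided by \<open>\<i> \<omega>\<close>.
\<close>

definition end_val :: "complex \<Rightarrow> ('v set \<Rightarrow> complex) \<Rightarrow> ('v set \<Rightarrow> complex) \<Rightarrow> 'v set \<Rightarrow> 'v \<Rightarrow> complex" where
  "end_val z A B e v = (if v = end0 G e then A e + B e else A e * z + B e * cnj z)"

definition end_flux :: "complex \<Rightarrow> ('v set \<Rightarrow> complex) \<Rightarrow> ('v set \<Rightarrow> complex) \<Rightarrow> 'v set \<Rightarrow> 'v \<Rightarrow> complex" where
  "end_flux z A B e v = (if v = end0 G e then A e - B e else B e * cnj z - A e * z)"

definition continuous_coeffs :: "complex \<Rightarrow> ('v set \<Rightarrow> complex) \<Rightarrow> ('v set \<Rightarrow> complex) \<Rightarrow> bool" where
  "continuous_coeffs z A B \<longleftrightarrow> (\<forall>v. \<forall>e\<in>incident_edges G v. \<forall>e'\<in>incident_edges G v.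
     end_val z A B e v = end_val z A B e' v)"

definition balanced_coeffs :: "complex \<Rightarrow> ('v set \<Rightarrow> complex) \<Rightarrow> ('v set \<Rightarrow> complex) \<Rightarrow> bool" where
  "balanced_coeffs z A B \<longleftrightarrow> (\<forall>v\<in>verts G. (\<Sum>e\<in>incident_edges G v. end_flux z A B e v) = 0)"

lemma vertex_continuous_wave_iff:
  "vertex_continuous (edge_wave G A B \<omega>) \<longleftrightarrow> continuous_coeffs (cis \<omega>) A B"
proof -
  have val: "edge_wave G A B \<omega> (e, t) = end_val (cis \<omega>) A B e (endpoint G e t)"
    if "e \<in> edges G" "t \<in> {0, 1}" for e t
    using that edge_ends(3)[OF that(1)] by (auto simp: edge_wave_eq wave_def end_val_def endpoint_def cis_cnj)
  show ?thesis
  proof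
    assume L: "vertex_continuous (edge_wave G A B \<omega>)"
    show "continuous_coeffs (cis \<omega>) A B"
      unfolding continuous_coeffs_def
    proof (intro allI ballI)
      fix v e e' assume e: "e \<in> incident_edges G v" "e' \<in> incident_edges G v"
      define t where "t e = (if v = end0 G e then 0 else 1 :: real)" for e
      have t: "t e \<in> {0, 1}" "e \<in> incident_edges G v \<Longrightarrow> endpoint G e (t e) = v" for e
        by (auto simp: t_def endpoint_def incident_iff)
      have E: "e \<in> edges G" "e' \<in> edges G" using e by (auto simp: incident_iff)
      have ep: "endpoint G e (t e) = v" "endpoint G e' (t e') = v" by (rule t(2), rule e)+
      have "edge_wave G A B \<omega> (e, t e) = edge_wave G A B \<omega> (e', t e')"
        by (rule L[unfolded vertex_continuous_def, THEN bspec, THEN bspec, THEN bspec, THEN bspec,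
            THEN mp, OF E t(1) t(1)]) (simp only: ep)
      then show "end_val (cis \<omega>) A B e v = end_val (cis \<omega>) A B e' v"
        unfolding val[OF E(1) t(1)] val[OF E(2) t(1)] ep .
    qed
  next
    assume R: "continuous_coeffs (cis \<omega>) A B"
    show "vertex_continuous (edge_wave G A B \<omega>)"
      unfolding vertex_continuous_def
    proof (intro ballI impI)
      fix e e' and t t' :: real
      assume e: "e \<in> edges G" "e' \<in> edges G" and t: "t \<in> {0, 1}" "t' \<in> {0, 1}"
        and eq: "endpoint G e t = endpoint G e' t'"
      have "e \<in> incident_edges G (endpoint G e t)" "e' \<in> incident_edges G (endpoint G e' t')"
        using e by (auto simp: incident_iff endpoint_def)
      then have "end_val (cis \<omega>) A B e (endpoint G e t) = end_val (cis \<omega>) A B e' (endpoint G e t)"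
        using R unfolding continuous_coeffs_def eq by blast
      then show "edge_wave G A B \<omega> (e, t) = edge_wave G A B \<omega> (e', t')"
        unfolding val[OF e(1) t(1)] val[OF e(2) t(2)] eq .
    qed
  qed
qed

lemma normal_deriv_edge_wave:
  assumes "e \<in> incident_edges G v"
  shows "normal_deriv G (edge_wave G A B \<omega>) e v = \<i> * of_real \<omega> * end_flux (cis \<omega>) A B e v"
  using assms by (auto simp: incident_iff normal_deriv_def edge_deriv_edge_wave end_flux_def
    wave_def cis_cnj algebra_simps)

text \<open>All normal derivatives carry the factor i \<omega>, so at \<omega> = 0 the flux
  condition is automatic; that case produces the kernel functions.\<close>

lemma edge_wave_eigenspace:
  assumes cont: "continuous_coeffs (cis \<omega>) A B" and bal: "\<omega> = 0 \<or> balanced_coeffs (cis \<omega>) A B"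
  shows "edge_wave G A B \<omega> \<in> eigenspace_inf G (\<omega>\<^sup>2)"
proof (rule eigenspace_inf_intro)
  show "vertex_continuous (edge_wave G A B \<omega>)" using cont by (simp add: vertex_continuous_wave_iff)
  show "(\<Sum>e\<in>incident_edges G v. normal_deriv G (edge_wave G A B \<omega>) e v) = 0" if "v \<in> verts G" for v
  proof -
    have "(\<Sum>e\<in>incident_edges G v. normal_deriv G (edge_wave G A B \<omega>) e v)
        = \<i> * of_real \<omega> * (\<Sum>e\<in>incident_edges G v. end_flux (cis \<omega>) A B e v)"
      by (simp add: normal_deriv_edge_wave sum_distrib_left)
    then show ?thesis using bal that by (auto simp: balanced_coeffs_def)
  qed
  fix e assume e: "e \<in> edges G"
  let ?a = "\<i> * of_real \<omega> * A e" and ?b = "- \<i> * of_real \<omega> * B e"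
  let ?a' = "\<i> * of_real \<omega> * ?a" and ?b' = "- \<i> * of_real \<omega> * ?b"
  have w: "wave ?a' ?b' \<omega> x = - of_real (\<omega>\<^sup>2) * wave (A e) (B e) \<omega> x" for x
    by (simp add: wave_def power2_eq_square algebra_simps)
  have "absolutely_continuous_on_interval (wave ?a ?b \<omega>) 0 1"
    by (rule absolutely_continuous_bounded_derivative[OF wave_deriv wave_bound]) simp
  moreover have "((\<lambda>y. edge_wave G A B \<omega> (e, y)) has_vector_derivative wave ?a ?b \<omega> x) (at x within {0..1})"
    if "x \<in> {0..1}" for x
    by (rule has_vector_derivative_transform[OF that _ wave_deriv]) (simp add: edge_wave_eq e)
  moreover have "AE x in lebesgue_on {0..1}. vector_derivative (wave ?a ?b \<omega>) (at x within {0..1})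
      = - of_real (\<omega>\<^sup>2) * edge_wave G A B \<omega> (e, x)"
  proof (rule AE_I2)
    fix x :: real assume "x \<in> space (lebesgue_on {0..1})"
    then have x: "x \<in> {0..1}" by simp
    show "vector_derivative (wave ?a ?b \<omega>) (at x within {0..1}) = - of_real (\<omega>\<^sup>2) * edge_wave G A B \<omega> (e, x)"
      using vector_derivative_within_closed_interval[OF zero_less_one x wave_deriv[of ?a ?b \<omega> x "{0..1}"]] e x
      unfolding w by (simp add: edge_wave_eq)
  qed
  ultimately show "\<exists>h. absolutely_continuous_on_interval h 0 1 \<and>
      (\<forall>x\<in>{0..1}. ((\<lambda>y. edge_wave G A B \<omega> (e, y)) has_vector_derivative h x) (at x within {0..1})) \<and>
      (AE x in lebesgue_on {0..1}. vector_derivative h (at x within {0..1})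
        = - of_real (\<omega>\<^sup>2) * edge_wave G A B \<omega> (e, x))"
    by blast
qed (auto simp: edge_wave_def)

lemma edge_wave_eigenspaceD:
  assumes "edge_wave G A B \<omega> \<in> eigenspace_inf G \<nu>" "\<omega> \<noteq> 0"
  shows "continuous_coeffs (cis \<omega>) A B" "balanced_coeffs (cis \<omega>) A B"
proof -
  note dom = eigenspace_inf_dom[OF assms(1)]
  show "continuous_coeffs (cis \<omega>) A B"
    using dom_vertex_continuous[OF dom] by (simp add: vertex_continuous_wave_iff)
  show "balanced_coeffs (cis \<omega>) A B"
    unfolding balanced_coeffs_def
  proof
    fix v assume v: "v \<in> verts G"
    have "\<i> * of_real \<omega> * (\<Sum>e\<in>incident_edges G v. end_flux (cis \<omega>) A B e v)
        = (\<Sum>e\<in>incident_edges G v. normal_deriv G (edge_wave G A B \<omega>) e v)"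
      by (simp add: normal_deriv_edge_wave sum_distrib_left)
    then show "(\<Sum>e\<in>incident_edges G v. end_flux (cis \<omega>) A B e v) = 0"
      using dom_flux[OF dom v] assms(2) by simp
  qed
qed

text \<open>Value and derivative at 0 give the sum and, as \<omega> is nonzero, the difference of
  the two coefficients.\<close>

lemma edge_wave_coeffs_unique:
  assumes eq: "edge_wave G A B \<omega> = edge_wave G A' B' \<omega>" and "\<omega> \<noteq> 0" and e: "e \<in> edges G"
  shows "A e = A' e" "B e = B' e"
proof -
  have "A e + B e = A' e + B' e"
    using fun_cong[OF eq, of "(e, 0)"] e by (simp add: edge_wave_eq wave_def)
  moreover have "\<i> * of_real \<omega> * (A e - B e) = \<i> * of_real \<omega> * (A' e - B' e)"
    using edge_deriv_edge_wave[OF e, of 0 A B \<omega>] edge_deriv_edge_wave[OF e, of 0 A' B' \<omega>]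
    unfolding eq by (simp add: wave_def algebra_simps)
  then have "A e - B e = A' e - B' e" using assms(2) by simp
  ultimately have "(A e + B e) + (A e - B e) = (A' e + B' e) + (A' e - B' e)"
    "(A e + B e) - (A e - B e) = (A' e + B' e) - (A' e - B' e)" by metis+
  then show "A e = A' e" "B e = B' e" by simp_all
qed

end

section \<open>Sampled waves and the eigenspaces of the refined graph\<close>

context refined_graph
begin

lemma restrict_edge_wave_sp:
  assumes "continuous_coeffs (cis \<omega>) A B" "e \<in> edges G" "n \<le> N"
  shows "restrict_N G N (edge_wave G A B \<omega>) (sp e n) = wave (A e) (B e) \<omega> (real n / real N)"
  using restrict_N_sp[of "edge_wave G A B \<omega>" e n] assms N_pos
  by (simp add: vertex_continuous_wave_iff edge_wave_eq)

lemma end_val_wave: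
  fixes f :: "'v rvertex \<Rightarrow> complex"
  assumes f: "\<And>e n. e \<in> edges G \<Longrightarrow> n \<le> N \<Longrightarrow> f (sp e n) = wave (A e) (B e) \<omega> (real n / real N)"
    and e: "e \<in> incident_edges G v"
  shows "end_val (cis \<omega>) A B e v = f (Old v)"
proof -
  have "e \<in> edges G" using e by (simp add: incident_iff)
  then show ?thesis
    using e f[of e 0] f[of e N] N_pos
    by (auto simp: incident_iff end_val_def sp_simps wave_def cis_cnj)
qed

text \<open>This is \<open>wave_shift\<close> by 1/N from the end 0 and by -1/N from the end 1; the
  sign of the shift accounts for the sign in \<open>end_flux\<close>.\<close>

lemma nbr_wave:
  fixes f :: "'v rvertex \<Rightarrow> complex"
  assumes f: "\<And>e n. e \<in> edges G \<Longrightarrow> n \<le> N \<Longrightarrow> f (sp e n) = wave (A e) (B e) \<omega> (real n / real N)"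
    and e: "e \<in> incident_edges G v"
  shows "f (nbr e v) = of_real (cos (\<omega> / N)) * f (Old v) + \<i> * of_real (sin (\<omega> / N)) * end_flux (cis \<omega>) A B e v"
proof -
  have E: "e \<in> edges G" using e by (simp add: incident_iff)
  show ?thesis
  proof (cases "v = end0 G e")
    case True
    then have "f (nbr e v) = wave (A e) (B e) \<omega> (0 + 1 / N)" "f (Old v) = wave (A e) (B e) \<omega> 0"
      using f[OF E, of 1] f[OF E, of 0] N_pos by (auto simp: nbr_def sp_simps)
    then show ?thesis using True unfolding wave_shift by (simp add: end_flux_def)
  next
    case False
    then have v: "v = end1 G e" using e by (simp add: incident_iff)
    have "real (N - 1) / real N = 1 + - 1 / real N" using N_pos by (simp add: of_nat_diff field_simps)
    then have "f (nbr e v) = wave (A e) (B e) \<omega> (1 + - 1 / real N)" "f (Old v) = wave (A e) (B e) \<omega> 1"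
      using f[OF E, of "N - 1"] f[OF E, of N] N_pos False v by (auto simp: nbr_def sp_simps)
    then show ?thesis using False unfolding wave_shift
      by (simp add: end_flux_def cis_cnj algebra_simps)
  qed
qed

lemma eigenspace_N_cos_iff:
  "f \<in> eigenspace_N G N ((real N)\<^sup>2 * (1 - cos \<theta>)) \<longleftrightarrow> f \<in> HN G N \<and>
    (\<forall>v\<in>verts G. (\<Sum>e\<in>incident_edges G v. f (nbr e v)) = of_nat (card (incident_edges G v)) * of_real (cos \<theta>) * f (Old v)) \<and>
    (\<forall>e\<in>edges G. \<forall>n. 0 < n \<and> n < N \<longrightarrow> f (sp e (n - 1)) + f (sp e (Suc n)) = 2 * of_real (cos \<theta>) * f (sp e n))"
proof -
  have c: "1 - (real N)\<^sup>2 * (1 - cos \<theta>) / (real N)\<^sup>2 = cos \<theta>" using N_pos by simp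
  have "(\<forall>v\<in>rverts G N. (\<Sum>u\<in>radj G N v. f u) = of_nat (rdeg G N v) * of_real (cos \<theta>) * f v) \<longleftrightarrow>
    (\<forall>v\<in>verts G. (\<Sum>e\<in>incident_edges G v. f (nbr e v)) = of_nat (card (incident_edges G v)) * of_real (cos \<theta>) * f (Old v)) \<and>
    (\<forall>e\<in>edges G. \<forall>n. 0 < n \<and> n < N \<longrightarrow> f (sp e (n - 1)) + f (sp e (Suc n)) = 2 * of_real (cos \<theta>) * f (sp e n))"
    (is "?L \<longleftrightarrow> ?R")
  proof
    assume L: ?L
    show ?R
    proof (intro conjI ballI allI impI)
      fix v assume "v \<in> verts G"
      then have "Old v \<in> rverts G N" by (simp add: rverts_def)
      from L[rule_format, OF this]
      show "(\<Sum>e\<in>incident_edges G v. f (nbr e v)) = of_nat (card (incident_edges G v)) * of_real (cos \<theta>) * f (Old v)"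
        by (simp add: sum_radj_Old rdeg_Old)
    next
      fix e n assume e: "e \<in> edges G" and n: "0 < n \<and> n < N"
      then have "New e n \<in> rverts G N" by (auto simp: rverts_def)
      from L[rule_format, OF this]
      show "f (sp e (n - 1)) + f (sp e (Suc n)) = 2 * of_real (cos \<theta>) * f (sp e n)"
        using e n by (simp add: sum_radj_New rdeg_New sp_simps)
    qed
  next
    assume R: ?R
    show ?L
    proof
      fix v assume "v \<in> rverts G N"
      then consider u where "u \<in> verts G" "v = Old u" | e n where "e \<in> edges G" "0 < n" "n < N" "v = New e n"
        by (auto simp: rverts_def)
      then show "(\<Sum>u\<in>radj G N v. f u) = of_nat (rdeg G N v) * of_real (cos \<theta>) * f v"
      proof cases
        case 1
        then show ?thesis using R by (simp add: sum_radj_Old rdeg_Old)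
      next
        case 2
        then have "f (sp e (n - 1)) + f (sp e (Suc n)) = 2 * of_real (cos \<theta>) * f (sp e n)" using R by blast
        then show ?thesis using 2 by (simp add: sum_radj_New rdeg_New sp_simps)
      qed
    qed
  qed
  then show ?thesis unfolding eigenspace_N_iff c by simp
qed

lemma restrict_edge_wave_eigenspace:
  assumes cont: "continuous_coeffs (cis \<omega>) A B"
    and bal: "sin (\<omega> / N) = 0 \<or> balanced_coeffs (cis \<omega>) A B"
  shows "restrict_N G N (edge_wave G A B \<omega>) \<in> eigenspace_N G N ((real N)\<^sup>2 * (1 - cos (\<omega> / N)))"
proof -
  let ?f = "restrict_N G N (edge_wave G A B \<omega>)"
  note f = restrict_edge_wave_sp[OF cont]
  show ?thesis unfolding eigenspace_N_cos_iff
  proof (intro conjI ballI allI impI)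
    show "?f \<in> HN G N" by (rule restrict_N_HN)
  next
    fix v assume v: "v \<in> verts G"
    have "(\<Sum>e\<in>incident_edges G v. ?f (nbr e v)) = of_nat (card (incident_edges G v)) * of_real (cos (\<omega> / N)) * ?f (Old v)
      + \<i> * of_real (sin (\<omega> / N)) * (\<Sum>e\<in>incident_edges G v. end_flux (cis \<omega>) A B e v)"
      by (simp add: nbr_wave[OF f] sum.distrib sum_distrib_left)
    then show "(\<Sum>e\<in>incident_edges G v. ?f (nbr e v)) = of_nat (card (incident_edges G v)) * of_real (cos (\<omega> / N)) * ?f (Old v)"
      using bal v by (auto simp: balanced_coeffs_def)
  next
    fix e n assume e: "e \<in> edges G" and n: "0 < n \<and> n < N"
    have x: "real (n - 1) / real N = real n / real N - 1 / real N" "real (Suc n) / real N = real n / real N + 1 / real N"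
      using n by (simp_all add: of_nat_diff diff_divide_distrib add_divide_distrib)
    have "?f (sp e (n - 1)) = wave (A e) (B e) \<omega> (real n / real N - 1 / real N)"
      "?f (sp e (Suc n)) = wave (A e) (B e) \<omega> (real n / real N + 1 / real N)"
      "?f (sp e n) = wave (A e) (B e) \<omega> (real n / real N)"
      using f[OF e, of "n - 1"] f[OF e, of "Suc n"] f[OF e, of n] n unfolding x by auto
    then show "?f (sp e (n - 1)) + ?f (sp e (Suc n)) = 2 * of_real (cos (\<omega> / N)) * ?f (sp e n)"
      using wave_three_term[of "A e" "B e" \<omega> "real n / real N" "1 / real N"] by simp
  qed
qed

lemma eigenspace_N_zero_wave:
  assumes f: "f \<in> eigenspace_N G N 0"
  obtains A where "continuous_coeffs (cis 0) A (\<lambda>_. 0)" "f = restrict_N G N (edge_wave G A (\<lambda>_. 0) 0)"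
proof -
  define A where "A e = f (sp e 0)" for e
  have "f (sp e n) = A e" if "e \<in> edges G" "n \<le> N" for e n
    using that(2) by (induction n) (use eigenspace_N_extreme[OF f, of 1 e] that(1) in \<open>auto simp: A_def\<close>)
  then have w: "f (sp e n) = wave (A e) 0 0 (real n / real N)" if "e \<in> edges G" "n \<le> N" for e n
    using that by (simp add: wave_def)
  have cont: "continuous_coeffs (cis 0) A (\<lambda>_. 0)"
    unfolding continuous_coeffs_def using end_val_wave[of f A "\<lambda>_. 0" 0, OF w] by auto
  have "f = restrict_N G N (edge_wave G A (\<lambda>_. 0) 0)"
    by (rule HN_eqI) (use f w restrict_edge_wave_sp[OF cont] restrict_N_HN in \<open>auto simp: eigenspace_N_def\<close>)
  with cont show ?thesis by (rule that)
qed

lemma eigenspace_N_wave: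
  assumes f: "f \<in> eigenspace_N G N ((real N)\<^sup>2 * (1 - cos (\<omega> / N)))" and \<omega>: "0 < \<omega>" "\<omega> \<le> N * pi"
  obtains A B where "continuous_coeffs (cis \<omega>) A B" "balanced_coeffs (cis \<omega>) A B"
    "f = restrict_N G N (edge_wave G A B \<omega>)"
proof -
  define \<theta> where "\<theta> = \<omega> / N"
  have \<theta>: "0 < \<theta>" "\<theta> \<le> pi" "\<omega> = N * \<theta>" using \<omega> N_pos by (auto simp: \<theta>_def field_simps)
  have f': "f \<in> HN G N"
    "\<And>v. v \<in> verts G \<Longrightarrow> (\<Sum>e\<in>incident_edges G v. f (nbr e v)) = of_nat (card (incident_edges G v)) * of_real (cos \<theta>) * f (Old v)"
    "\<And>e n. e \<in> edges G \<Longrightarrow> 0 < n \<Longrightarrow> n < N \<Longrightarrow> f (sp e (n - 1)) + f (sp e (Suc n)) = 2 * of_real (cos \<theta>) * f (sp e n)"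
    using f unfolding eigenspace_N_cos_iff \<theta>_def by blast+
  have "\<exists>A B. (\<forall>e\<in>edges G. \<forall>n\<le>N. f (sp e n) = wave (A e) (B e) \<omega> (real n / real N)) \<and>
     balanced_coeffs (cis \<omega>) A B"
  proof (cases "\<theta> = pi")
    case True
    \<comment> \<open>At \<theta> = pi the samples determine only the sum of the two coefficients.
      They are chosen equal, so that the flux vanishes edge by edge, cis \<omega> being
      real.\<close>
    define A where "A e = f (sp e 0) / 2" for e
    have \<omega>': "\<omega> = N * pi" using True \<theta> by simp
    have ext: "f (sp e (Suc n)) = - f (sp e n)" if "e \<in> edges G" "n < N" for e n
      using eigenspace_N_extreme[OF f, of "-1" e n] that N_pos True by (simp add: \<theta>_def)
    have "f (sp e n) = (-1) ^ n * (2 * A e)" if "e \<in> edges G" "n \<le> N" for e n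
      using that(2) by (induction n) (use ext that(1) in \<open>auto simp: A_def\<close>)
    moreover have "wave a a \<omega> (real n / real N) = (-1) ^ n * (2 * a)" for a n
    proof -
      have "\<omega> * (real n / real N) = real n * pi" using N_pos by (simp add: \<omega>')
      then have "wave a a \<omega> (real n / real N) = a * (cis (real n * pi) + cis (- (real n * pi)))"
        by (simp add: wave_def algebra_simps)
      also have "cis (real n * pi) + cis (- (real n * pi)) = 2 * (-1) ^ n"
        by (simp add: complex_eq_iff cos_npi)
      finally show ?thesis by simp
    qed
    moreover have "balanced_coeffs (cis \<omega>) A A"
    proof -
      have "cis \<omega> = cnj (cis \<omega>)" by (simp add: \<omega>' complex_eq_iff sin_npi)
      then have "end_flux (cis \<omega>) A A e v = 0" for e v unfolding end_flux_def by simp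
      then show ?thesis by (simp add: balanced_coeffs_def)
    qed
    ultimately show ?thesis by (intro exI[of _ A]) auto
  next
    case False
    then have sin: "sin \<theta> \<noteq> 0" using \<theta> sin_gt_zero[of \<theta>] by simp
    \<comment> \<open>Cramer's rule: A + B and A cis \<theta> + B cis (-\<theta>) must be the first
      two samples, and up to sign the determinant is 2 i sin \<theta>. The recurrence then
      determines all further samples.\<close>
    define A where "A e = (f (sp e 1) - f (sp e 0) * cis (- \<theta>)) / (2 * \<i> * of_real (sin \<theta>))" for e
    define B where "B e = (f (sp e 0) * cis \<theta> - f (sp e 1)) / (2 * \<i> * of_real (sin \<theta>))" for e
    have cis_diff: "cis \<theta> - cis (- \<theta>) = 2 * \<i> * of_real (sin \<theta>)" by (simp add: complex_eq_iff)
    have AB0: "A e + B e = f (sp e 0)" for e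
    proof -
      have "A e + B e = f (sp e 0) * (cis \<theta> - cis (- \<theta>)) / (2 * \<i> * of_real (sin \<theta>))"
        unfolding A_def B_def by (simp add: add_divide_distrib[symmetric] algebra_simps)
      then show ?thesis using sin unfolding cis_diff by simp
    qed
    have AB1: "A e * cis \<theta> + B e * cis (- \<theta>) = f (sp e 1)" for e
    proof -
      have "A e * cis \<theta> + B e * cis (- \<theta>) = f (sp e 1) * (cis \<theta> - cis (- \<theta>)) / (2 * \<i> * of_real (sin \<theta>))"
        unfolding A_def B_def
        by (simp add: add_divide_distrib[symmetric] algebra_simps)
      then show ?thesis using sin unfolding cis_diff by simp
    qed
    have w: "f (sp e n) = wave (A e) (B e) \<omega> (real n / real N)" if e: "e \<in> edges G" and n: "n \<le> N" for e n
      using n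
    proof (induction n rule: less_induct)
      case (less n)
      consider "n = 0" | "n = 1" | m where "n = Suc m" "0 < m" "m < N"
        using less.prems by (cases n) auto
      then show ?case
      proof cases
        case 1
        then show ?thesis by (simp add: wave_def AB0)
      next
        case 2
        then show ?thesis using N_pos by (simp add: wave_def \<theta>(3) AB1)
      next
        case 3
        have "f (sp e (m - 1)) = wave (A e) (B e) \<omega> (real (m - 1) / real N)"
          "f (sp e m) = wave (A e) (B e) \<omega> (real m / real N)" using 3 less.IH by auto
        moreover have "real (m - 1) / real N = real m / real N - 1 / real N"
          "real n / real N = real m / real N + 1 / real N"
          using 3 by (simp_all add: of_nat_diff diff_divide_distrib add_divide_distrib)
        ultimately show ?thesis
          using f'(3)[OF e 3(2,3)] wave_three_term[of "A e" "B e" \<omega> "real m / real N" "1 / real N"] 3(1)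
          by (simp add: \<theta>_def) (metis add_left_cancel)
      qed
    qed
    have "balanced_coeffs (cis \<omega>) A B"
      unfolding balanced_coeffs_def
    proof
      fix v assume v: "v \<in> verts G"
      have "(\<Sum>e\<in>incident_edges G v. f (nbr e v)) = of_nat (card (incident_edges G v)) * of_real (cos \<theta>) * f (Old v)
        + \<i> * of_real (sin \<theta>) * (\<Sum>e\<in>incident_edges G v. end_flux (cis \<omega>) A B e v)"
        unfolding \<theta>_def by (simp add: nbr_wave[of f A B, OF w] sum.distrib sum_distrib_left)
      \<comment> \<open>Comparison with the eigenvalue equation at the vertex leaves sin \<theta>
        times the flux.\<close>
      then show "(\<Sum>e\<in>incident_edges G v. end_flux (cis \<omega>) A B e v) = 0"
        using f'(2)[OF v] sin by simp
    qed
    with w show ?thesis by blast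
  qed
  then obtain A B where w: "\<And>e n. e \<in> edges G \<Longrightarrow> n \<le> N \<Longrightarrow> f (sp e n) = wave (A e) (B e) \<omega> (real n / real N)"
    and bal: "balanced_coeffs (cis \<omega>) A B" by blast
  have cont: "continuous_coeffs (cis \<omega>) A B"
    unfolding continuous_coeffs_def using end_val_wave[of f A B, OF w] by auto
  have "f = restrict_N G N (edge_wave G A B \<omega>)"
    by (rule HN_eqI) (use f' w restrict_edge_wave_sp[OF cont] restrict_N_HN in auto)
  with cont bal show ?thesis by (rule that)
qed

end

section \<open>The discrete Fourier transform\<close>

locale graph_dft = refined_graph G N for G :: "'v mgraph" and N +
  fixes K I0 :: nat and I :: "nat \<Rightarrow> nat"
    and \<omega>0 :: "nat \<Rightarrow> real"
    and \<psi>0 :: "nat \<Rightarrow> 'v gfun"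
    and \<Psi> :: "nat \<Rightarrow> nat \<Rightarrow> 'v gfun"
    and A B :: "nat \<Rightarrow> nat \<Rightarrow> 'v set \<Rightarrow> complex"
  assumes freq_mono: "strict_mono_on {1..K} \<omega>0"
    and freq_all: "\<omega>0 ` {1..K} = {\<omega>. 0 < \<omega> \<and> \<omega> \<le> 2 * pi \<and> eigenvalue_inf G (\<omega>\<^sup>2)}"
    and basis_zero: "is_onb (inner_inf G) (eigenspace_inf G 0) I0 \<psi>0"
    and basis: "\<And>k. k \<in> {1..K} \<Longrightarrow>
      is_onb (inner_inf G) (eigenspace_inf G ((\<omega>0 k)\<^sup>2)) (I k) (\<Psi> k)"
    and coeffs: "\<And>k j e x. k \<in> {1..K} \<Longrightarrow> j \<in> {1..I k} \<Longrightarrow> e \<in> edges G \<Longrightarrow> x \<in> {0..1} \<Longrightarrow>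
      \<Psi> k j (e, x) = A k j e * exp (\<i> * of_real (\<omega>0 k * x))
                   + B k j e * exp (- \<i> * of_real (\<omega>0 k * x))"
begin

abbreviation "\<mu> \<equiv> mu N \<omega>0"
abbreviation "\<Phi> \<equiv> Phi G N \<omega>0 A B"
abbreviation "\<Phi>0 j \<equiv> restrict_N G N (\<psi>0 j)"

lemma freq0:
  assumes "k \<in> {1..K}" shows "0 < \<omega>0 k" "\<omega>0 k \<le> 2 * pi"
  using freq_all assms by blast+

lemma cis_freq: "cis (freq \<omega>0 m k) = cis (\<omega>0 k)"
proof -
  have "freq \<omega>0 m k = \<omega>0 k + 2 * pi * real m" by (simp add: freq_def)
  then show ?thesis by (simp only: cis_mult[symmetric]) simp
qed

lemma freq_pos: "k \<in> {1..K} \<Longrightarrow> 0 < freq \<omega>0 m k"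
  using freq0[of k] by (simp add: freq_def add_pos_nonneg)

lemma Psi_eq:
  assumes "k \<in> {1..K}" "j \<in> {1..I k}"
  shows "\<Psi> k j = edge_wave G (A k j) (B k j) (\<omega>0 k)"
proof
  fix p :: "'v set \<times> real"
  obtain e x where p: "p = (e, x)" by fastforce
  have "\<Psi> k j \<in> dom_Delta_inf G"
    using basis[OF assms(1)] assms(2) unfolding is_onb_def by (blast intro: eigenspace_inf_dom)
  then show "\<Psi> k j p = edge_wave G (A k j) (B k j) (\<omega>0 k) p"
    using coeffs[OF assms] dom_outside by (auto simp: p edge_wave_def)
qed

lemma Psi_coeffs:
  assumes "k \<in> {1..K}" "j \<in> {1..I k}"
  shows "continuous_coeffs (cis (\<omega>0 k)) (A k j) (B k j)" "balanced_coeffs (cis (\<omega>0 k)) (A k j) (B k j)"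
proof -
  have "edge_wave G (A k j) (B k j) (\<omega>0 k) \<in> eigenspace_inf G ((\<omega>0 k)\<^sup>2)"
    using basis[OF assms(1)] assms unfolding is_onb_def Psi_eq[OF assms, symmetric] by blast
  moreover have "\<omega>0 k \<noteq> 0" using freq0[OF assms(1)] by simp
  ultimately show "continuous_coeffs (cis (\<omega>0 k)) (A k j) (B k j)" "balanced_coeffs (cis (\<omega>0 k)) (A k j) (B k j)"
    by (rule edge_wave_eigenspaceD)+
qed

lemma mu_eq: "\<mu> m k = (real N)\<^sup>2 * (1 - cos (freq \<omega>0 m k / N))"
  by (simp add: mu_def)

lemma Phi_eigenspace:
  assumes "k \<in> {1..K}" "j \<in> {1..I k}"
  shows "\<Phi> m k j \<in> eigenspace_N G N (\<mu> m k)"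
  unfolding Phi_def mu_eq
  by (rule restrict_edge_wave_eigenspace) (simp_all add: cis_freq Psi_coeffs[OF assms])

lemma Phi_sp:
  assumes "k \<in> {1..K}" "j \<in> {1..I k}" "e \<in> edges G" "n \<le> N"
  shows "\<Phi> m k j (sp e n) = wave (A k j e) (B k j e) (freq \<omega>0 m k) (real n / real N)"
  unfolding Phi_def
  by (rule restrict_edge_wave_sp) (simp_all add: cis_freq Psi_coeffs[OF assms(1,2)] assms(3,4))

lemma eigenspace_span:
  assumes k: "k \<in> {1..K}" and cb: "continuous_coeffs (cis (\<omega>0 k)) A' B'" "balanced_coeffs (cis (\<omega>0 k)) A' B'"
  shows "\<exists>c. \<forall>e\<in>edges G. A' e = (\<Sum>j=1..I k. c j * A k j e) \<and> B' e = (\<Sum>j=1..I k. c j * B k j e)"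
proof -
  have "edge_wave G A' B' (\<omega>0 k) \<in> eigenspace_inf G ((\<omega>0 k)\<^sup>2)"
    by (rule edge_wave_eigenspace) (simp_all add: cb)
  then obtain c where c: "edge_wave G A' B' (\<omega>0 k) = (\<lambda>p. \<Sum>j=1..I k. c j * \<Psi> k j p)"
    using basis[OF k] unfolding is_onb_def by blast
  also have "\<dots> = (\<lambda>p. \<Sum>j=1..I k. c j * edge_wave G (A k j) (B k j) (\<omega>0 k) p)"
    by (intro ext sum.cong) (simp_all add: Psi_eq[OF k])
  also have "\<dots> = edge_wave G (\<lambda>e. \<Sum>j=1..I k. c j * A k j e) (\<lambda>e. \<Sum>j=1..I k. c j * B k j e) (\<omega>0 k)"
    by (rule edge_wave_sum[symmetric])
  finally have eq: "edge_wave G A' B' (\<omega>0 k)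
    = edge_wave G (\<lambda>e. \<Sum>j=1..I k. c j * A k j e) (\<lambda>e. \<Sum>j=1..I k. c j * B k j e) (\<omega>0 k)" .
  have "\<omega>0 k \<noteq> 0" using freq0[OF k] by simp
  from edge_wave_coeffs_unique[OF eq this] show ?thesis by (intro exI[of _ c]) blast
qed

text \<open>The coefficients of the extended wave obey vertex conditions that see only cis \<omega>,
  so they also define an eigenfunction at the base frequency; its expansion in \<Psi> carries over
  to the shifted family with the same constants.\<close>

lemma eigenspace_N_span:
  assumes mk: "(m, k) \<in> dft_index N K \<omega>0" and f: "f \<in> eigenspace_N G N (\<mu> m k)"
  shows "\<exists>c. f = (\<lambda>v. \<Sum>j=1..I k. c j * \<Phi> m k j v)"
proof -
  let ?\<omega> = "freq \<omega>0 m k"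
  have k: "k \<in> {1..K}" and \<omega>: "0 < ?\<omega>" "?\<omega> \<le> N * pi" using mk freq_pos by (auto simp: dft_index_def)
  obtain A' B' where ab: "continuous_coeffs (cis ?\<omega>) A' B'" "balanced_coeffs (cis ?\<omega>) A' B'"
    and f': "f = restrict_N G N (edge_wave G A' B' ?\<omega>)"
    by (rule eigenspace_N_wave[OF f[unfolded mu_eq] \<omega>])
  obtain c where c: "\<And>e. e \<in> edges G \<Longrightarrow> A' e = (\<Sum>j=1..I k. c j * A k j e)"
    "\<And>e. e \<in> edges G \<Longrightarrow> B' e = (\<Sum>j=1..I k. c j * B k j e)"
    using eigenspace_span[OF k ab[unfolded cis_freq]] by blast
  have "f = (\<lambda>v. \<Sum>j=1..I k. c j * \<Phi> m k j v)"
  proof (rule HN_eqI)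
    show "f \<in> HN G N" unfolding f' by (rule restrict_N_HN)
    show "(\<lambda>v. \<Sum>j=1..I k. c j * \<Phi> m k j v) \<in> HN G N"
      unfolding HN_space by (rule W.space_sum) (simp add: Phi_def restrict_N_HN HN_space[symmetric])
    fix e n assume e: "e \<in> edges G" "n \<le> N"
    show "f (sp e n) = (\<Sum>j=1..I k. c j * \<Phi> m k j (sp e n))"
      unfolding f' restrict_edge_wave_sp[OF ab(1) e] c[OF e(1)] wave_sum
      by (intro sum.cong) (simp_all add: Phi_sp[OF k _ e])
  qed
  then show ?thesis by (rule exI[of _ c])
qed

text \<open>Two consecutive zero samples force both coefficients to vanish, since sin (\<omega>/N)
  is nonzero below N pi. The relation then holds at the base frequency, where \<Psi> is
  orthonormal.\<close>

lemma Phi_independent: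
  assumes k: "k \<in> {1..K}" and \<omega>: "freq \<omega>0 m k < N * pi"
    and c: "(\<lambda>v. \<Sum>j=1..I k. c j * \<Phi> m k j v) = (\<lambda>_. 0)" and j: "j \<in> {1..I k}"
  shows "c j = 0"
proof -
  let ?\<omega> = "freq \<omega>0 m k"
  define A' where "A' e = (\<Sum>j=1..I k. c j * A k j e)" for e
  define B' where "B' e = (\<Sum>j=1..I k. c j * B k j e)" for e
  have \<theta>: "0 < ?\<omega> / N" "?\<omega> / N < pi" using freq_pos[OF k] \<omega> N_pos by (auto simp: field_simps)
  have sin: "sin (?\<omega> / N) \<noteq> 0" using sin_gt_zero[OF \<theta>] by simp
  have w0: "wave (A' e) (B' e) ?\<omega> (real n / real N) = 0" if e: "e \<in> edges G" "n \<le> N" for e n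
  proof -
    have "wave (A' e) (B' e) ?\<omega> (real n / real N) = (\<Sum>j=1..I k. c j * \<Phi> m k j (sp e n))"
      unfolding A'_def B'_def wave_sum by (intro sum.cong) (simp_all add: Phi_sp[OF k _ e])
    also have "\<dots> = 0" using fun_cong[OF c, of "sp e n"] by simp
    finally show ?thesis .
  qed
  have AB: "A' e = 0 \<and> B' e = 0" if e: "e \<in> edges G" for e
  proof -
    have "A' e + B' e = 0" using w0[OF e, of 0] by (simp add: wave_def)
    then have B': "B' e = - A' e" by (simp add: add_eq_0_iff)
    have "wave (A' e) (B' e) ?\<omega> (0 + 1 / N) = 0" using w0[OF e, of 1] N_pos by simp
    then have "sin (?\<omega> / N) = 0 \<or> A' e = 0"
      unfolding wave_shift B' by (auto simp: wave_def)
    with sin B' show ?thesis by auto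
  qed
  have "(\<lambda>p. \<Sum>j=1..I k. c j * \<Psi> k j p) = edge_wave G A' B' (\<omega>0 k)"
    unfolding A'_def[abs_def] B'_def[abs_def] edge_wave_sum by (intro ext sum.cong) (simp_all add: Psi_eq[OF k])
  also have "\<dots> = (\<lambda>_. 0)" using AB by (auto simp: edge_wave_def)
  finally have 0: "(\<lambda>p. \<Sum>j=1..I k. c j * \<Psi> k j p) = (\<lambda>_. 0)" .
  have \<Psi>: "\<Psi> k j \<in> eigenspace_inf G ((\<omega>0 k)\<^sup>2)" if "j \<in> {1..I k}" for j
    using basis[OF k] that unfolding is_onb_def by blast
  have "0 = inner_inf G (\<lambda>p. \<Sum>i=1..I k. c i * \<Psi> k i p) (\<Psi> k j)" unfolding 0 by (simp add: inner_inf_def)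
  also have "\<dots> = (\<Sum>i=1..I k. c i * inner_inf G (\<Psi> k i) (\<Psi> k j))"
    using \<Psi> j by (intro inner_inf_sum_left) (auto intro!: dom_Delta_inf_continuous[of _ G] eigenspace_inf_dom)
  also have "\<dots> = (\<Sum>i=1..I k. if i = j then c i else 0)"
    using basis[OF k] j unfolding is_onb_def by (intro sum.cong) auto
  also have "\<dots> = c j" using j by simp
  finally show ?thesis by simp
qed

lemma is_B_matrix_exists:
  assumes mk: "(m, k) \<in> dft_index N K \<omega>0"
  shows "\<exists>d b. is_B_matrix G N \<omega>0 A B I m k d b"
proof -
  have k: "k \<in> {1..K}" using mk by (auto simp: dft_index_def)
  have "\<forall>j\<in>{1..I k}. \<Phi> m k j \<in> W.space"
    using Phi_eigenspace[OF k] by (auto simp: HN_space[symmetric] eigenspace_N_def)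
  from W.gram_schmidt[OF this, folded inner_N_ip] obtain d b where
      ons: "\<forall>i\<in>{1..d}. \<forall>i'\<in>{1..d}. inner_N G N (\<lambda>v. \<Sum>j=1..I k. b i j * \<Phi> m k j v)
         (\<lambda>v. \<Sum>j=1..I k. b i' j * \<Phi> m k j v) = (if i = i' then 1 else 0)"
    and span: "\<forall>j\<in>{1..I k}. \<exists>a. \<Phi> m k j = (\<lambda>v. \<Sum>i=1..d. a i * (\<Sum>j=1..I k. b i j * \<Phi> m k j v))"
    and indep: "(\<forall>c. (\<lambda>v. \<Sum>j=1..I k. c j * \<Phi> m k j v) = (\<lambda>_. 0) \<longrightarrow> (\<forall>j\<in>{1..I k}. c j = 0)) \<longrightarrow> d = I k"
    by (elim exE conjE) (rule that)
  obtain a where a: "\<And>j. j \<in> {1..I k} \<Longrightarrow>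
      \<Phi> m k j = (\<lambda>v. \<Sum>i=1..d. a j i * (\<Sum>j=1..I k. b i j * \<Phi> m k j v))"
    using bchoice[OF span] by blast
  have "is_onb (inner_N G N) (eigenspace_N G N (\<mu> m k)) d (\<lambda>i v. \<Sum>j=1..I k. b i j * \<Phi> m k j v)"
    unfolding is_onb_def
  proof (intro conjI ons ballI)
    fix i
    show "(\<lambda>v. \<Sum>j=1..I k. b i j * \<Phi> m k j v) \<in> eigenspace_N G N (\<mu> m k)"
      using Phi_eigenspace[OF k, of _ m] unfolding eigenspace_N_def
      by (auto simp: Delta_N_sum HN_space sum_distrib_left mult_ac intro!: W.space_sum sum.cong)
  next
    fix f assume "f \<in> eigenspace_N G N (\<mu> m k)"
    then obtain c where c: "f = (\<lambda>v. \<Sum>j=1..I k. c j * \<Phi> m k j v)"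
      using eigenspace_N_span[OF mk] by blast
    have "f v = (\<Sum>i=1..d. (\<Sum>j=1..I k. c j * a j i) * (\<Sum>j=1..I k. b i j * \<Phi> m k j v))" for v
    proof -
      have "f v = (\<Sum>j=1..I k. c j * (\<Sum>i=1..d. a j i * (\<Sum>j=1..I k. b i j * \<Phi> m k j v)))"
        unfolding c using a by (intro sum.cong refl) (metis (no_types, lifting))
      also have "\<dots> = (\<Sum>i=1..d. (\<Sum>j=1..I k. c j * a j i) * (\<Sum>j=1..I k. b i j * \<Phi> m k j v))"
        unfolding sum_distrib_left[where A = "{1..d}"]
        by (subst sum.swap) (simp only: sum_distrib_right mult.assoc)
      finally show ?thesis .
    qed
    then show "\<exists>c. f = (\<lambda>v. \<Sum>i=1..d. c i * (\<Sum>j=1..I k. b i j * \<Phi> m k j v))"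
      by (intro exI[of _ "\<lambda>i. \<Sum>j=1..I k. c j * a j i"] ext)
  qed
  moreover have "freq \<omega>0 m k < real N * pi \<longrightarrow> d = I k"
    using indep Phi_independent[OF k] by blast
  ultimately show ?thesis unfolding is_B_matrix_def by blast
qed

section \<open>The eigenvalue 0\<close>

lemma kernel_edge_wave:
  assumes "f \<in> eigenspace_inf G 0"
  shows "f = edge_wave G (\<lambda>e. f (e, 0)) (\<lambda>_. 0) 0"
proof
  fix p :: "'v set \<times> real"
  obtain e x where p: "p = (e, x)" by fastforce
  show "f p = edge_wave G (\<lambda>e. f (e, 0)) (\<lambda>_. 0) 0 p"
    using kernel_edgewise_constant[OF basis_zero assms, of e x] dom_outside[OF eigenspace_inf_dom[OF assms], of e x]
    by (auto simp: p edge_wave_eq wave_def)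
qed

lemma psi0_eigenspace: "j \<in> {1..I0} \<Longrightarrow> \<psi>0 j \<in> eigenspace_inf G 0"
  using basis_zero unfolding is_onb_def by blast

lemma psi0_coeffs:
  assumes "j \<in> {1..I0}"
  shows "continuous_coeffs (cis 0) (\<lambda>e. \<psi>0 j (e, 0)) (\<lambda>_. 0)"
  using dom_vertex_continuous[OF eigenspace_inf_dom[OF psi0_eigenspace[OF assms]]]
  by (subst (asm) kernel_edge_wave[OF psi0_eigenspace[OF assms]]) (simp only: vertex_continuous_wave_iff)

lemma Phi0_eq: "j \<in> {1..I0} \<Longrightarrow> \<Phi>0 j = restrict_N G N (edge_wave G (\<lambda>e. \<psi>0 j (e, 0)) (\<lambda>_. 0) 0)"
  using kernel_edge_wave[OF psi0_eigenspace] by metis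

lemma Phi0_sp: "j \<in> {1..I0} \<Longrightarrow> e \<in> edges G \<Longrightarrow> n \<le> N \<Longrightarrow> \<Phi>0 j (sp e n) = \<psi>0 j (e, 0)"
  using restrict_edge_wave_sp[OF psi0_coeffs] Phi0_eq by (simp add: wave_def)

lemma Phi0_eigenspace: "j \<in> {1..I0} \<Longrightarrow> \<Phi>0 j \<in> eigenspace_N G N 0"
  using restrict_edge_wave_eigenspace[OF psi0_coeffs] Phi0_eq by simp

text \<open>Both inner products are computed from the constant values on the edges: the trapezoidal
  sum over N segments and the integral over [0, 1] agree.\<close>

lemma Phi0_inner:
  assumes i: "i \<in> {1..I0}" and j: "j \<in> {1..I0}"
  shows "inner_N G N (\<Phi>0 i) (\<Phi>0 j) = (if i = j then 1 else 0)"
proof -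
  have "(\<Sum>v\<in>rverts G N. of_nat (rdeg G N v) * \<Phi>0 i v * cnj (\<Phi>0 j v))
      = (\<Sum>e\<in>edges G. \<Sum>n<N. \<Phi>0 i (sp e n) * cnj (\<Phi>0 j (sp e n)) + \<Phi>0 i (sp e (Suc n)) * cnj (\<Phi>0 j (sp e (Suc n))))"
    unfolding mult.assoc by (rule sum_rdeg)
  also have "\<dots> = (\<Sum>e\<in>edges G. of_nat (2 * N) * (\<psi>0 i (e, 0) * cnj (\<psi>0 j (e, 0))))"
    by (intro sum.cong refl) (simp add: Phi0_sp[OF i] Phi0_sp[OF j])
  also have "\<dots> = of_nat (2 * N) * (\<Sum>e\<in>edges G. \<psi>0 i (e, 0) * cnj (\<psi>0 j (e, 0)))"
    by (rule sum_distrib_left[symmetric])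
  finally have 1: "inner_N G N (\<Phi>0 i) (\<Phi>0 j)
      = (\<Sum>e\<in>edges G. \<psi>0 i (e, 0) * cnj (\<psi>0 j (e, 0))) / of_nat (card (edges G))"
    using N_pos by (simp add: inner_N_def)
  have "(LINT x|lebesgue_on {0..1}. \<psi>0 i (e, x) * cnj (\<psi>0 j (e, x))) = \<psi>0 i (e, 0) * cnj (\<psi>0 j (e, 0))"
    if e: "e \<in> edges G" for e
  proof -
    have "(LINT x|lebesgue_on {0..1}. \<psi>0 i (e, x) * cnj (\<psi>0 j (e, x)))
        = (LINT x|lebesgue_on {0..1::real}. \<psi>0 i (e, 0) * cnj (\<psi>0 j (e, 0)))"
      using kernel_edgewise_constant[OF basis_zero psi0_eigenspace[OF i] e]
        kernel_edgewise_constant[OF basis_zero psi0_eigenspace[OF j] e]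
      by (intro Bochner_Integration.integral_cong refl) (metis space_lebesgue_on)
    also have "\<dots> = measure (lebesgue_on {0..1::real}) {0..1} *\<^sub>R (\<psi>0 i (e, 0) * cnj (\<psi>0 j (e, 0)))"
      by simp
    also have "measure (lebesgue_on {0..1::real}) {0..1} = 1"
      by (subst measure_restrict_space) auto
    finally show ?thesis by simp
  qed
  then have "inner_inf G (\<psi>0 i) (\<psi>0 j) = (\<Sum>e\<in>edges G. \<psi>0 i (e, 0) * cnj (\<psi>0 j (e, 0))) / of_nat (card (edges G))"
    by (simp add: inner_inf_def)
  then show ?thesis using 1 basis_zero i j unfolding is_onb_def by simp
qed

lemma kernel_N_span:
  assumes f: "f \<in> eigenspace_N G N 0"
  shows "\<exists>c. f = (\<lambda>v. \<Sum>j=1..I0. c j * \<Phi>0 j v)"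
proof -
  obtain A' where A': "continuous_coeffs (cis 0) A' (\<lambda>_. 0)" and f': "f = restrict_N G N (edge_wave G A' (\<lambda>_. 0) 0)"
    by (rule eigenspace_N_zero_wave[OF f])
  have "edge_wave G A' (\<lambda>_. 0) 0 \<in> eigenspace_inf G (0\<^sup>2)"
    by (rule edge_wave_eigenspace[OF A']) simp
  then obtain c where c: "edge_wave G A' (\<lambda>_. 0) 0 = (\<lambda>p. \<Sum>j=1..I0. c j * \<psi>0 j p)"
    using basis_zero unfolding is_onb_def by auto
  have "f = (\<lambda>v. \<Sum>j=1..I0. c j * \<Phi>0 j v)"
  proof (rule HN_eqI)
    show "f \<in> HN G N" unfolding f' by (rule restrict_N_HN)
    show "(\<lambda>v. \<Sum>j=1..I0. c j * \<Phi>0 j v) \<in> HN G N"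
      unfolding HN_space by (rule W.space_sum) (simp add: restrict_N_HN HN_space[symmetric])
    fix e n assume e: "e \<in> edges G" "n \<le> N"
    have "f (sp e n) = edge_wave G A' (\<lambda>_. 0) 0 (e, 0)"
      unfolding f' restrict_edge_wave_sp[OF A' e] using e by (simp add: edge_wave_eq wave_def)
    also have "\<dots> = (\<Sum>j=1..I0. c j * \<Phi>0 j (sp e n))"
      unfolding c using e by (intro sum.cong) (simp_all add: Phi0_sp)
    finally show "f (sp e n) = (\<Sum>j=1..I0. c j * \<Phi>0 j (sp e n))" .
  qed
  then show ?thesis by (rule exI[of _ c])
qed

section \<open>The listed eigenvalues are distinct and exhaust the spectrum\<close>

lemma finite_dft_index: "finite (dft_index N K \<omega>0)"
proof (rule finite_subset)
  show "dft_index N K \<omega>0 \<subseteq> {..N} \<times> {1..K}"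
  proof (clarsimp simp: dft_index_def)
    fix m k assume k: "Suc 0 \<le> k" "k \<le> K" and le: "freq \<omega>0 m k \<le> real N * pi"
    have "0 < \<omega>0 k" using freq0[of k] k by simp
    with le have "real m * pi + real m * pi \<le> real N * pi" unfolding freq_def by linarith
    moreover have "0 \<le> real m * pi" by simp
    ultimately have "real m * pi \<le> real N * pi" by linarith
    then show "m \<le> N" by simp
  qed
qed simp

text \<open>Base frequencies lie in the half-open interval (0, 2 pi], so two of them differ by less
  than 2 pi and their shifts cannot collide.\<close>

lemma freq_inj:
  assumes "k \<in> {1..K}" "k' \<in> {1..K}" "freq \<omega>0 m k = freq \<omega>0 m' k'"
  shows "m = m' \<and> k = k'"
proof -
  have d: "\<bar>\<omega>0 k - \<omega>0 k'\<bar> < 2 * pi" using freq0[OF assms(1)] freq0[OF assms(2)] by linarith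
  have "\<omega>0 k - \<omega>0 k' = 2 * pi * (real m' - real m)" using assms(3) by (simp add: freq_def algebra_simps)
  with d have "2 * pi * \<bar>real m' - real m\<bar> < 2 * pi * 1" by (simp add: abs_mult)
  then have "\<bar>real m' - real m\<bar> < 1" by (subst (asm) mult_less_cancel_left_pos) auto
  then have m: "m = m'" by linarith
  then have "\<omega>0 k = \<omega>0 k'" using assms(3) by (simp add: freq_def)
  moreover have "inj_on \<omega>0 {1..K}" using freq_mono by (rule strict_mono_on_imp_inj_on)
  ultimately have "k = k'" using assms(1,2) by (metis inj_onD)
  with m show ?thesis by simp
qed

text \<open>The cutoff \<omega> \<le> N pi puts \<omega>/N into [0, pi], where cos is
  injective.\<close>

lemma mu_inj:
  assumes "(m, k) \<in> dft_index N K \<omega>0" "(m', k') \<in> dft_index N K \<omega>0" "\<mu> m k = \<mu> m' k'"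
  shows "m = m' \<and> k = k'"
proof -
  have \<theta>: "0 \<le> freq \<omega>0 m k / N \<and> freq \<omega>0 m k / N \<le> pi" if "(m, k) \<in> dft_index N K \<omega>0" for m k
    using that freq_pos[of k m] N_pos by (auto simp: dft_index_def field_simps)
  have "cos (freq \<omega>0 m k / N) = cos (freq \<omega>0 m' k' / N)"
    using assms(3) N_pos by (simp add: mu_eq)
  then have "freq \<omega>0 m k / N = freq \<omega>0 m' k' / N"
    by (rule cos_inj_pi[OF conjunct1[OF \<theta>[OF assms(1)]] conjunct2[OF \<theta>[OF assms(1)]]
          conjunct1[OF \<theta>[OF assms(2)]] conjunct2[OF \<theta>[OF assms(2)]]])
  then have "freq \<omega>0 m k = freq \<omega>0 m' k'" using N_pos by simp
  then show ?thesis using freq_inj assms(1,2) by (auto simp: dft_index_def)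
qed

lemma mu_nonzero:
  assumes "(m, k) \<in> dft_index N K \<omega>0"
  shows "\<mu> m k \<noteq> 0"
proof
  have k: "k \<in> {1..K}" "freq \<omega>0 m k \<le> N * pi" using assms by (auto simp: dft_index_def)
  assume "\<mu> m k = 0"
  then have eq: "cos (freq \<omega>0 m k / N) = cos 0" using N_pos by (simp add: mu_eq)
  have \<theta>: "0 \<le> freq \<omega>0 m k / N" "freq \<omega>0 m k / N \<le> pi"
    using freq_pos[OF k(1), of m] k(2) N_pos by (auto simp: field_simps)
  have "freq \<omega>0 m k / N = 0" by (rule cos_inj_pi[OF \<theta> order_refl pi_ge_zero eq])
  then show False using freq_pos[OF k(1), of m] N_pos by simp
qed

lemma eigenvectors_orthogonal:
  assumes "f \<in> eigenspace_N G N a" "g \<in> eigenspace_N G N b" "a \<noteq> b"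
  shows "inner_N G N f g = 0"
proof -
  have "inner_N G N (Delta_N G N f) g = inner_N G N f (Delta_N G N g)" by (rule Delta_N_adj)
  then have "of_real a * inner_N G N f g = of_real b * inner_N G N f g"
    using assms(1,2) by (simp add: eigenspace_N_def inner_N_ip W.ip_scale_left W.ip_scale_right)
  then show ?thesis using assms(3) by simp
qed

text \<open>The bound on the eigenvalue makes arccos available. The eigenfunction extends to a wave
  of frequency N \<theta>; with this frequency reduced modulo 2 pi, the same coefficients give an
  eigenfunction of the continuous graph, so the reduced frequency is in the list.\<close>

lemma eigenvalue_N_cases:
  assumes g: "g \<in> eigenspace_N G N \<nu>" and nz: "g \<noteq> (\<lambda>_. 0)"
  shows "\<nu> = 0 \<or> (\<exists>(m, k)\<in>dft_index N K \<omega>0. \<nu> = \<mu> m k)"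
proof (rule disjCI)
  assume no: "\<not> (\<exists>(m, k)\<in>dft_index N K \<omega>0. \<nu> = \<mu> m k)"
  have "\<bar>1 - \<nu> / (real N)\<^sup>2\<bar> \<le> 1" by (rule eigenvalue_N_bounds[OF g nz])
  then have bnd: "-1 \<le> 1 - \<nu> / (real N)\<^sup>2" "1 - \<nu> / (real N)\<^sup>2 \<le> 1" by auto
  define \<theta> where "\<theta> = arccos (1 - \<nu> / (real N)\<^sup>2)"
  have \<theta>: "0 \<le> \<theta>" "\<theta> \<le> pi" "cos \<theta> = 1 - \<nu> / (real N)\<^sup>2"
    using bnd by (auto simp: \<theta>_def arccos_lbound arccos_ubound)
  have \<nu>: "\<nu> = (real N)\<^sup>2 * (1 - cos \<theta>)" using N_pos by (simp add: \<theta>(3))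
  show "\<nu> = 0"
  proof (rule ccontr)
    assume "\<nu> \<noteq> 0"
    then have "\<theta> \<noteq> 0" using \<nu> by auto
    define \<omega> where "\<omega> = N * \<theta>"
    have \<omega>: "0 < \<omega>" "\<omega> \<le> N * pi" "\<omega> / N = \<theta>" using \<theta> \<open>\<theta> \<noteq> 0\<close> N_pos by (auto simp: \<omega>_def)
    have "g \<in> eigenspace_N G N ((real N)\<^sup>2 * (1 - cos (\<omega> / N)))" using g unfolding \<omega>(3) \<nu>[symmetric] .
    from eigenspace_N_wave[OF this \<omega>(1,2)] obtain A' B' where
      ab: "continuous_coeffs (cis \<omega>) A' B'" "balanced_coeffs (cis \<omega>) A' B'"
      and g': "g = restrict_N G N (edge_wave G A' B' \<omega>)" by blast
    \<comment> \<open>Ceiling minus one instead of the floor: a multiple of 2 pi must leave the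
      remainder 2 pi, as base frequencies lie in (0, 2 pi].\<close>
    define m where "m = nat (\<lceil>\<omega> / (2 * pi)\<rceil> - 1)"
    define \<omega>' where "\<omega>' = \<omega> - 2 * real m * pi"
    have "0 < \<omega> / (2 * pi)" using \<omega> by simp
    then have "0 < \<lceil>\<omega> / (2 * pi)\<rceil>" by simp
    then have "real m = of_int \<lceil>\<omega> / (2 * pi)\<rceil> - 1" by (simp add: m_def)
    then have "real m < \<omega> / (2 * pi)" "\<omega> / (2 * pi) \<le> real m + 1" by linarith+
    then have \<omega>': "0 < \<omega>'" "\<omega>' \<le> 2 * pi" by (auto simp: \<omega>'_def field_simps)
    have "\<omega> = \<omega>' + 2 * pi * real m" by (simp add: \<omega>'_def)
    then have cis: "cis \<omega> = cis \<omega>'" by (simp only: cis_mult[symmetric]) simp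
    have "edge_wave G A' B' \<omega>' \<in> eigenspace_inf G (\<omega>'\<^sup>2)"
      by (rule edge_wave_eigenspace) (use ab cis in auto)
    moreover have "edge_wave G A' B' \<omega>' \<noteq> (\<lambda>_. 0)"
    proof
      assume "edge_wave G A' B' \<omega>' = (\<lambda>_. 0)"
      then have eq: "edge_wave G A' B' \<omega>' = edge_wave G (\<lambda>_. 0) (\<lambda>_. 0) \<omega>'" by (auto simp: edge_wave_def)
      have "A' e = 0 \<and> B' e = 0" if "e \<in> edges G" for e
        using edge_wave_coeffs_unique[OF eq _ that] \<omega>'(1) by simp
      then have "g = (\<lambda>_. 0)"
        by (intro HN_eqI) (auto simp: g' restrict_N_HN restrict_edge_wave_sp[OF ab(1)] wave_def, simp add: HN_def)
      with nz show False ..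
    qed
    ultimately have "eigenvalue_inf G (\<omega>'\<^sup>2)" unfolding eigenvalue_inf_def by blast
    then have "\<omega>' \<in> \<omega>0 ` {1..K}" unfolding freq_all using \<omega>' by simp
    then obtain k where k: "k \<in> {1..K}" "\<omega>' = \<omega>0 k" by auto
    then have "freq \<omega>0 m k = \<omega>" by (simp add: freq_def \<omega>'_def)
    then have "(m, k) \<in> dft_index N K \<omega>0" "\<nu> = \<mu> m k"
      using k \<omega> \<nu> by (auto simp: dft_index_def mu_eq)
    with no show False by blast
  qed
qed

section \<open>Action of the Laplacian and the isometry\<close>

lemma dft_Delta:
  assumes "(m, k) \<in> dft_index N K \<omega>0" "j \<in> {1..I k}"
  shows "dft G N \<omega>0 A B (Delta_N G N f) m k j = of_real (\<mu> m k) * dft G N \<omega>0 A B f m k j"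
proof -
  have "k \<in> {1..K}" using assms by (auto simp: dft_index_def)
  then have "Delta_N G N (\<Phi> m k j) = (\<lambda>v. of_real (\<mu> m k) * \<Phi> m k j v)"
    using Phi_eigenspace[OF _ assms(2)] by (simp add: eigenspace_N_def)
  then show ?thesis unfolding dft_def Delta_N_adj by (simp add: inner_N_ip W.ip_scale_right)
qed

lemma dft_zero_Delta:
  assumes "j \<in> {1..I0}"
  shows "dft_zero G N \<psi>0 (Delta_N G N f) j = 0"
proof -
  have "Delta_N G N (\<Phi>0 j) = (\<lambda>v. 0)"
    using Phi0_eigenspace[OF assms] by (simp add: eigenspace_N_def)
  then show ?thesis unfolding dft_zero_def Delta_N_adj by (simp add: inner_N_def)
qed

lemma dft_isometry:
  assumes b: "\<forall>(m, k)\<in>dft_index N K \<omega>0. is_B_matrix G N \<omega>0 A B I m k (d m k) (b m k)"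
    and f: "f \<in> HN G N"
  shows "inner_N G N f g =
     (\<Sum>j=1..I0. dft_zero G N \<psi>0 f j * cnj (dft_zero G N \<psi>0 g j)) +
     (\<Sum>(m, k)\<in>dft_index N K \<omega>0. B_inner (d m k) (I k) (b m k)
        (dft G N \<omega>0 A B f m k) (dft G N \<omega>0 A B g m k))"
proof -
  let ?D = "dft_index N K \<omega>0"
  define \<eta> where "\<eta> = (\<lambda>(m, k) i v. \<Sum>j=1..I k. b m k i j * \<Phi> m k j v)"
  define dd where "dd = (\<lambda>(m, k). d m k)"
  define mm where "mm = (\<lambda>(m, k). \<mu> m k)"
  have onb: "is_onb (inner_N G N) (eigenspace_N G N (mm p)) (dd p) (\<eta> p)" if "p \<in> ?D" for p
    using b that by (auto simp: is_B_matrix_def \<eta>_def dd_def mm_def)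
  have mm_inj: "p = q" if "p \<in> ?D" "q \<in> ?D" "mm p = mm q" for p q
    using mu_inj that by (auto simp: mm_def split: prod.splits)
  have mm_nz: "mm p \<noteq> 0" if "p \<in> ?D" for p using mu_nonzero that by (cases p) (auto simp: mm_def)
  define S where "S = (SIGMA p:?D. {1..dd p})"
  define L where "L = {1..I0} <+> S"
  \<comment> \<open>\<open>h\<close> and \<open>ev\<close> list an orthonormal eigenbasis with its
    eigenvalues: the sampled kernel basis and the vectors \<eta> of every block.\<close>
  define h where "h = case_sum \<Phi>0 (\<lambda>(p, i). \<eta> p i)"
  define ev where "ev = case_sum (\<lambda>_::nat. 0) (\<lambda>(p, i::nat). mm p)"
  have fin: "finite S" "finite L" using finite_dft_index by (auto simp: S_def L_def)
  have L_cases: "(\<exists>j\<in>{1..I0}. l = Inl j) \<or> (\<exists>p\<in>?D. \<exists>i\<in>{1..dd p}. l = Inr (p, i))" if "l \<in> L" for l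
    using that by (auto simp: L_def S_def)
  have h_eig: "h l \<in> eigenspace_N G N (ev l)" if "l \<in> L" for l
    using L_cases[OF that] Phi0_eigenspace onb by (auto simp: h_def ev_def is_onb_def)
  have ons: "W.ip (h l) (h l') = (if l = l' then 1 else 0)" if l: "l \<in> L" "l' \<in> L" for l l'
  proof (cases "ev l = ev l'")
    case False
    then have "l \<noteq> l'" by auto
    then show ?thesis
      using eigenvectors_orthogonal[OF h_eig[OF l(1)] h_eig[OF l(2)] False] by (simp add: inner_N_ip)
  next
    \<comment> \<open>Equal eigenvalues mean the same block, by \<open>mu_inj\<close> and
      \<open>mu_nonzero\<close>, and within a block orthonormality is known.\<close>
    case True
    from L_cases[OF l(1)] L_cases[OF l(2)] show ?thesis
    proof (elim disjE bexE)
      fix i j assume "i \<in> {1..I0}" "j \<in> {1..I0}" "l = Inl i" "l' = Inl j"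
      then show ?thesis using Phi0_inner by (simp add: h_def inner_N_ip)
    next
      fix p q i j assume p: "p \<in> ?D" "q \<in> ?D" "i \<in> {1..dd p}" "j \<in> {1..dd q}" "l = Inr (p, i)" "l' = Inr (q, j)"
      with True have "p = q" by (intro mm_inj) (auto simp: ev_def)
      then show ?thesis using onb[OF p(1)] p unfolding is_onb_def inner_N_ip by (simp add: h_def)
    qed (use True mm_nz mm_nz[symmetric] in \<open>auto simp: ev_def\<close>)
  qed
  have complete: "x = (\<lambda>_. 0)" if x: "x \<in> W.space" and orth: "\<And>l. l \<in> L \<Longrightarrow> W.ip x (h l) = 0" for x
  proof (rule W.selfadjoint_complete)
    show "Delta_N G N y \<in> W.space" for y using Delta_N_HN by (simp add: HN_space)
    show "Delta_N G N (\<lambda>v. \<Sum>j\<le>n. c j * \<phi> j v) = (\<lambda>v. \<Sum>j\<le>n. c j * Delta_N G N (\<phi> j) v)" for n :: nat and c \<phi>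
      by (rule Delta_N_sum)
    show "W.ip (Delta_N G N y) z = W.ip y (Delta_N G N z)" for y z
      using Delta_N_adj[of y z] by (simp add: inner_N_ip)
    fix \<nu> z assume z: "z \<in> W.space" "Delta_N G N z = (\<lambda>v. of_real \<nu> * z v)"
    then have z': "z \<in> eigenspace_N G N \<nu>" by (simp add: eigenspace_N_def HN_space)
    show "W.ip x z = 0"
    proof (cases "z = (\<lambda>_. 0)")
      case True
      then show ?thesis by (simp add: W.ip_def)
    next
      case False
      from eigenvalue_N_cases[OF z' False] show ?thesis
      proof
        assume "\<nu> = 0"
        then obtain c where c: "z = (\<lambda>v. \<Sum>j=1..I0. c j * \<Phi>0 j v)" using kernel_N_span z' by blast
        have "W.ip x (\<Phi>0 j) = 0" if "j \<in> {1..I0}" for j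
        proof -
          have "Inl j \<in> L" using that by (auto simp: L_def)
          from orth[OF this] show ?thesis by (simp add: h_def)
        qed
        then show ?thesis unfolding c by (simp add: W.ip_sum_right)
      next
        assume "\<exists>(m, k)\<in>?D. \<nu> = \<mu> m k"
        then obtain p where p: "p \<in> ?D" "\<nu> = mm p" by (auto simp: mm_def)
        obtain c where c: "z = (\<lambda>v. \<Sum>j=1..dd p. c j * \<eta> p j v)"
          using onb[OF p(1)] z' unfolding is_onb_def p(2) by blast
        have "W.ip x (\<eta> p j) = 0" if "j \<in> {1..dd p}" for j
        proof -
          have "Inr (p, j) \<in> L" using that p by (auto simp: L_def S_def)
          from orth[OF this] show ?thesis by (simp add: h_def)
        qed
        then show ?thesis unfolding c by (simp add: W.ip_sum_right)
      qed
    qed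
  qed (rule x)
  \<comment> \<open>\<eta> stands in the conjugate-linear slot; this is the origin of the conjugate
    of B in \<open>B_inner\<close>.\<close>
  have ip_\<eta>: "W.ip x (\<eta> (m, k) i) = (\<Sum>j=1..I k. cnj (b m k i j) * dft G N \<omega>0 A B x m k j)" for x m k i
    by (simp add: \<eta>_def W.ip_sum_right dft_def inner_N_ip)
  have "W.ip f g = (\<Sum>l\<in>L. W.ip f (h l) * cnj (W.ip g (h l)))"
    using h_eig f by (intro W.parseval fin ons complete) (auto simp: eigenspace_N_def HN_space)
  also have "\<dots> = (\<Sum>j=1..I0. W.ip f (\<Phi>0 j) * cnj (W.ip g (\<Phi>0 j)))
      + (\<Sum>(p, i)\<in>S. W.ip f (\<eta> p i) * cnj (W.ip g (\<eta> p i)))"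
    unfolding L_def by (subst sum.Plus) (use fin in \<open>auto simp: h_def case_prod_beta\<close>)
  also have "(\<Sum>(p, i)\<in>S. W.ip f (\<eta> p i) * cnj (W.ip g (\<eta> p i)))
      = (\<Sum>p\<in>?D. \<Sum>i=1..dd p. W.ip f (\<eta> p i) * cnj (W.ip g (\<eta> p i)))"
    unfolding S_def by (rule sum.Sigma[symmetric]) (use finite_dft_index in auto)
  also have "\<dots> = (\<Sum>(m, k)\<in>?D. B_inner (d m k) (I k) (b m k) (dft G N \<omega>0 A B f m k) (dft G N \<omega>0 A B g m k))"
    by (intro sum.cong refl) (auto simp: B_inner_def dd_def ip_\<eta>)
  finally show ?thesis by (simp add: dft_zero_def inner_N_ip)
qed

end

section \<open>Running programs\<close>

definition halts :: "'a prog \<Rightarrow> 'a state \<Rightarrow> nat \<Rightarrow> ('a state \<Rightarrow> bool) \<Rightarrow> bool" where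
  "halts P s T Q \<longleftrightarrow> (\<exists>t s'. runs P s t s' \<and> t \<le> T \<and> Q s')"

lemma halts_mono: "halts P s T Q \<Longrightarrow> T \<le> T' \<Longrightarrow> (\<And>s'. Q s' \<Longrightarrow> Q' s') \<Longrightarrow> halts P s T' Q'"
  unfolding halts_def by (meson order_trans)

lemma halts_Instr: "Q (run_instr i s) \<Longrightarrow> halts (Instr i) s 1 Q"
  unfolding halts_def using runs.instr by blast

lemma halts_Seq:
  assumes "halts P s T R" "\<And>s'. R s' \<Longrightarrow> halts P' s' T' Q"
  shows "halts (Seq P P') s (T + T') Q"
proof -
  obtain t s' where 1: "runs P s t s'" "t \<le> T" "R s'" using assms(1) by (auto simp: halts_def)
  obtain t' s'' where 2: "runs P' s' t' s''" "t' \<le> T'" "Q s''" using assms(2)[OF 1(3)] by (auto simp: halts_def)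
  from runs.seq[OF 1(1) 2(1)] 1 2 show ?thesis unfolding halts_def by (meson add_mono)
qed

text \<open>\<open>n\<close> rounds of one test and at most \<open>T\<close> steps each, and the
  final failing test.\<close>

lemma halts_While:
  assumes step: "\<And>i s. i < n \<Longrightarrow> Inv i s \<Longrightarrow> fst s p < fst s q \<and> halts P s T (Inv (Suc i))"
    and stop: "\<And>s. Inv n s \<Longrightarrow> \<not> fst s p < fst s q"
    and init: "Inv 0 s"
  shows "halts (While_Less p q P) s (n * (T + 1) + 1) (Inv n)"
proof -
  have "halts (While_Less p q P) s ((n - i) * (T + 1) + 1) (Inv n)" if "i \<le> n" "Inv i s" for i s
    using that
  proof (induction i arbitrary: s rule: inc_induct)
    case base
    then show ?case using runs.while_done[OF stop] unfolding halts_def by fastforce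
  next
    case (step i)
    then have *: "fst s p < fst s q" "halts P s T (Inv (Suc i))" using assms(1) by auto
    then obtain t s' where 1: "runs P s t s'" "t \<le> T" "Inv (Suc i) s'" by (auto simp: halts_def)
    obtain t' s'' where 2: "runs (While_Less p q P) s' t' s''" "t' \<le> (n - Suc i) * (T + 1) + 1" "Inv n s''"
      using step.IH[OF 1(3)] by (auto simp: halts_def)
    have "n - i = Suc (n - Suc i)" using step.hyps by simp
    then have "1 + t + t' \<le> (n - i) * (T + 1) + 1" using 1(2) 2(2) by simp
    then show ?case using runs.while_step[OF *(1) 1(1) 2(1)] 2(3) unfolding halts_def by blast
  qed
  from this[of 0] init show ?thesis by simp
qed

text \<open>The language has no empty program; a loop whose condition is false takes its place.\<close>

fun seqs :: "'a prog list \<Rightarrow> 'a prog" where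
  "seqs [] = While_Less 0 0 (Instr (Nat_Const 0 0))"
| "seqs (P # Ps) = Seq P (seqs Ps)"

abbreviation block :: "'a instr list \<Rightarrow> 'a prog" where
  "block is \<equiv> seqs (map Instr is)"

lemma halts_Nil: "Q s \<Longrightarrow> halts (seqs []) s 1 Q"
  unfolding halts_def seqs.simps by (intro exI conjI, rule runs.while_done) auto

text \<open>The summand 1 pays for the loop that stands for the empty program.\<close>

lemma halts_seqs:
  assumes "\<And>i s. i < length Ps \<Longrightarrow> J i s \<Longrightarrow> halts (Ps ! i) s T (J (Suc i))" "J 0 s"
  shows "halts (seqs Ps) s (length Ps * T + 1) (J (length Ps))"
  using assms
proof (induction Ps arbitrary: J s)
  case Nil
  then show ?case using halts_Nil[of _ s] by simp
next
  case (Cons P Ps)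
  have "halts P s T (J (Suc 0))" using Cons.prems(1)[of 0] Cons.prems(2) by simp
  moreover have "halts (seqs Ps) s' (length Ps * T + 1) (J (Suc (length Ps)))" if "J (Suc 0) s'" for s'
    using Cons.IH[of "\<lambda>i. J (Suc i)" s'] Cons.prems(1)[of "Suc _"] that by auto
  ultimately have "halts (Seq P (seqs Ps)) s (T + (length Ps * T + 1)) (J (Suc (length Ps)))"
    by (rule halts_Seq)
  then show ?case by (simp add: add.assoc)
qed

lemma halts_block:
  assumes "Q (fold run_instr is s)"
  shows "halts (block is) s (length is + 1) Q"
  using assms
proof (induction "is" arbitrary: s)
  case Nil
  then show ?case using halts_Nil[of _ s] by simp
next
  case (Cons i "is")
  have "halts (Instr i) s 1 (\<lambda>s'. s' = run_instr i s)" by (rule halts_Instr) simp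
  moreover have "halts (block is) s' (length is + 1) Q" if "s' = run_instr i s" for s'
    using Cons that by simp
  ultimately have "halts (Seq (Instr i) (block is)) s (1 + (length is + 1)) Q" by (rule halts_Seq)
  then show ?case by simp
qed

lemma halts_block_length:
  assumes "length is + 1 = T" "Q (fold run_instr is s)"
  shows "halts (block is) s T Q"
  using halts_block[of Q "is" s] assms by simp

text \<open>
  Throughout, register 0 holds \<open>N\<close>, register 1 holds 0 and register 2 holds 1. An operand
  \<open>(Work i, 1)\<close> serves as a scalar variable.
\<close>

definition frame :: "'v array state \<Rightarrow> 'v array state \<Rightarrow> bool" where
  "frame s s' \<longleftrightarrow> (\<forall>x. (\<forall>i. x \<noteq> Work i) \<longrightarrow> snd s' x = snd s x) \<and> (\<forall>r<3. fst s' r = fst s r)"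

lemma frame_trans: "frame s s' \<Longrightarrow> frame s' s'' \<Longrightarrow> frame s s''"
  by (simp add: frame_def)

definition ready :: "nat \<Rightarrow> 'v array state \<Rightarrow> bool" where
  "ready N s \<longleftrightarrow> fst s 0 = N \<and> fst s 1 = 0 \<and> fst s 2 = 1"

lemma frame_ready: "frame s s' \<Longrightarrow> ready N s \<Longrightarrow> ready N s'"
  by (simp add: frame_def ready_def)

section \<open>Assembling the input of the Fourier transform\<close>

definition add_term :: "complex \<times> nat \<times> 'v array \<times> nat \<Rightarrow> 'v array instr list" where
  "add_term = (\<lambda>(c, i, x). [Cx_Const (Work 6, 1) c, Cx_Mult (Work 6, 1) (Work 6, 1) (Work i, 1),
     Cx_Mult (Work 6, 1) (Work 6, 1) x, Cx_Add (Work 0, 3) (Work 0, 3) (Work 6, 1)])"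

definition add_terms :: "(complex \<times> nat \<times> 'v array \<times> nat) list \<Rightarrow> 'v array instr list" where
  "add_terms ts = concat (map add_term ts)"

text \<open>A term (c, i, x) stands for the product of a constant, a scalar variable and an operand.
  The conditions keep the terms from reading the accumulator \<open>Work 0\<close> and the scratch
  variable \<open>Work 6\<close>.\<close>

lemma run_add_terms:
  assumes "\<forall>(c, i, x)\<in>set ts. i \<notin> {0, 6} \<and> fst x \<notin> {Work 0, Work 6}"
  shows "\<exists>z. fold run_instr (add_terms ts) (r, m) = (r, m(Work 0 := (m (Work 0))(r 3 := m (Work 0) (r 3)
      + (\<Sum>(c, i, x)\<leftarrow>ts. c * m (Work i) (r 1) * m (fst x) (r (snd x)))), Work 6 := z))"
  using assms
proof (induction ts arbitrary: m)
  case Nil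
  show ?case by (intro exI[of _ "m (Work 6)"]) (simp add: add_terms_def)
next
  case (Cons t ts)
  obtain c i y k where t: "t = (c, i, (y, k))" by (metis prod_cases4)
  have ne: "i \<noteq> 0" "i \<noteq> 6" "y \<noteq> Work 0" "y \<noteq> Work 6" using Cons.prems by (auto simp: t)
  define S where "S = c * m (Work i) (r 1) * m y (r k)"
  define z where "z = (m (Work 6))(r 1 := S)"
  have m1: "fold run_instr (add_term t) (r, m)
      = (r, m(Work 0 := (m (Work 0))(r 3 := m (Work 0) (r 3) + S), Work 6 := z))" (is "_ = (r, ?m1)")
    using ne by (simp add: t add_term_def set_cell_def cell_def S_def z_def fun_eq_iff)
  have prems: "\<forall>(c, i, x)\<in>set ts. i \<notin> {0, 6} \<and> fst x \<notin> {Work 0, Work 6}"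
    using Cons.prems by simp
  from Cons.IH[OF prems, of ?m1] obtain z' where z': "fold run_instr (add_terms ts) (r, ?m1) = (r, ?m1(Work 0 := (?m1 (Work 0))(r 3 := ?m1 (Work 0) (r 3)
      + (\<Sum>(c, i, x)\<leftarrow>ts. c * ?m1 (Work i) (r 1) * ?m1 (fst x) (r (snd x)))), Work 6 := z'))"
    by (elim exE) (rule that)
  have "(\<Sum>(c, i, x)\<leftarrow>ts. c * ?m1 (Work i) (r 1) * ?m1 (fst x) (r (snd x)))
      = (\<Sum>(c, i, x)\<leftarrow>ts. c * m (Work i) (r 1) * m (fst x) (r (snd x)))"
    using Cons.prems by (intro arg_cong[of _ _ sum_list] map_cong) auto
  then have "fold run_instr (add_terms (t # ts)) (r, m) = (r, m(Work 0 := (m (Work 0))(r 3 := m (Work 0) (r 3)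
      + (\<Sum>(c, i, x)\<leftarrow>t # ts. c * m (Work i) (r 1) * m (fst x) (r (snd x)))), Work 6 := z'))"
    using m1 z' by (simp add: add_terms_def t S_def fun_upd_twist add.assoc)
  then show ?case by blast
qed

text \<open>The factor 2 is the degree of a subdivision vertex. \<open>Work 4\<close> and
  \<open>Work 5\<close> hold the phases of the two halves of the wave, registers 3 and 4 the
  positions n and N - n.\<close>

definition edge_terms ::
  "'v set list \<Rightarrow> ('v set \<Rightarrow> complex) \<Rightarrow> ('v set \<Rightarrow> complex) \<Rightarrow> (complex \<times> nat \<times> 'v array \<times> nat) list" where
  "edge_terms es a b = concat (map (\<lambda>e. [(2 * cnj (a e), 4, (In_Edge e, 3)), (2 * cnj (b e), 5, (In_Edge e, 4))]) es)"

definition fill_phases :: "real \<Rightarrow> 'v array instr list" where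
  "fill_phases \<omega> =
     [Nat_Sub 4 0 3,
      Cx_Of_Nat (Work 3, 1) 0,
      Cx_Of_Nat (Work 2, 1) 3,
      Cx_Div (Work 2, 1) (Work 2, 1) (Work 3, 1),
      Cx_Const (Work 4, 1) (- \<i> * of_real \<omega>),
      Cx_Mult (Work 4, 1) (Work 4, 1) (Work 2, 1),
      Cx_Exp (Work 4, 1) (Work 4, 1),
      Cx_Of_Nat (Work 2, 1) 4,
      Cx_Div (Work 2, 1) (Work 2, 1) (Work 3, 1),
      Cx_Const (Work 5, 1) (\<i> * of_real \<omega>),
      Cx_Mult (Work 5, 1) (Work 5, 1) (Work 2, 1),
      Cx_Exp (Work 5, 1) (Work 5, 1),
      Cx_Const (Work 0, 3) 0]"

definition fill_body ::
  "'v set list \<Rightarrow> ('v set \<Rightarrow> complex) \<Rightarrow> ('v set \<Rightarrow> complex) \<Rightarrow> real \<Rightarrow> 'v array instr list" where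
  "fill_body es a b \<omega> = fill_phases \<omega> @ add_terms (edge_terms es a b) @ [Nat_Add 3 3 2]"

text \<open>
  The second half of a wave is reflected, \<open>n \<mapsto> N - n\<close>, so that both halves need the same
  discrete Fourier transform.
\<close>

definition edge_input ::
  "nat \<Rightarrow> ('v set \<Rightarrow> nat \<Rightarrow> complex) \<Rightarrow> 'v set list \<Rightarrow> ('v set \<Rightarrow> complex) \<Rightarrow> ('v set \<Rightarrow> complex) \<Rightarrow> real \<Rightarrow> nat \<Rightarrow> complex" where
  "edge_input N f es a b \<omega> n = (\<Sum>e\<leftarrow>es.
     2 * cnj (a e) * cis (- (\<omega> * (real n / real N))) * f e n
     + 2 * cnj (b e) * cis (\<omega> * (real (N - n) / real N)) * f e (N - n))"

lemma exp_i_of_nat_div: "exp (\<i> * of_real \<omega> * (of_nat n / of_nat N)) = cis (\<omega> * (real n / real N))"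
    "exp (- \<i> * of_real \<omega> * (of_nat n / of_nat N)) = cis (- (\<omega> * (real n / real N)))"
  by (simp_all add: cis_conv_exp mult.assoc)

lemma run_fill_body:
  assumes s: "ready N s"
  shows "frame s (fold run_instr (fill_body es a b \<omega>) s) \<and>
    fst (fold run_instr (fill_body es a b \<omega>) s) 3 = Suc (fst s 3) \<and>
    snd (fold run_instr (fill_body es a b \<omega>) s) (Work 0)
      = (snd s (Work 0))(fst s 3 := edge_input N (\<lambda>e. snd s (In_Edge e)) es a b \<omega> (fst s 3))"
proof -
  obtain r m where rm: "s = (r, m)" by fastforce
  have r: "r 0 = N" "r 1 = 0" "r (Suc 0) = 0" "r 2 = 1" using s by (auto simp: ready_def rm)
  define n where "n = r 3"
  define r1 where "r1 = r(4 := N - n)"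
  define m1 where "m1 = m(Work 3 := (m (Work 3))(0 := of_nat N),
     Work 2 := (m (Work 2))(0 := of_nat (N - n) / of_nat N),
     Work 4 := (m (Work 4))(0 := cis (- (\<omega> * (real n / real N)))),
     Work 5 := (m (Work 5))(0 := cis (\<omega> * (real (N - n) / real N))),
     Work 0 := (m (Work 0))(n := 0))"
  have 1: "fold run_instr (fill_phases \<omega>) s = (r1, m1)"
    unfolding rm m1_def r1_def exp_i_of_nat_div[symmetric] fill_phases_def
    by (simp add: set_reg_def set_cell_def cell_def r n_def[symmetric] fun_upd_twist)
  have ok: "\<forall>(c, i, x)\<in>set (edge_terms es a b). i \<notin> {0, 6} \<and> fst x \<notin> {Work 0, Work 6}"
    by (auto simp: edge_terms_def)
  obtain z where 2: "fold run_instr (add_terms (edge_terms es a b)) (r1, m1)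
      = (r1, m1(Work 0 := (m1 (Work 0))(r1 3 := m1 (Work 0) (r1 3)
        + (\<Sum>(c, i, x)\<leftarrow>edge_terms es a b. c * m1 (Work i) (r1 1) * m1 (fst x) (r1 (snd x)))), Work 6 := z))"
    using run_add_terms[OF ok] by blast
  have "(\<Sum>(c, i, x)\<leftarrow>edge_terms es a b. c * m1 (Work i) (r1 1) * m1 (fst x) (r1 (snd x)))
      = edge_input N (\<lambda>e. m (In_Edge e)) es a b \<omega> n"
  proof (induction es)
    case (Cons e es)
    then show ?case by (simp add: edge_terms_def edge_input_def m1_def r1_def r n_def[symmetric])
  qed (simp add: edge_terms_def edge_input_def)
  then have 3: "fold run_instr (fill_body es a b \<omega>) s = (r1(3 := Suc n),
      m1(Work 0 := (m (Work 0))(n := edge_input N (\<lambda>e. m (In_Edge e)) es a b \<omega> n), Work 6 := z))"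
    unfolding fill_body_def fold_append o_apply 1 2
    by (simp add: set_reg_def r1_def r n_def[symmetric]) (simp add: m1_def)
  show ?thesis unfolding 3 by (simp add: frame_def rm n_def[symmetric] r1_def m1_def)
qed

text \<open>A wave has the same values at the old vertices for every m. Their contribution therefore
  is constant in m and goes into entry 0, whose Fourier phase is 1.\<close>

definition fill ::
  "'v set list \<Rightarrow> ('v set \<Rightarrow> complex) \<Rightarrow> ('v set \<Rightarrow> complex) \<Rightarrow> real \<Rightarrow> 'v list \<Rightarrow> ('v \<Rightarrow> complex) \<Rightarrow> 'v array prog" where
  "fill es a b \<omega> vs \<gamma> = Seq (Instr (Nat_Const 3 0)) (Seq (While_Less 3 0 (block (fill_body es a b \<omega>)))
     (block ([Nat_Const 3 0, Cx_Const (Work 4, 1) 1] @ add_terms (map (\<lambda>v. (\<gamma> v, 4, (In_Vertex v, 1))) vs))))"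

definition fft_input ::
  "nat \<Rightarrow> ('v set \<Rightarrow> nat \<Rightarrow> complex) \<Rightarrow> ('v \<Rightarrow> complex) \<Rightarrow> 'v set list \<Rightarrow> ('v set \<Rightarrow> complex) \<Rightarrow> ('v set \<Rightarrow> complex) \<Rightarrow> real
    \<Rightarrow> 'v list \<Rightarrow> ('v \<Rightarrow> complex) \<Rightarrow> nat \<Rightarrow> complex" where
  "fft_input N f g es a b \<omega> vs \<gamma> n = edge_input N f es a b \<omega> n + (if n = 0 then (\<Sum>v\<leftarrow>vs. \<gamma> v * g v) else 0)"

lemma halts_fill:
  assumes s: "ready N s"
  shows "halts (fill es a b \<omega> vs \<gamma>) s (N * (length (fill_body es a b \<omega>) + 2) + length (add_terms (map (\<lambda>v. (\<gamma> v, 4::nat, (In_Vertex v, 1::nat))) vs)) + 5)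
    (\<lambda>s'. frame s s' \<and> (\<forall>n<N. snd s' (Work 0) n
      = fft_input N (\<lambda>e. snd s (In_Edge e)) (\<lambda>v. snd s (In_Vertex v) 0) es a b \<omega> vs \<gamma> n))"
proof -
  let ?F = "edge_input N (\<lambda>e. snd s (In_Edge e)) es a b \<omega>"
  let ?vt = "map (\<lambda>v. (\<gamma> v, 4::nat, (In_Vertex v, 1::nat))) vs"
  define Inv where "Inv n s' \<longleftrightarrow> frame s s' \<and> fst s' 3 = n \<and> (\<forall>n'<n. snd s' (Work 0) n' = ?F n')" for n s'
  have loop: "halts (While_Less 3 0 (block (fill_body es a b \<omega>))) s' (N * ((length (fill_body es a b \<omega>) + 1) + 1) + 1) (Inv N)"
    if "Inv 0 s'" for s'
  proof (rule halts_While[of N Inv, OF _ _ that])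
    fix n s' assume n: "n < N" and I: "Inv n s'"
    have "ready N s'" using I s frame_ready unfolding Inv_def by metis
    note body = run_fill_body[OF this, of es a b \<omega>]
    have in_eq: "(\<lambda>e. snd s' (In_Edge e)) = (\<lambda>e. snd s (In_Edge e))" using I by (auto simp: Inv_def frame_def)
    have "frame s (fold run_instr (fill_body es a b \<omega>) s')"
      using body I frame_trans unfolding Inv_def by metis
    then have "Inv (Suc n) (fold run_instr (fill_body es a b \<omega>) s')"
      using body I unfolding Inv_def in_eq by (auto simp: less_Suc_eq)
    moreover
    have "fst s' 0 = N" using \<open>ready N s'\<close> by (simp add: ready_def)
    then have "fst s' 3 < fst s' 0" using n I by (simp add: Inv_def)
    ultimately show "fst s' 3 < fst s' 0 \<and> halts (block (fill_body es a b \<omega>)) s' (length (fill_body es a b \<omega>) + 1) (Inv (Suc n))"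
      by (intro conjI halts_block)
  next
    fix s' assume "Inv N s'"
    then show "\<not> fst s' 3 < fst s' 0" using frame_ready[OF _ s] by (auto simp: Inv_def ready_def)
  qed
  have last: "halts (block ([Nat_Const 3 0, Cx_Const (Work 4, 1) 1] @ add_terms ?vt)) s' (length ([Nat_Const 3 0, Cx_Const (Work 4, 1) 1] @ add_terms ?vt) + 1)
    (\<lambda>s'. frame s s' \<and> (\<forall>n<N. snd s' (Work 0) n
      = fft_input N (\<lambda>e. snd s (In_Edge e)) (\<lambda>v. snd s (In_Vertex v) 0) es a b \<omega> vs \<gamma> n))" if I: "Inv N s'" for s'
  proof (rule halts_block)
    obtain r m where rm: "s' = (r, m)" by fastforce
    have "ready N s'" using I s frame_ready unfolding Inv_def by metis
    then have r: "r 0 = N" "r 1 = 0" "r (Suc 0) = 0" "r 2 = 1" by (auto simp: ready_def rm)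
    define r1 where "r1 = r(3 := 0)"
    define m1 where "m1 = m(Work 4 := (m (Work 4))(0 := 1))"
    have 1: "fold run_instr [Nat_Const 3 0, Cx_Const (Work 4, 1) 1] s' = (r1, m1)"
      by (simp add: rm set_reg_def set_cell_def r r1_def m1_def)
    have ok: "\<forall>(c, i, x)\<in>set ?vt. i \<notin> {0, 6} \<and> fst x \<notin> {Work 0, Work 6}" by auto
    obtain z where 2: "fold run_instr (add_terms ?vt) (r1, m1)
      = (r1, m1(Work 0 := (m1 (Work 0))(r1 3 := m1 (Work 0) (r1 3)
        + (\<Sum>(c, i, x)\<leftarrow>?vt. c * m1 (Work i) (r1 1) * m1 (fst x) (r1 (snd x)))), Work 6 := z))"
      using run_add_terms[OF ok] by blast
    have in_eq: "m (In_Vertex v) = snd s (In_Vertex v)" for v using I by (auto simp: Inv_def frame_def rm)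
    have 3: "(\<Sum>(c, i, x)\<leftarrow>?vt. c * m1 (Work i) (r1 1) * m1 (fst x) (r1 (snd x)))
        = (\<Sum>v\<leftarrow>vs. \<gamma> v * snd s (In_Vertex v) 0)"
      by (simp add: o_def m1_def r1_def r in_eq)
    show "frame s (fold run_instr ([Nat_Const 3 0, Cx_Const (Work 4, 1) 1] @ add_terms ?vt) s') \<and>
      (\<forall>n<N. snd (fold run_instr ([Nat_Const 3 0, Cx_Const (Work 4, 1) 1] @ add_terms ?vt) s') (Work 0) n
      = fft_input N (\<lambda>e. snd s (In_Edge e)) (\<lambda>v. snd s (In_Vertex v) 0) es a b \<omega> vs \<gamma> n)"
      unfolding fold_append o_apply 1 2 3
      using I by (auto simp: Inv_def frame_def rm r1_def m1_def fft_input_def)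
  qed
  have first: "halts (Instr (Nat_Const 3 0)) s 1 (Inv 0)"
    by (rule halts_Instr) (simp add: Inv_def frame_def set_reg_def)
  show ?thesis
    unfolding fill_def
    by (rule halts_mono[OF halts_Seq[OF first halts_Seq[OF loop last]]]) (auto simp: algebra_simps)
qed

section \<open>The fast Fourier transform\<close>

text \<open>
  \<open>fft_part F L M u r\<close> is the discrete Fourier transform of the \<open>L\<close> entries \<open>r, r + M, r + 2M, \<dots>\<close> of \<open>F\<close>,
  evaluated at \<open>u\<close>. Storing it at position \<open>u * M + r\<close> keeps the output in order without bit reversal.
\<close>

definition fft_part :: "(nat \<Rightarrow> complex) \<Rightarrow> nat \<Rightarrow> nat \<Rightarrow> nat \<Rightarrow> nat \<Rightarrow> complex" where
  "fft_part F L M u r = (\<Sum>i<L. F (r + M * i) * cis (- (2 * pi * (real u * real i / real L))))"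

lemma sum_even_odd: "(\<Sum>i<2 * n. g i) = (\<Sum>i<n. g (2 * i)) + (\<Sum>i<n. g (2 * i + 1))"
  for g :: "nat \<Rightarrow> 'a::comm_monoid_add"
  by (induction n) (simp_all add: ac_simps)

text \<open>Radix-2 splitting: the even i form the subsequence with offset r and stride 2 M, the odd
  i the one with offset r + M.\<close>

lemma fft_part_double:
  assumes "0 < L"
  shows "fft_part F (2 * L) M u r = fft_part F L (2 * M) u r
    + cis (- (2 * pi * (real u / real (2 * L)))) * fft_part F L (2 * M) u (r + M)"
proof -
  have even: "F (r + M * (2 * i)) * cis (- (2 * pi * (real u * real (2 * i) / real (2 * L))))
      = F (r + 2 * M * i) * cis (- (2 * pi * (real u * real i / real L)))" for i
    by (simp add: mult_ac)
  have odd: "F (r + M * (2 * i + 1)) * cis (- (2 * pi * (real u * real (2 * i + 1) / real (2 * L))))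
      = cis (- (2 * pi * (real u / real (2 * L))))
        * (F (r + M + 2 * M * i) * cis (- (2 * pi * (real u * real i / real L))))" for i
  proof -
    have "- (2 * pi * (real u * real (2 * i + 1) / real (2 * L)))
        = - (2 * pi * (real u / real (2 * L))) + - (2 * pi * (real u * real i / real L))"
      using assms by (simp add: field_simps)
    moreover have "r + M * (2 * i + 1) = r + M + 2 * M * i" by (simp add: algebra_simps)
    ultimately show ?thesis by (simp only: cis_mult[symmetric]) (simp only: mult_ac)
  qed
  show ?thesis unfolding fft_part_def sum_even_odd even odd by (simp add: sum_distrib_left)
qed

lemma cis_minus_2pi_nat: "cis (- (2 * pi * real n)) = 1"
proof -
  have "cis (2 * pi * real_of_int (- int n)) = 1" by (intro cis_multiple_2pi) auto
  then show ?thesis by simp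
qed

lemma fft_part_periodic:
  assumes "0 < L"
  shows "fft_part F L M (u + L) r = fft_part F L M u r"
  unfolding fft_part_def
proof (intro sum.cong refl)
  fix i
  have "- (2 * pi * (real (u + L) * real i / real L)) = - (2 * pi * (real u * real i / real L)) + - (2 * pi * real i)"
    using assms by (simp add: field_simps)
  then show "F (r + M * i) * cis (- (2 * pi * (real (u + L) * real i / real L)))
      = F (r + M * i) * cis (- (2 * pi * (real u * real i / real L)))"
    by (simp only: cis_mult[symmetric] cis_minus_2pi_nat) simp
qed

text \<open>Moving u by L is half a turn of the twiddle factor and a full period of both
  subtransforms, so only the sign changes and the same two values serve twice.\<close>

lemma fft_part_double_shift:
  assumes "0 < L"
  shows "fft_part F (2 * L) M (u + L) r = fft_part F L (2 * M) u r
    - cis (- (2 * pi * (real u / real (2 * L)))) * fft_part F L (2 * M) u (r + M)"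
proof -
  have "- (2 * pi * (real (u + L) / real (2 * L))) = - (2 * pi * (real u / real (2 * L))) + - pi"
    using assms by (simp add: field_simps)
  then have "cis (- (2 * pi * (real (u + L) / real (2 * L)))) = - cis (- (2 * pi * (real u / real (2 * L))))"
    by (simp only: cis_mult[symmetric]) (simp add: complex_eq_iff)
  then show ?thesis using fft_part_double[OF assms, of F M "u + L" r] by (simp add: fft_part_periodic[OF assms])
qed

text \<open>Registers 10 and 11 address the second source entry, M further on, and the second target
  entry, N/2 further on. \<open>Work 4\<close> supplies the twiddle factor.\<close>

definition butterfly :: "'v array instr list" where
  "butterfly = [Nat_Add 10 8 6, Nat_Add 11 7 5, Cx_Mult (Work 5, 1) (Work 4, 1) (Work 0, 10),
     Cx_Add (Work 1, 7) (Work 0, 8) (Work 5, 1), Cx_Sub (Work 1, 11) (Work 0, 8) (Work 5, 1),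
     Nat_Add 7 7 2, Nat_Add 8 8 2]"

text \<open>At the start of block u register 7 holds u M, and with N = 2 L M the quotient u M / N is
  the exponent u / (2 L) of the splitting. Register 9 marks the end of the block, so one exponential
  serves M butterflies.\<close>

definition twiddle :: "'v array instr list" where
  "twiddle = [Cx_Of_Nat (Work 2, 1) 7, Cx_Of_Nat (Work 3, 1) 0, Cx_Div (Work 2, 1) (Work 2, 1) (Work 3, 1),
     Cx_Const (Work 4, 1) (- \<i> * of_real (2 * pi)), Cx_Mult (Work 4, 1) (Work 4, 1) (Work 2, 1),
     Cx_Exp (Work 4, 1) (Work 4, 1), Nat_Add 9 7 6]"

text \<open>
  In a stage, register 5 holds \<open>N/2\<close> and register 6 half the length \<open>2 M\<close> of the current blocks.
  Register 7 is the position in the target \<open>Work 1\<close>, register 8 that in the source \<open>Work 0\<close>.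
\<close>

definition fft_stage :: "'v array prog" where
  "fft_stage = Seq (block [Nat_Const 7 0, Nat_Const 8 0])
    (Seq (While_Less 7 5 (Seq (block twiddle) (Seq (While_Less 7 9 (block butterfly)) (block [Nat_Add 8 8 6]))))
    (Seq (block [Nat_Const 3 0])
    (Seq (While_Less 3 0 (block [Cx_Copy (Work 0, 3) (Work 1, 3), Nat_Add 3 3 2]))
    (block [Nat_Half 6 6]))))"

text \<open>Register 1 holds 0, so the loop ends when halving has brought register 6 to 0, after the
  stage with M = 1.\<close>

definition fft :: "'v array prog" where
  "fft = Seq (block [Nat_Half 5 0, Nat_Half 6 0]) (While_Less 1 6 fft_stage)"

text \<open>For d = u M + r with r < M, \<open>d div M * M\<close> is u M. The source entry is thus
  number r + M of block u in the old layout with blocks of length 2 M.\<close>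

definition stage_rot :: "nat \<Rightarrow> nat \<Rightarrow> (nat \<Rightarrow> complex) \<Rightarrow> nat \<Rightarrow> complex" where
  "stage_rot N M X d = cis (- (2 * pi * (real (d div M * M) / real N))) * X (d + d div M * M + M)"

lemma run_butterfly:
  assumes "ready N s"
  defines "s' \<equiv> fold run_instr butterfly s"
  shows "frame s s'" "fst s' 7 = Suc (fst s 7)" "fst s' 8 = Suc (fst s 8)"
    "fst s' 5 = fst s 5" "fst s' 6 = fst s 6" "fst s' 9 = fst s 9"
    "snd s' (Work 0) = snd s (Work 0)" "snd s' (Work 4) = snd s (Work 4)"
    "snd s' (Work 1) = (snd s (Work 1))(
       fst s 7 := snd s (Work 0) (fst s 8) + snd s (Work 4) 0 * snd s (Work 0) (fst s 8 + fst s 6),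
       fst s 7 + fst s 5 := snd s (Work 0) (fst s 8) - snd s (Work 4) 0 * snd s (Work 0) (fst s 8 + fst s 6))"
  using assms(1) unfolding s'_def
  by (simp_all add: butterfly_def set_reg_def set_cell_def cell_def ready_def frame_def)

lemma run_twiddle:
  assumes "ready N s"
  defines "s' \<equiv> fold run_instr twiddle s"
  shows "frame s s'" "fst s' 7 = fst s 7" "fst s' 8 = fst s 8"
    "fst s' 5 = fst s 5" "fst s' 6 = fst s 6" "fst s' 9 = fst s 7 + fst s 6"
    "snd s' (Work 0) = snd s (Work 0)" "snd s' (Work 1) = snd s (Work 1)"
    "snd s' (Work 4) 0 = cis (- (2 * pi * (real (fst s 7) / real N)))"
  using assms(1) unfolding s'_def exp_i_of_nat_div[symmetric]
  by (simp_all add: twiddle_def set_reg_def set_cell_def cell_def ready_def frame_def)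

lemma halts_fft_stage:
  assumes s0: "ready N s0" and fr: "frame s0 s" and N: "N = 2 * h" and h: "h = L * M" and M: "0 < M" and L: "0 < L"
    and r5: "fst s 5 = h" and r6: "fst s 6 = M"
  shows "halts fft_stage s (40 * N) (\<lambda>s'. frame s0 s' \<and> fst s' 5 = h \<and> fst s' 6 = M div 2 \<and>
    (\<forall>d<h. snd s' (Work 0) d = snd s (Work 0) (d + d div M * M) + stage_rot N M (snd s (Work 0)) d \<and>
      snd s' (Work 0) (d + h) = snd s (Work 0) (d + d div M * M) - stage_rot N M (snd s (Work 0)) d))"
proof -
  define X where "X = snd s (Work 0)"
  define R where "R = stage_rot N M X"
  \<comment> \<open>After d butterflies the first d entries of either half of the target are
    final.\<close>
  define Y where "Y d z \<longleftrightarrow> (\<forall>d'<d. z d' = X (d' + d' div M * M) + R d' \<and> z (d' + h) = X (d' + d' div M * M) - R d')" for d and z :: "nat \<Rightarrow> complex"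
  define St where "St s' \<longleftrightarrow> frame s0 s' \<and> fst s' 5 = h \<and> fst s' 6 = M \<and> snd s' (Work 0) = X" for s'
  define Out where "Out u s' \<longleftrightarrow> St s' \<and> fst s' 7 = u * M \<and> fst s' 8 = 2 * (u * M) \<and> Y (u * M) (snd s' (Work 1))" for u s'
  define Inn where "Inn u r s' \<longleftrightarrow> St s' \<and> fst s' 7 = u * M + r \<and> fst s' 8 = 2 * (u * M) + r \<and> fst s' 9 = u * M + M
      \<and> snd s' (Work 4) 0 = cis (- (2 * pi * (real (u * M) / real N))) \<and> Y (u * M + r) (snd s' (Work 1))" for u r s'
  have rdy: "ready N s'" if "St s'" for s' using that s0 frame_ready unfolding St_def by metis
  have inner: "halts (While_Less 7 9 (block butterfly)) s' (M * (8 + 1) + 1) (Inn u M)"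
    if u: "u < L" and I: "Inn u 0 s'" for u s'
  proof (rule halts_While[of M "Inn u", OF _ _ I])
    fix r s' assume r: "r < M" and I: "Inn u r s'"
    note b = run_butterfly[OF rdy, of s']
    have St: "St s'" using I by (simp add: Inn_def)
    let ?s = "fold run_instr butterfly s'"
    have "frame s0 ?s" using b(1)[OF St] St frame_trans unfolding St_def by metis
    then have St': "St ?s" using b[OF St] St by (simp add: St_def)
    have "u * M + M \<le> h" using u mult_le_mono1[of "Suc u" L M] by (simp add: h)
    then have d: "u * M + r < h" using r by simp
    have dv: "(u * M + r) div M = u" using r M by simp
    have x: "X (fst s' 8) = X ((u * M + r) + (u * M + r) div M * M)"
      "snd s' (Work 4) 0 * X (fst s' 8 + fst s' 6) = R (u * M + r)"
    proof -
      have "fst s' 8 = u * M + r + u * M" "fst s' 8 + fst s' 6 = u * M + r + u * M + M"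
        using I St by (simp_all add: Inn_def St_def)
      then show "X (fst s' 8) = X ((u * M + r) + (u * M + r) div M * M)"
          "snd s' (Work 4) 0 * X (fst s' 8 + fst s' 6) = R (u * M + r)"
        using I unfolding R_def stage_rot_def dv by (simp_all only: Inn_def)
    qed
    have "Y (u * M + r) (snd s' (Work 1))" using I by (simp add: Inn_def)
    then have "Y (Suc (u * M + r)) (snd ?s (Work 1))"
      unfolding b(9)[OF St] using I St d x
      by (auto simp: Y_def Inn_def St_def less_Suc_eq)
    then have "Inn u (Suc r) ?s" using St' I b[OF St] by (simp add: Inn_def)
    then have "halts (block butterfly) s' 8 (Inn u (Suc r))"
      by (intro halts_block_length) (simp_all add: butterfly_def)
    then show "fst s' 7 < fst s' 9 \<and> halts (block butterfly) s' 8 (Inn u (Suc r))"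
      using I r by (simp add: Inn_def)
  qed (simp add: Inn_def)
  have outer: "halts (While_Less 7 5 (Seq (block twiddle) (Seq (While_Less 7 9 (block butterfly)) (block [Nat_Add 8 8 6])))) s'
      (L * ((8 + ((M * (8 + 1) + 1) + 2)) + 1) + 1) (Out L)" if I: "Out 0 s'" for s'
  proof (rule halts_While[of L Out, OF _ _ I])
    fix u s' assume u: "u < L" and I: "Out u s'"
    have St: "St s'" using I by (simp add: Out_def)
    note t = run_twiddle[OF rdy[OF St]]
    let ?s = "fold run_instr twiddle s'"
    have "frame s0 ?s" using t(1) St frame_trans unfolding St_def by metis
    then have "St ?s" using t St by (simp add: St_def)
    then have "Inn u 0 ?s" using t I St by (simp add: Inn_def Out_def St_def)
    then have 1: "halts (block twiddle) s' 8 (Inn u 0)"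
      by (intro halts_block_length) (simp_all add: twiddle_def)
    \<comment> \<open>The M second operands of the block have been consumed as well, so the source
      position skips them.\<close>
    have 2: "halts (block [Nat_Add 8 8 6]) s2 2 (Out (Suc u))" if "Inn u M s2" for s2
      using that by (intro halts_block_length)
        (simp_all add: Inn_def Out_def St_def set_reg_def frame_def add.commute)
    have "u * M < h" using u M by (simp add: h)
    then show "fst s' 7 < fst s' 5 \<and>
      halts (Seq (block twiddle) (Seq (While_Less 7 9 (block butterfly)) (block [Nat_Add 8 8 6]))) s'
        (8 + ((M * (8 + 1) + 1) + 2)) (Out (Suc u))"
      using I St halts_Seq[OF 1 halts_Seq[OF inner[OF u] 2]] by (simp add: Out_def St_def)
  qed (simp add: Out_def St_def h)
  define Cp where "Cp n s' \<longleftrightarrow> frame s0 s' \<and> fst s' 5 = h \<and> fst s' 6 = M \<and> fst s' 3 = n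
      \<and> Y h (snd s' (Work 1)) \<and> (\<forall>n'<n. snd s' (Work 0) n' = snd s' (Work 1) n')" for n s'
  have copy: "halts (While_Less 3 0 (block [Cx_Copy (Work 0, 3) (Work 1, 3), Nat_Add 3 3 2])) s'
      (N * (3 + 1) + 1) (Cp N)" if I: "Cp 0 s'" for s'
  proof (rule halts_While[of N Cp, OF _ _ I])
    fix n s' assume n: "n < N" and I: "Cp n s'"
    have "ready N s'" using I s0 frame_ready unfolding Cp_def by metis
    then have r: "fst s' 0 = N" "fst s' 1 = 0" "fst s' (Suc 0) = 0" "fst s' 2 = 1" by (auto simp: ready_def)
    have "Cp (Suc n) (fold run_instr [Cx_Copy (Work 0, 3) (Work 1, 3), Nat_Add 3 3 2] s')"
      using I r by (auto simp: Cp_def set_reg_def set_cell_def cell_def frame_def less_Suc_eq)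
    then have "halts (block [Cx_Copy (Work 0, 3) (Work 1, 3), Nat_Add 3 3 2]) s' 3 (Cp (Suc n))"
      by (intro halts_block_length) simp_all
    then show "fst s' 3 < fst s' 0 \<and> halts (block [Cx_Copy (Work 0, 3) (Work 1, 3), Nat_Add 3 3 2]) s' 3 (Cp (Suc n))"
      using n I r by (simp only: Cp_def)
  next
    fix s' assume "Cp N s'"
    then show "\<not> fst s' 3 < fst s' 0" using frame_ready[OF _ s0] by (auto simp: Cp_def ready_def)
  qed
  have a: "halts (block [Nat_Const 7 0, Nat_Const 8 0]) s 3 (Out 0)"
    using fr r5 r6 by (intro halts_block_length) (simp_all add: Out_def St_def X_def Y_def set_reg_def frame_def)
  have b: "halts (block [Nat_Const 3 0]) s' 2 (Cp 0)" if "Out L s'" for s'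
    using that by (intro halts_block_length) (simp_all add: Out_def St_def Cp_def h[symmetric] set_reg_def frame_def)
  have c: "halts (block [Nat_Half 6 6]) s' 2 (\<lambda>s'. frame s0 s' \<and> fst s' 5 = h \<and> fst s' 6 = M div 2 \<and>
     (\<forall>d<h. snd s' (Work 0) d = X (d + d div M * M) + R d \<and> snd s' (Work 0) (d + h) = X (d + d div M * M) - R d))"
    (is "halts _ _ _ ?Q") if "Cp N s'" for s'
    using that by (intro halts_block_length) (auto simp: Cp_def Y_def set_reg_def frame_def N)
  have Lh: "L \<le> h" "1 \<le> h" using M L by (simp_all add: h)
  have eq: "L * ((8 + ((M * (8 + 1) + 1) + 2)) + 1) = 9 * h + 12 * L" by (simp add: h algebra_simps)
  \<comment> \<open>9 h for the butterflies, at most 12 h for the overhead of the L blocks and 4 N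
    for copying back, apart from a few single steps; 40 N is a generous bound.\<close>
  have time: "3 + ((L * ((8 + ((M * (8 + 1) + 1) + 2)) + 1) + 1) + (2 + ((N * (3 + 1) + 1) + 2))) \<le> 40 * N"
    unfolding eq N using Lh by simp
  show ?thesis unfolding fft_stage_def X_def[symmetric] R_def[symmetric]
    by (rule halts_mono[OF halts_Seq[OF a halts_Seq[OF outer halts_Seq[OF b halts_Seq[OF copy c]]]] time])
qed

lemma halts_fft:
  assumes s: "ready N s" and N: "N = 2 ^ p" and p: "1 \<le> p"
  shows "halts fft s (p * (40 * N + 1) + 4) (\<lambda>s'. frame s s' \<and>
    (\<forall>m<N. snd s' (Work 0) m = (\<Sum>n<N. snd s (Work 0) n * cis (- (2 * pi * (real m * real n / real N))))))"
proof -
  define F where "F = snd s (Work 0)"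
  define h where "h = (2::nat) ^ (p - 1)"
  have Nh: "N = 2 * h" using p by (simp add: N h_def power_eq_if)
  \<comment> \<open>After t stages the array holds 2^(p - t) interleaved transforms of length 2^t.
    Written as a quotient, the content of register 6 becomes 0 at t = p, which ends the
    loop.\<close>
  define Inv where "Inv t s' \<longleftrightarrow> frame s s' \<and> fst s' 5 = h \<and> fst s' 6 = 2 ^ p div 2 ^ Suc t \<and>
     (\<forall>u<2 ^ t. \<forall>r<2 ^ (p - t). snd s' (Work 0) (u * 2 ^ (p - t) + r) = fft_part F (2 ^ t) (2 ^ (p - t)) u r)" for t s'
  have start: "halts (block [Nat_Half 5 0, Nat_Half 6 0]) s 3 (Inv 0)"
  proof (rule halts_block_length)
    show "Inv 0 (fold run_instr [Nat_Half 5 0, Nat_Half 6 0] s)"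
      using s Nh by (simp add: Inv_def set_reg_def frame_def ready_def N[symmetric] F_def fft_part_def)
  qed simp
  have loop: "halts (While_Less 1 6 fft_stage) s' (p * (40 * N + 1) + 1) (Inv p)" if I: "Inv 0 s'" for s'
  proof (rule halts_While[of p Inv, OF _ _ I])
    fix t s' assume t: "t < p" and I: "Inv t s'"
    define L where "L = (2::nat) ^ t"
    define M where "M = (2::nat) ^ (p - Suc t)"
    have M: "2 ^ p div 2 ^ Suc t = M" using t by (simp add: M_def power_diff)
    have M2: "2 ^ (p - t) = 2 * M" using t by (simp add: M_def Suc_diff_Suc flip: power_Suc)
    have hLM: "h = L * M" using t by (simp add: h_def L_def M_def flip: power_add)
    have pos: "0 < L" "0 < M" by (auto simp: L_def M_def)
    define X where "X = snd s' (Work 0)"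
    have X: "X (u * (2 * M) + r) = fft_part F L (2 * M) u r" if "u < L" "r < 2 * M" for u r
      using I that unfolding Inv_def M2 X_def L_def by blast
    have regs: "frame s s'" "fst s' 5 = h" "fst s' 6 = M" using I M by (auto simp: Inv_def)
    have stage: "Inv (Suc t) s''" if *: "frame s s'' \<and> fst s'' 5 = h \<and> fst s'' 6 = M div 2 \<and>
       (\<forall>d<h. snd s'' (Work 0) d = X (d + d div M * M) + stage_rot N M X d \<and>
        snd s'' (Work 0) (d + h) = X (d + d div M * M) - stage_rot N M X d)" for s''
    proof -
      have key: "snd s'' (Work 0) (u * M + r) = fft_part F (2 * L) M u r \<and>
          snd s'' (Work 0) ((u + L) * M + r) = fft_part F (2 * L) M (u + L) r" if u: "u < L" and r: "r < M" for u r
      proof -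
        define d where "d = u * M + r"
        have dv: "d div M = u" using r by (simp add: d_def)
        have "u * M + M \<le> h" using u mult_le_mono1[of "Suc u" L M] by (simp add: hLM)
        then have d: "d < h" using r by (simp add: d_def)
        have i: "d + d div M * M = u * (2 * M) + r" "d + d div M * M + M = u * (2 * M) + (r + M)"
          unfolding dv by (simp_all add: d_def mult_2 distrib_left)
        have "X (d + d div M * M) = fft_part F L (2 * M) u r"
          unfolding i(1) using r by (intro X u) simp
        moreover have "X (d + d div M * M + M) = fft_part F L (2 * M) u (r + M)"
          unfolding i(2) using r by (intro X u) simp
        moreover have "real (d div M * M) / real N = real u / real (2 * L)"
          using pos unfolding dv Nh hLM by (simp add: field_simps)
        ultimately have "snd s'' (Work 0) d = fft_part F (2 * L) M u r \<and>
            snd s'' (Work 0) (d + h) = fft_part F (2 * L) M (u + L) r"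
          using * d unfolding stage_rot_def
          by (simp only: fft_part_double[OF pos(1), of F M u r]
              fft_part_double_shift[OF pos(1), of F M u r] simp_thms)
        moreover have "(u + L) * M + r = d + h" by (simp add: d_def hLM algebra_simps)
        ultimately show ?thesis by (simp only: d_def)
      qed
      have "snd s'' (Work 0) (u * M + r) = fft_part F (2 * L) M u r" if "u < 2 * L" "r < M" for u r
      proof (cases "u < L")
        case True
        then show ?thesis using key that by blast
      next
        case False
        then have "u = (u - L) + L" "u - L < L" using that by auto
        then show ?thesis using key[of "u - L" r] that by metis
      qed
      moreover have "M div 2 = 2 ^ p div 2 ^ Suc (Suc t)" unfolding M[symmetric] by (simp add: div_mult2_eq[symmetric] mult.commute)
      ultimately show ?thesis using * unfolding Inv_def M_def[symmetric] by (simp add: L_def)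
    qed
    have "halts fft_stage s' (40 * N) (Inv (Suc t))"
      by (rule halts_mono[OF halts_fft_stage[OF s regs(1) Nh hLM pos(2,1) regs(2,3), folded X_def] order_refl stage])
    moreover have "fst s' 1 = 0" using frame_ready[OF regs(1) s] by (simp add: ready_def)
    ultimately show "fst s' 1 < fst s' 6 \<and> halts fft_stage s' (40 * N) (Inv (Suc t))"
      using regs pos by simp
  next
    fix s' assume "Inv p s'"
    then show "\<not> fst s' 1 < fst s' 6" by (simp add: Inv_def)
  qed
  have "frame s s' \<and> (\<forall>m<N. snd s' (Work 0) m = (\<Sum>n<N. F n * cis (- (2 * pi * (real m * real n / real N)))))"
    if I: "Inv p s'" for s'
  proof (intro conjI allI impI)
    show "frame s s'" using I by (simp add: Inv_def)
    fix m assume "m < N"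
    moreover have "\<forall>u<2 ^ p. snd s' (Work 0) u = fft_part F (2 ^ p) 1 u 0"
      using I by (simp add: Inv_def)
    ultimately have "snd s' (Work 0) m = fft_part F N 1 m 0" by (simp add: N)
    then show "snd s' (Work 0) m = (\<Sum>n<N. F n * cis (- (2 * pi * (real m * real n / real N))))"
      by (simp add: fft_part_def)
  qed
  then show ?thesis unfolding fft_def F_def[symmetric]
    by (intro halts_mono[OF halts_Seq[OF start loop]]) auto
qed

section \<open>Normalisation and running time of a single transform\<close>

definition scale_body :: "'v array \<Rightarrow> complex \<Rightarrow> 'v array instr list" where
  "scale_body R c = [Cx_Of_Nat (Work 3, 1) 0, Cx_Const (Work 2, 1) c, Cx_Mult (Work 3, 1) (Work 3, 1) (Work 2, 1),
     Cx_Div (R, 3) (Work 0, 3) (Work 3, 1), Nat_Add 3 3 2]"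

definition scale :: "'v array \<Rightarrow> complex \<Rightarrow> 'v array prog" where
  "scale R c = Seq (block [Nat_Const 3 0]) (While_Less 3 0 (block (scale_body R c)))"

definition writes_only :: "'v array \<Rightarrow> 'v array state \<Rightarrow> 'v array state \<Rightarrow> bool" where
  "writes_only R s s' \<longleftrightarrow> (\<forall>x. x \<noteq> R \<and> (\<forall>i. x \<noteq> Work i) \<longrightarrow> snd s' x = snd s x)"

lemma halts_scale:
  assumes s: "ready N s" and R: "\<And>i. R \<noteq> Work i"
  shows "halts (scale R c) s (7 * N + 3) (\<lambda>s'. ready N s' \<and> writes_only R s s' \<and>
    (\<forall>m<N. snd s' R m = snd s (Work 0) m / (of_nat N * c)))"
proof -
  define Inv where "Inv n s' \<longleftrightarrow> ready N s' \<and> fst s' 3 = n \<and> snd s' (Work 0) = snd s (Work 0) \<and> writes_only R s s' \<and>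
    (\<forall>m<n. snd s' R m = snd s (Work 0) m / (of_nat N * c))" for n s'
  have start: "halts (block [Nat_Const 3 0]) s 2 (Inv 0)"
    using s by (intro halts_block_length) (simp_all add: Inv_def set_reg_def ready_def writes_only_def)
  have loop: "halts (While_Less 3 0 (block (scale_body R c))) s' (N * (6 + 1) + 1) (Inv N)" if I: "Inv 0 s'" for s'
  proof (rule halts_While[of N Inv, OF _ _ I])
    fix n s' assume n: "n < N" and I: "Inv n s'"
    have r: "fst s' 0 = N" "fst s' 1 = 0" "fst s' (Suc 0) = 0" "fst s' 2 = 1" using I by (auto simp: Inv_def ready_def)
    have "Inv (Suc n) (fold run_instr (scale_body R c) s')"
      using I r R R[symmetric]
      by (auto simp: Inv_def scale_body_def set_reg_def set_cell_def cell_def ready_def writes_only_def less_Suc_eq)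
    then have "halts (block (scale_body R c)) s' 6 (Inv (Suc n))"
      by (intro halts_block_length) (simp_all add: scale_body_def)
    then show "fst s' 3 < fst s' 0 \<and> halts (block (scale_body R c)) s' 6 (Inv (Suc n))"
      using n I r by (simp only: Inv_def)
  qed (simp add: Inv_def ready_def)
  show ?thesis unfolding scale_def
    by (rule halts_mono[OF halts_Seq[OF start loop]]) (auto simp: Inv_def)
qed

definition transform ::
  "'v array \<Rightarrow> complex \<Rightarrow> 'v set list \<Rightarrow> ('v set \<Rightarrow> complex) \<Rightarrow> ('v set \<Rightarrow> complex) \<Rightarrow> real
    \<Rightarrow> 'v list \<Rightarrow> ('v \<Rightarrow> complex) \<Rightarrow> 'v array prog" where
  "transform R c es a b \<omega> vs \<gamma> = Seq (fill es a b \<omega> vs \<gamma>) (Seq fft (scale R c))"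

lemma halts_transform:
  fixes R :: "'v array"
  assumes R: "\<And>i. R \<noteq> Work i"
  shows "\<exists>C. \<forall>p\<ge>1. \<forall>N s. N = 2 ^ p \<longrightarrow> ready N s \<longrightarrow>
    halts (transform R c es a b \<omega> vs \<gamma>) s (C * (N * p)) (\<lambda>s'. ready N s' \<and> writes_only R s s' \<and>
      (\<forall>m<N. snd s' R m = (\<Sum>n<N.
         fft_input N (\<lambda>e. snd s (In_Edge e)) (\<lambda>v. snd s (In_Vertex v) 0) es a b \<omega> vs \<gamma> n
           * cis (- (2 * pi * (real m * real n / real N)))) / (of_nat N * c)))"
proof -
  \<comment> \<open>Both lengths are fixed by the graph and the chosen wave and do not change with
    N; this is what makes C uniform. The terms of order N, p and 1 are absorbed since p is at least
    1.\<close>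
  define l1 where "l1 = length (fill_body es a b \<omega>)"
  define l2 where "l2 = length (add_terms (map (\<lambda>v. (\<gamma> v, 4::nat, (In_Vertex v, 1::nat))) vs))"
  show ?thesis
  proof (intro exI[of _ "l1 + l2 + 100"] allI impI)
    fix p N :: nat and s :: "'v array state"
    assume p: "1 \<le> p" and N: "N = 2 ^ p" and s: "ready N s"
    let ?F = "fft_input N (\<lambda>e. snd s (In_Edge e)) (\<lambda>v. snd s (In_Vertex v) 0) es a b \<omega> vs \<gamma>"
    let ?X = "\<lambda>m. \<Sum>n<N. ?F n * cis (- (2 * pi * (real m * real n / real N)))"
    note 1 = halts_fill[OF s, of es a b \<omega> vs \<gamma>, folded l1_def l2_def]
    have 2: "halts fft s1 (p * (40 * N + 1) + 4) (\<lambda>s'. frame s s' \<and> (\<forall>m<N. snd s' (Work 0) m = ?X m))"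
      if s1: "frame s s1 \<and> (\<forall>n<N. snd s1 (Work 0) n = ?F n)" for s1
    proof -
      have "ready N s1" using s1 s frame_ready by metis
      from halts_fft[OF this N p] show ?thesis
      proof (rule halts_mono[OF _ order_refl])
        fix s' assume s': "frame s1 s' \<and> (\<forall>m<N. snd s' (Work 0) m
          = (\<Sum>n<N. snd s1 (Work 0) n * cis (- (2 * pi * (real m * real n / real N)))))"
        have "frame s s'" using s1 s' frame_trans by metis
        moreover have "(\<Sum>n<N. snd s1 (Work 0) n * cis (- (2 * pi * (real m * real n / real N)))) = ?X m" for m
          using s1 by (intro sum.cong) auto
        ultimately show "frame s s' \<and> (\<forall>m<N. snd s' (Work 0) m = ?X m)" using s' by simp
      qed
    qed
    have 3: "halts (scale R c) s2 (7 * N + 3) (\<lambda>s'. ready N s' \<and> writes_only R s s' \<and>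
      (\<forall>m<N. snd s' R m = ?X m / (of_nat N * c)))"
      if s2: "frame s s2 \<and> (\<forall>m<N. snd s2 (Work 0) m = ?X m)" for s2
    proof -
      have "ready N s2" using s2 s frame_ready by metis
      from halts_scale[OF this R] show ?thesis
      proof (rule halts_mono[OF _ order_refl])
        fix s' assume s': "ready N s' \<and> writes_only R s2 s' \<and>
          (\<forall>m<N. snd s' R m = snd s2 (Work 0) m / (of_nat N * c))"
        have "writes_only R s s'" using s2 s' by (simp add: writes_only_def frame_def)
        with s' s2 show "ready N s' \<and> writes_only R s s' \<and> (\<forall>m<N. snd s' R m = ?X m / (of_nat N * c))"
          by simp
      qed
    qed
    have "1 \<le> N" by (simp add: N)
    then have Np: "N \<le> N * p" "p \<le> N * p" "1 \<le> N * p" using p by auto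
    have "N * (l1 + 2) \<le> (N * p) * (l1 + 2)" using Np(1) by (rule mult_le_mono1)
    moreover have "l2 \<le> (N * p) * l2" using Np(3) by (metis mult_le_mono1 mult_1)
    moreover have "(l1 + l2 + 100) * (N * p) = (N * p) * (l1 + 2) + (N * p) * l2 + 98 * (N * p)"
      by (simp add: algebra_simps)
    moreover have "p * (40 * N + 1) = 40 * (N * p) + p" by (simp add: algebra_simps)
    ultimately have time: "N * (l1 + 2) + l2 + 5 + (p * (40 * N + 1) + 4 + (7 * N + 3)) \<le> (l1 + l2 + 100) * (N * p)"
      using Np by linarith
    show "halts (transform R c es a b \<omega> vs \<gamma>) s ((l1 + l2 + 100) * (N * p)) (\<lambda>s'. ready N s' \<and> writes_only R s s' \<and>
      (\<forall>m<N. snd s' R m = ?X m / (of_nat N * c)))"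
      unfolding transform_def by (rule halts_mono[OF halts_Seq[OF 1 halts_Seq[OF 2 3]] time])
  qed
qed

text \<open>Isolates the dependence on m: one half of the wave meets the forward Fourier kernel, the
  other its conjugate, which the reflection of the input turns into the forward kernel.\<close>

lemma cnj_wave_shift:
  "cnj (wave a b (\<omega> + 2 * real m * pi) (real n / real N))
    = cnj a * cis (- (\<omega> * (real n / real N))) * cis (- (2 * pi * (real m * real n / real N)))
      + cnj b * cis (\<omega> * (real n / real N)) * cis (2 * pi * (real m * real n / real N))"
proof -
  have "(\<omega> + 2 * real m * pi) * (real n / real N) = \<omega> * (real n / real N) + 2 * pi * (real m * real n / real N)"
    by (simp add: algebra_simps)
  then have "cnj (wave a b (\<omega> + 2 * real m * pi) (real n / real N))
      = cnj a * cis (- (\<omega> * (real n / real N)) + - (2 * pi * (real m * real n / real N)))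
        + cnj b * cis (\<omega> * (real n / real N) + 2 * pi * (real m * real n / real N))"
    by (simp only: wave_def complex_cnj_add complex_cnj_mult cis_cnj minus_minus minus_add_distrib)
  then show ?thesis by (simp only: cis_mult[symmetric] mult.assoc)
qed

section \<open>The Fourier transform computes the inner products with the sampled waves\<close>

context refined_graph
begin

text \<open>For continuous coefficients the end value is the same along every edge at
  \<open>v\<close>, so any choice of the edge serves.\<close>

definition vertex_weight :: "complex \<Rightarrow> ('v set \<Rightarrow> complex) \<Rightarrow> ('v set \<Rightarrow> complex) \<Rightarrow> 'v \<Rightarrow> complex" where
  "vertex_weight z a b v = of_nat (card (incident_edges G v)) * cnj (end_val z a b (SOME e. e \<in> incident_edges G v) v)"

lemma fft_computes_inner:
  assumes cont: "continuous_coeffs (cis \<omega>) a b" and f: "f \<in> HN G N"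
    and es: "distinct es" "set es = edges G" and vs: "distinct vs" "set vs = verts G"
  shows "(\<Sum>n<N. fft_input N (\<lambda>e n. f (New e n)) (\<lambda>v. f (Old v)) es a b \<omega> vs (vertex_weight (cis \<omega>) a b) n
      * cis (- (2 * pi * (real m * real n / real N)))) / (of_nat N * of_nat (2 * card (edges G)))
    = inner_N G N f (restrict_N G N (edge_wave G a b (\<omega> + 2 * real m * pi)))"
proof -
  let ?\<omega> = "\<omega> + 2 * real m * pi"
  let ?g = "restrict_N G N (edge_wave G a b ?\<omega>)"
  let ?\<gamma> = "vertex_weight (cis \<omega>) a b"
  let ?c = "\<lambda>n. cis (- (2 * pi * (real m * real n / real N)))"
  have "?\<omega> = \<omega> + 2 * pi * real m" by simp
  then have cis: "cis ?\<omega> = cis \<omega>" by (simp only: cis_mult[symmetric]) simp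
  note g = restrict_edge_wave_sp[OF cont[folded cis]]
  \<comment> \<open>\<open>New e 0\<close> and \<open>New e N\<close> are not vertices, so the input
    arrays hold 0 there and sums over n < N reduce to interior points, reflected or not.\<close>
  have f0: "f (New e 0) = 0" "f (New e N) = 0" for e using f by (auto simp: HN_def rverts_def)
  have old: "of_nat (rdeg G N (Old v)) * f (Old v) * cnj (?g (Old v)) = ?\<gamma> v * f (Old v)" if v: "v \<in> verts G" for v
  proof -
    have "(SOME e. e \<in> incident_edges G v) \<in> incident_edges G v"
      by (rule some_in_eq[THEN iffD2, OF incident_nonempty[OF v]])
    from end_val_wave[of ?g a b ?\<omega>, OF g this]
    have "end_val (cis \<omega>) a b (SOME e. e \<in> incident_edges G v) v = ?g (Old v)" unfolding cis .
    then show ?thesis by (simp only: vertex_weight_def rdeg_Old mult_ac)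
  qed
  have edge: "(\<Sum>n\<in>{0<..<N}. of_nat (rdeg G N (New e n)) * f (New e n) * cnj (?g (New e n)))
      = (\<Sum>n<N. (2 * cnj (a e) * cis (- (\<omega> * (real n / real N))) * f (New e n)
         + 2 * cnj (b e) * cis (\<omega> * (real (N - n) / real N)) * f (New e (N - n))) * ?c n)"
    if e: "e \<in> edges G" for e
  proof -
    have N: "{..<N} = insert 0 {0<..<N}" using N_pos by auto
    have "(\<Sum>n<N. 2 * cnj (b e) * cis (\<omega> * (real (N - n) / real N)) * f (New e (N - n)) * ?c n)
        = (\<Sum>n\<in>{0<..<N}. 2 * cnj (b e) * cis (\<omega> * (real (N - n) / real N)) * f (New e (N - n)) * ?c n)"
      unfolding N by (simp add: f0)
    also have "\<dots> = (\<Sum>n\<in>{0<..<N}. 2 * cnj (b e) * cis (\<omega> * (real n / real N)) * f (New e n)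
        * cis (2 * pi * (real m * real n / real N)))"
    proof (rule sum.reindex_bij_witness[of _ "\<lambda>n. N - n" "\<lambda>n. N - n"])
      fix n assume n: "n \<in> {0<..<N}"
      \<comment> \<open>Reflection conjugates the kernel because m (N - n)/N and - m n/N differ by
        the integer m.\<close>
      have "2 * pi * (real m * real (N - n) / real N) = - (2 * pi * (real m * real n / real N)) + 2 * pi * real m"
        using n by (simp add: of_nat_diff field_simps)
      then have "cis (2 * pi * (real m * real (N - n) / real N)) = ?c n"
        by (simp only: cis_mult[symmetric]) simp
      then show "2 * cnj (b e) * cis (\<omega> * (real (N - n) / real N)) * f (New e (N - n))
          * cis (2 * pi * (real m * real (N - n) / real N))
        = 2 * cnj (b e) * cis (\<omega> * (real (N - n) / real N)) * f (New e (N - n)) * ?c n" by simp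
    qed auto
    finally have refl_part: "(\<Sum>n<N. 2 * cnj (b e) * cis (\<omega> * (real (N - n) / real N)) * f (New e (N - n)) * ?c n)
        = (\<Sum>n\<in>{0<..<N}. 2 * cnj (b e) * cis (\<omega> * (real n / real N)) * f (New e n)
          * cis (2 * pi * (real m * real n / real N)))" .
    have dir_part: "(\<Sum>n<N. 2 * cnj (a e) * cis (- (\<omega> * (real n / real N))) * f (New e n) * ?c n)
        = (\<Sum>n\<in>{0<..<N}. 2 * cnj (a e) * cis (- (\<omega> * (real n / real N))) * f (New e n) * ?c n)"
      unfolding N by (simp add: f0)
    show ?thesis unfolding distrib_right sum.distrib refl_part dir_part unfolding sum.distrib[symmetric]
    proof (rule sum.cong[OF refl])
      fix n assume n: "n \<in> {0<..<N}"
      have "?g (New e n) = wave (a e) (b e) ?\<omega> (real n / real N)"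
        using g[OF e, of n] n by (simp add: sp_simps)
      then show "of_nat (rdeg G N (New e n)) * f (New e n) * cnj (?g (New e n))
          = 2 * cnj (a e) * cis (- (\<omega> * (real n / real N))) * f (New e n) * ?c n
            + 2 * cnj (b e) * cis (\<omega> * (real n / real N)) * f (New e n) * cis (2 * pi * (real m * real n / real N))"
        using n e by (simp only: cnj_wave_shift) (simp add: rdeg_New algebra_simps)
    qed
  qed
  have "(\<Sum>v\<in>rverts G N. of_nat (rdeg G N v) * f v * cnj (?g v))
      = (\<Sum>v\<in>verts G. ?\<gamma> v * f (Old v)) + (\<Sum>e\<in>edges G. \<Sum>n<N. (2 * cnj (a e) * cis (- (\<omega> * (real n / real N))) * f (New e n)
         + 2 * cnj (b e) * cis (\<omega> * (real (N - n) / real N)) * f (New e (N - n))) * ?c n)"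
    unfolding sum_rverts by (simp only: old edge cong: sum.cong)
  also have "(\<Sum>e\<in>edges G. \<Sum>n<N. (2 * cnj (a e) * cis (- (\<omega> * (real n / real N))) * f (New e n)
         + 2 * cnj (b e) * cis (\<omega> * (real (N - n) / real N)) * f (New e (N - n))) * ?c n)
      = (\<Sum>n<N. edge_input N (\<lambda>e n. f (New e n)) es a b \<omega> n * ?c n)"
    unfolding edge_input_def sum_list_distinct_conv_sum_set[OF es(1)] es(2) sum_distrib_right
    by (rule sum.swap)
  also have "(\<Sum>v\<in>verts G. ?\<gamma> v * f (Old v)) = (\<Sum>n<N. (if n = 0 then (\<Sum>v\<leftarrow>vs. ?\<gamma> v * f (Old v)) else 0) * ?c n)"
  proof -
    have "(\<Sum>n<N. (if n = 0 then (\<Sum>v\<leftarrow>vs. ?\<gamma> v * f (Old v)) else 0) * ?c n)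
        = (\<Sum>n<N. if n = 0 then (\<Sum>v\<leftarrow>vs. ?\<gamma> v * f (Old v)) else 0)"
      by (intro sum.cong) auto
    then show ?thesis using N_pos by (simp add: sum_list_distinct_conv_sum_set[OF vs(1)] vs(2))
  qed
  also have "(\<Sum>n<N. (if n = 0 then (\<Sum>v\<leftarrow>vs. ?\<gamma> v * f (Old v)) else 0) * ?c n)
      + (\<Sum>n<N. edge_input N (\<lambda>e n. f (New e n)) es a b \<omega> n * ?c n)
      = (\<Sum>n<N. fft_input N (\<lambda>e n. f (New e n)) (\<lambda>v. f (Old v)) es a b \<omega> vs ?\<gamma> n * ?c n)"
    unfolding sum.distrib[symmetric] fft_input_def by (intro sum.cong) (auto simp: distrib_right)
  finally show ?thesis by (simp add: inner_N_def mult_ac)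
qed

end

theorem theorem4p2:
  fixes G :: "'v mgraph"
    and K I0 :: nat and I :: "nat \<Rightarrow> nat"
    and \<omega>0 :: "nat \<Rightarrow> real"
    and \<psi>0 :: "nat \<Rightarrow> 'v gfun"
    and \<Psi> :: "nat \<Rightarrow> nat \<Rightarrow> 'v gfun"
    and A B :: "nat \<Rightarrow> nat \<Rightarrow> 'v set \<Rightarrow> complex"
  assumes graph: "finite_simple_graph G"
    and degree: "\<And>v. v \<in> verts G \<Longrightarrow> card (incident_edges G v) \<ge> 2"
    and freq_mono: "strict_mono_on {1..K} \<omega>0"
    and freq_all: "\<omega>0 ` {1..K} = {\<omega>. 0 < \<omega> \<and> \<omega> \<le> 2 * pi \<and> eigenvalue_inf G (\<omega>\<^sup>2)}"
    and basis_zero: "is_onb (inner_inf G) (eigenspace_inf G 0) I0 \<psi>0"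
    and basis: "\<And>k. k \<in> {1..K} \<Longrightarrow>
      is_onb (inner_inf G) (eigenspace_inf G ((\<omega>0 k)\<^sup>2)) (I k) (\<Psi> k)"
    and coeffs: "\<And>k j e x. k \<in> {1..K} \<Longrightarrow> j \<in> {1..I k} \<Longrightarrow> e \<in> edges G \<Longrightarrow> x \<in> {0..1} \<Longrightarrow>
      \<Psi> k j (e, x) = A k j e * exp (\<i> * of_real (\<omega>0 k * x))
                   + B k j e * exp (- \<i> * of_real (\<omega>0 k * x))"
  shows
    "(\<forall>N>0.
        (\<forall>f\<in>HN G N.
           (\<forall>j\<in>{1..I0}. dft_zero G N \<psi>0 (Delta_N G N f) j = 0) \<and>
           (\<forall>(m, k)\<in>dft_index N K \<omega>0. \<forall>j\<in>{1..I k}.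
              dft G N \<omega>0 A B (Delta_N G N f) m k j
                = of_real (mu N \<omega>0 m k) * dft G N \<omega>0 A B f m k j)) \<and>
        (\<forall>(m, k)\<in>dft_index N K \<omega>0. \<exists>d b. is_B_matrix G N \<omega>0 A B I m k d b) \<and>
        (\<forall>d b. (\<forall>(m, k)\<in>dft_index N K \<omega>0. is_B_matrix G N \<omega>0 A B I m k (d m k) (b m k)) \<longrightarrow>
           (\<forall>f\<in>HN G N. \<forall>g\<in>HN G N.
              inner_N G N f g =
                (\<Sum>j=1..I0. dft_zero G N \<psi>0 f j * cnj (dft_zero G N \<psi>0 g j)) +
                (\<Sum>(m, k)\<in>dft_index N K \<omega>0. B_inner (d m k) (I k) (b m k)
                   (dft G N \<omega>0 A B f m k) (dft G N \<omega>0 A B g m k))))) \<and>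
     (\<exists>P :: 'v array prog. \<exists>C :: real. \<forall>p\<ge>1. \<forall>N. N = 2 ^ p \<longrightarrow>
        (\<forall>f\<in>HN G N. \<exists>t s. runs P (input_state N f) t s \<and>
           real t \<le> C * (real N * log 2 (real N)) \<and>
           holds_dft G N K \<omega>0 I0 I \<psi>0 A B f s))"
    (is "(\<forall>N>0. ?spectral N) \<and> ?fast")
proof -
  have gd: "graph_dft G N K I0 I \<omega>0 \<psi>0 \<Psi> A B" if "0 < N" for N
    by unfold_locales (use that assms in auto)
  have ?fast
  proof -
    have fin: "finite (edges G)" "finite (verts G)"
      using refined_graph.finite_edges refined_graph.finite_verts gd[of 1] by (auto simp: graph_dft_def)
    obtain es where es: "distinct es" "set es = edges G" using finite_distinct_list[OF fin(1)] by blast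
    obtain vs where vs: "distinct vs" "set vs = verts G" using finite_distinct_list[OF fin(2)] by blast
    define Rs :: "'v array list" where
      "Rs = map Out_Zero [1..<Suc I0] @ concat (map (\<lambda>k. map (Out k) [1..<Suc (I k)]) [1..<Suc K])"
    \<comment> \<open>Every output array is assigned a wave. A kernel basis function is one of
      frequency 0 with second coefficient 0, so both kinds of output come from the same
      program.\<close>
    define a where "a R = (case R of Out_Zero j \<Rightarrow> (\<lambda>e. \<psi>0 j (e, 0)) | Out k j \<Rightarrow> A k j | _ \<Rightarrow> \<lambda>_. 0)" for R :: "'v array"
    define b where "b R = (case R of Out k j \<Rightarrow> B k j | _ \<Rightarrow> \<lambda>_. 0)" for R :: "'v array"
    define w where "w R = (case R of Out k j \<Rightarrow> \<omega>0 k | _ \<Rightarrow> 0)" for R :: "'v array"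
    define \<gamma> where "\<gamma> R = refined_graph.vertex_weight G (cis (w R)) (a R) (b R)" for R
    define E where "E = (of_nat (2 * card (edges G)) :: complex)"
    define TR where "TR R = transform R E es (a R) (b R) (w R) vs (\<gamma> R)" for R
    define val where "val f N R m = (\<Sum>n<N. fft_input N (\<lambda>e n. f (New e n)) (\<lambda>v. f (Old v)) es (a R) (b R) (w R) vs (\<gamma> R) n
      * cis (- (2 * pi * (real m * real n / real N)))) / (of_nat N * E)" for f N R m
    define inputs where "inputs f s \<longleftrightarrow> (\<forall>v. snd s (In_Vertex v) 0 = f (Old v)) \<and> (\<forall>e n. snd s (In_Edge e) n = f (New e n))"
      for f and s :: "'v array state"
    have Rs_set: "set Rs = Out_Zero ` {1..I0} \<union> {Out k j |k j. k \<in> {1..K} \<and> j \<in> {1..I k}}"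
    proof -
      have "set [1..<Suc n] = {1..n}" for n by (simp only: set_upt atLeastLessThanSuc_atLeastAtMost)
      then show ?thesis by (simp only: Rs_def set_append set_concat set_map) auto
    qed
    have Rs: "R \<noteq> Work i" "R \<noteq> In_Vertex v" "R \<noteq> In_Edge e" if "R \<in> set Rs" for R i v e
      using that by (auto simp: Rs_set)
    have "\<forall>R\<in>set Rs. \<exists>C. \<forall>p\<ge>1. \<forall>N s f. N = 2 ^ p \<longrightarrow> ready N s \<and> inputs f s \<longrightarrow>
      halts (TR R) s (C * (N * p)) (\<lambda>s'. ready N s' \<and> writes_only R s s' \<and> (\<forall>m<N. snd s' R m = val f N R m))"
    proof
      fix R assume "R \<in> set Rs"
      then obtain C where C: "\<forall>p\<ge>1. \<forall>N s. N = 2 ^ p \<longrightarrow> ready N s \<longrightarrow>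
        halts (TR R) s (C * (N * p)) (\<lambda>s'. ready N s' \<and> writes_only R s s' \<and>
        (\<forall>m<N. snd s' R m = (\<Sum>n<N.
         fft_input N (\<lambda>e. snd s (In_Edge e)) (\<lambda>v. snd s (In_Vertex v) 0) es (a R) (b R) (w R) vs (\<gamma> R) n
           * cis (- (2 * pi * (real m * real n / real N)))) / (of_nat N * E)))"
        using halts_transform[of R E es "a R" "b R" "w R" vs "\<gamma> R"] Rs(1) unfolding TR_def by blast
      have "halts (TR R) s (C * (N * p)) (\<lambda>s'. ready N s' \<and> writes_only R s s' \<and> (\<forall>m<N. snd s' R m = val f N R m))"
        if "1 \<le> p" "N = 2 ^ p" "ready N s" "inputs f s" for p N s f
      proof -
        have "(\<lambda>e. snd s (In_Edge e)) = (\<lambda>e n. f (New e n))" "(\<lambda>v. snd s (In_Vertex v) 0) = (\<lambda>v. f (Old v))"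
          using that(4) by (auto simp: inputs_def fun_eq_iff)
        then show ?thesis using C[rule_format, OF that(1-3)] unfolding val_def by simp
      qed
      then show "\<exists>C. \<forall>p\<ge>1. \<forall>N s f. N = 2 ^ p \<longrightarrow> ready N s \<and> inputs f s \<longrightarrow>
        halts (TR R) s (C * (N * p)) (\<lambda>s'. ready N s' \<and> writes_only R s s' \<and> (\<forall>m<N. snd s' R m = val f N R m))"
        by blast
    qed
    from bchoice[OF this] obtain C where C: "\<And>R p N s f. R \<in> set Rs \<Longrightarrow> 1 \<le> p \<Longrightarrow> N = 2 ^ p \<Longrightarrow> ready N s \<Longrightarrow> inputs f s \<Longrightarrow>
      halts (TR R) s (C R * (N * p)) (\<lambda>s'. ready N s' \<and> writes_only R s s' \<and> (\<forall>m<N. snd s' R m = val f N R m))"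
      by blast
    \<comment> \<open>One constant for all outputs, whose list depends only on the numbers
      \<open>I0\<close>, \<open>K\<close> and \<open>I k\<close>.\<close>
    define C' where "C' = sum C (set Rs)"
    \<comment> \<open>Register 2 is set to 1 as \<open>ready\<close> demands; registers 0 and 1 are
      right from the start.\<close>
    define P where "P = Seq (Instr (Nat_Const 2 1)) (seqs (map TR Rs))"
    show ?thesis
    \<comment> \<open>The 2 covers the initial instruction and the empty program at the end of the
      list.\<close>
    proof (intro exI[of _ P] exI[of _ "real (length Rs * C' + 2)"] allI impI ballI)
      fix p N :: nat and f
      assume p: "1 \<le> p" and N: "N = 2 ^ p" and f: "f \<in> HN G N"
      interpret graph_dft G N K I0 I \<omega>0 \<psi>0 \<Psi> A B by (rule gd) (simp add: N)
      define J where "J i s \<longleftrightarrow> ready N s \<and> inputs f s \<and> (\<forall>i'<i. \<forall>m<N. snd s (Rs ! i') m = val f N (Rs ! i') m)" for i s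
      have "halts (Instr (Nat_Const 2 1)) (input_state N f) 1 (J 0)"
        by (rule halts_Instr) (simp add: J_def ready_def inputs_def input_state_def set_reg_def)
      moreover have "halts (seqs (map TR Rs)) s (length (map TR Rs) * (C' * (N * p)) + 1) (J (length (map TR Rs)))"
        if "J 0 s" for s
      proof (rule halts_seqs[where J = J, OF _ that])
        fix i s assume i: "i < length (map TR Rs)" and J: "J i s"
        then have R: "Rs ! i \<in> set Rs" by simp
        have J': "ready N s" "inputs f s" using J by (auto simp: J_def)
        have "C (Rs ! i) \<le> C'" unfolding C'_def by (rule member_le_sum) (use R in auto)
        then have time: "C (Rs ! i) * (N * p) \<le> C' * (N * p)" by (rule mult_le_mono1)
        have "J (Suc i) s'" if s': "ready N s' \<and> writes_only (Rs ! i) s s' \<and> (\<forall>m<N. snd s' (Rs ! i) m = val f N (Rs ! i) m)" for s'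
        proof -
          have "inputs f s'" using s' J'(2) Rs(2,3)[OF R, symmetric] by (simp add: inputs_def writes_only_def)
          \<comment> \<open>Arrays are compared by name: an equal name has just been written with
            the same value, any other output is untouched.\<close>
          moreover have "snd s' (Rs ! i') m = val f N (Rs ! i') m" if "i' < Suc i" "m < N" for i' m
          proof (cases "Rs ! i' = Rs ! i")
            case True
            then show ?thesis using s' that by simp
          next
            case False
            then have "i' < i" using that by (auto simp: less_Suc_eq)
            moreover have "Rs ! i' \<in> set Rs" using \<open>i' < i\<close> i by simp
            then have "snd s' (Rs ! i') = snd s (Rs ! i')" using s' False Rs(1) by (simp add: writes_only_def)
            ultimately show ?thesis using J that by (simp add: J_def)
          qed
          ultimately show ?thesis using s' by (simp add: J_def)
        qed
        then show "halts (map TR Rs ! i) s (C' * (N * p)) (J (Suc i))"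
          using halts_mono[OF C[OF R p N J'] time] i by simp
      qed
      ultimately have "halts P (input_state N f) (1 + (length (map TR Rs) * (C' * (N * p)) + 1)) (J (length (map TR Rs)))"
        unfolding P_def by (rule halts_Seq)
      then obtain t s where ts: "runs P (input_state N f) t s" "t \<le> 1 + (length Rs * (C' * (N * p)) + 1)" "J (length Rs) s"
        by (auto simp: halts_def)
      have "1 \<le> N * p" using p by (simp add: N)
      moreover have "(length Rs * C' + 2) * (N * p) = length Rs * (C' * (N * p)) + N * p + N * p"
        by (simp add: algebra_simps)
      ultimately have "t \<le> (length Rs * C' + 2) * (N * p)" using ts(2) by linarith
      then have "real t \<le> real ((length Rs * C' + 2) * (N * p))" by (rule of_nat_mono)
      moreover have "log 2 (real N) = real p" by (simp add: N log_nat_power)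
      ultimately have time: "real t \<le> real (length Rs * C' + 2) * (real N * log 2 (real N))"
        by (simp only: of_nat_mult)
      have out: "snd s R m = val f N R m" if "R \<in> set Rs" "m < N" for R m
        using ts(3) that unfolding J_def by (metis in_set_conv_nth)
      have val: "val f N R m = inner_N G N f (restrict_N G N (edge_wave G (a R) (b R) (w R + 2 * real m * pi)))"
        if "continuous_coeffs (cis (w R)) (a R) (b R)" for R m
        unfolding val_def \<gamma>_def E_def by (rule fft_computes_inner[OF that f es vs])
      have "holds_dft G N K \<omega>0 I0 I \<psi>0 A B f s"
        unfolding holds_dft_def
      proof (intro conjI ballI)
        fix j assume j: "j \<in> {1..I0}"
        have "snd s (Out_Zero j) 0 = val f N (Out_Zero j) 0" using j N by (intro out) (auto simp: Rs_set)
        also have "\<dots> = dft_zero G N \<psi>0 f j"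
          using val[of "Out_Zero j" 0] psi0_coeffs[OF j] Phi0_eq[OF j] by (simp add: a_def b_def w_def dft_zero_def)
        finally show "snd s (Out_Zero j) 0 = dft_zero G N \<psi>0 f j" .
      next
        fix q assume q: "q \<in> dft_index N K \<omega>0"
        obtain m k where mk: "q = (m, k)" by fastforce
        have k: "k \<in> {1..K}" and le: "freq \<omega>0 m k \<le> real N * pi" using q by (auto simp: mk dft_index_def)
        \<comment> \<open>Even 2 m < N holds, so the coefficient is among the N entries that the
          transform produces.\<close>
        have "real m * pi + real m * pi < real N * pi" using le freq0(1)[OF k] unfolding freq_def by linarith
        moreover have "0 \<le> real m * pi" by simp
        ultimately have "real m * pi < real N * pi" by linarith
        then have m: "m < N" by simp
        have "snd s (Out k j) m = dft G N \<omega>0 A B f m k j" if j: "j \<in> {1..I k}" for j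
        proof -
          have "snd s (Out k j) m = val f N (Out k j) m" using j k m by (intro out) (auto simp: Rs_set)
          also have "\<dots> = dft G N \<omega>0 A B f m k j"
            using val[of "Out k j" m] Psi_coeffs(1)[OF k j] by (simp add: a_def b_def w_def dft_def Phi_def freq_def)
          finally show ?thesis .
        qed
        then show "case q of (m, k) \<Rightarrow> \<forall>j\<in>{1..I k}. snd s (Out k j) m = dft G N \<omega>0 A B f m k j"
          by (simp add: mk)
      qed
      with ts(1) time show "\<exists>t s. runs P (input_state N f) t s \<and>
           real t \<le> real (length Rs * C' + 2) * (real N * log 2 (real N)) \<and>
           holds_dft G N K \<omega>0 I0 I \<psi>0 A B f s" by blast
    qed
  qed
  moreover have "?spectral N" if "0 < N" for N
  proof -
    interpret graph_dft G N K I0 I \<omega>0 \<psi>0 \<Psi> A B by (rule gd) (rule that)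
    show ?thesis
      using dft_zero_Delta dft_Delta is_B_matrix_exists dft_isometry
      by (intro conjI allI impI ballI) auto
  qed
  ultimately show ?thesis by blast
qed

end
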